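(* Let $D$ be a $2$-dimensional regular local ring with maximal ideal $\mathfrak{m}_D=(x,y)D$ and with an algebraically closed coefficient field $k$. For each $a\in k$ let $$\alpha_a=D\Big[\tfrac{x+ay}{y}\Big]_{(y,\frac{x+ay}{y})},\qquad \beta_a=\alpha_a\Big[\tfrac{y^2}{x+ay}\Big]_{(\frac{x+ay}{y},\frac{y^2}{x+ay})},$$ (localizations at the ideals generated by the indicated elements), and let $B=\bigcap_{a\in k}\beta_a$. Then $B$ is an almost Krull domain that is not Noetherian, and the family $\{\beta_a: a\in k\}$ defines an irredundant essential representation of $B$.
   Context: A coefficient field of $D$ is a subfield $k\subseteq D$ mapping isomorphically onto $D/\mathfrak{m}_D$. An integral domain $B$ is an almost Krull domain if $B_P$ is a Krull domain for every prime ideal $P$ of $B$. The representation $B=\bigcap_{a\in k}\beta_a$ is irredundant if for every $b\in k$, $\bigcap_{a\neq b}\beta_a\neq B$; it is essential if each $\beta_a$ is a localization of $B$ at a prime ideal of $B$. *)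

theory Defs
  imports Main
begin

text \<open>All rings are subrings of an ambient field of type 'a (e.g. the quotient field
of D); localizations, ring adjunctions and intersections are taken inside it.\<close>

definition subring :: "'a::field set \<Rightarrow> bool" where
  "subring R \<longleftrightarrow> 0 \<in> R \<and> 1 \<in> R \<and>
     (\<forall>a\<in>R. \<forall>b\<in>R. a + b \<in> R \<and> - a \<in> R \<and> a * b \<in> R)"

definition subfield :: "'a::field set \<Rightarrow> bool" where
  "subfield k \<longleftrightarrow> subring k \<and> (\<forall>a\<in>k. a \<noteq> 0 \<longrightarrow> inverse a \<in> k)"

definition ideal_of :: "'a::field set \<Rightarrow> 'a set \<Rightarrow> bool" where
  "ideal_of R I \<longleftrightarrow> I \<subseteq> R \<and> 0 \<in> I \<and>
     (\<forall>a\<in>I. \<forall>b\<in>I. a + b \<in> I) \<and> (\<forall>r\<in>R. \<forall>a\<in>I. r * a \<in> I)"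

definition genideal :: "'a::field set \<Rightarrow> 'a set \<Rightarrow> 'a set" where
  "genideal R S = {\<Sum>s\<in>F. c s * s | F c. finite F \<and> F \<subseteq> S \<and> (\<forall>s\<in>F. c s \<in> R)}"

definition prime_ideal_of :: "'a::field set \<Rightarrow> 'a set \<Rightarrow> bool" where
  "prime_ideal_of R P \<longleftrightarrow> ideal_of R P \<and> P \<noteq> R \<and>
     (\<forall>a\<in>R. \<forall>b\<in>R. a * b \<in> P \<longrightarrow> a \<in> P \<or> b \<in> P)"

definition maximal_ideal_of :: "'a::field set \<Rightarrow> 'a set \<Rightarrow> bool" where
  "maximal_ideal_of R M \<longleftrightarrow> ideal_of R M \<and> M \<noteq> R \<and>
     (\<forall>J. ideal_of R J \<and> M \<subseteq> J \<longrightarrow> J = M \<or> J = R)"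

definition local_ring :: "'a::field set \<Rightarrow> 'a set \<Rightarrow> bool" where
  "local_ring R M \<longleftrightarrow> maximal_ideal_of R M \<and> (\<forall>M'. maximal_ideal_of R M' \<longrightarrow> M' = M)"

definition noetherian :: "'a::field set \<Rightarrow> bool" where
  "noetherian R \<longleftrightarrow> (\<forall>I. ideal_of R I \<longrightarrow> (\<exists>F. finite F \<and> F \<subseteq> I \<and> I = genideal R F))"

definition dim_ge :: "'a::field set \<Rightarrow> nat \<Rightarrow> bool" where
  "dim_ge R n \<longleftrightarrow> (\<exists>P :: nat \<Rightarrow> 'a set. (\<forall>i\<le>n. prime_ideal_of R (P i)) \<and> (\<forall>i<n. P i \<subset> P (Suc i)))"

definition krull_dim_eq :: "'a::field set \<Rightarrow> nat \<Rightarrow> bool" where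
  "krull_dim_eq R n \<longleftrightarrow> dim_ge R n \<and> \<not> dim_ge R (Suc n)"

definition regular_local_dim2 :: "'a::field set \<Rightarrow> 'a \<Rightarrow> 'a \<Rightarrow> bool" where
  "regular_local_dim2 D x y \<longleftrightarrow> subring D \<and> x \<in> D \<and> y \<in> D \<and> noetherian D \<and>
     local_ring D (genideal D {x, y}) \<and> krull_dim_eq D 2"

definition coefficient_field :: "'a::field set \<Rightarrow> 'a set \<Rightarrow> 'a set \<Rightarrow> bool" where
  "coefficient_field D M k \<longleftrightarrow> subfield k \<and> k \<subseteq> D \<and> (\<forall>d\<in>D. \<exists>!c. c \<in> k \<and> d - c \<in> M)"

definition alg_closed_subfield :: "'a::field set \<Rightarrow> bool" where
  "alg_closed_subfield k \<longleftrightarrow> subfield k \<and>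
     (\<forall>n c. n \<ge> 1 \<and> (\<forall>i<n. c i \<in> k) \<longrightarrow> (\<exists>r\<in>k. r ^ n + (\<Sum>i<n. c i * r ^ i) = 0))"

definition adjoin :: "'a::field set \<Rightarrow> 'a \<Rightarrow> 'a set" where
  "adjoin R t = {\<Sum>i\<le>n. c i * t ^ i | n c. \<forall>i. c i \<in> R}"

definition loc :: "'a::field set \<Rightarrow> 'a set \<Rightarrow> 'a set" where
  "loc R P = {r / s | r s. r \<in> R \<and> s \<in> R \<and> s \<notin> P}"

definition frac :: "'a::field set \<Rightarrow> 'a set" where
  "frac R = {r / s | r s. r \<in> R \<and> s \<in> R \<and> s \<noteq> 0}"

definition dvr_of :: "'a::field set \<Rightarrow> 'a set \<Rightarrow> bool" where
  "dvr_of L V \<longleftrightarrow> (\<exists>v :: 'a \<Rightarrow> int.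
     (\<forall>n. \<exists>z\<in>L. z \<noteq> 0 \<and> v z = n) \<and>
     (\<forall>a\<in>L. \<forall>b\<in>L. a \<noteq> 0 \<and> b \<noteq> 0 \<longrightarrow> v (a * b) = v a + v b) \<and>
     (\<forall>a\<in>L. \<forall>b\<in>L. a \<noteq> 0 \<and> b \<noteq> 0 \<and> a + b \<noteq> 0 \<longrightarrow> v (a + b) \<ge> min (v a) (v b)) \<and>
     V = {z \<in> L. z = 0 \<or> v z \<ge> 0})"

definition krull_domain :: "'a::field set \<Rightarrow> bool" where
  "krull_domain R \<longleftrightarrow> subring R \<and> (\<exists>\<V>. (\<forall>V\<in>\<V>. dvr_of (frac R) V) \<and>
     R = frac R \<inter> \<Inter>\<V> \<and>
     (\<forall>z\<in>R. z \<noteq> 0 \<longrightarrow> finite {V\<in>\<V>. inverse z \<notin> V}))"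

definition almost_krull :: "'a::field set \<Rightarrow> bool" where
  "almost_krull B \<longleftrightarrow> subring B \<and> (\<forall>P. prime_ideal_of B P \<longrightarrow> krull_domain (loc B P))"

definition alpha_ring :: "'a::field set \<Rightarrow> 'a \<Rightarrow> 'a \<Rightarrow> 'a \<Rightarrow> 'a set" where
  "alpha_ring D x y a = (let t = (x + a * y) / y; R = adjoin D t in loc R (genideal R {y, t}))"

definition beta_ring :: "'a::field set \<Rightarrow> 'a \<Rightarrow> 'a \<Rightarrow> 'a \<Rightarrow> 'a set" where
  "beta_ring D x y a = (let t = (x + a * y) / y; u = y ^ 2 / (x + a * y);
      R = adjoin (alpha_ring D x y a) u in loc R (genideal R {t, u}))"

end

theory Submission
  imports "HOL-Computational_Algebra.Polynomial" Defs
begin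

text \<open>
  Write \<open>t = (x + ay)/y\<close> and \<open>u = y/t\<close>. The parameters of \<open>\<alpha>\<close> at a are y and t, those of \<open>\<beta>\<close> are
  t and u, and both rings arise by the same step \<open>(R, p, q) \<mapsto> (R[p/q] localized at (q, p/q), q, p/q)\<close>.
  D is a unique factorization domain; the step preserves unique factorization by Nagata's criterion,
  since inverting q turns the new ring into a localization of the old one and q remains prime.

  For distinct a and b the element t of a is a unit at b, and u of a lies in the maximal ideal at b.
  Hence the reciprocal of t at b separates \<open>\<beta>\<close> at b from the other members of the family, every u lies
  in B, which makes \<open>\<beta>\<close> a localization of B, and the elements \<open>y / (t\<^sub>1 \<cdots> t\<^sub>n)\<close> generate a strictly
  increasing chain of ideals of B.

  Let P be a prime of B. If y is not in P, then \<open>B\<^sub>P\<close> is an overring of \<open>D[1/y]\<close>, a principal ideal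
  domain, hence a localization of D. If y is in P, then P is contained in the center of some \<open>\<beta>\<close>:
  when some t lies in P, a polynomial in u over k with non-zero constant term is a unit of B, and when
  none does, all u lie in P and a non-zero polynomial in t over k avoids P because k is algebraically
  closed. So \<open>B\<^sub>P\<close> is a localization of a factorial ring in either case, hence a Krull domain.
\<close>

section \<open>Subrings and ideals of a field\<close>

text \<open>Only D is Noetherian by hypothesis. Carrying that property and the dimension through
  each transform is avoided: the transforms carry the explicit conditions of
  \<open>param_ring\<close>, in which \<open>separated\<close> (the ideals (p, q^n) meet in pR)
  stands in for Krull's intersection theorem. One fact drives the step. As p is prime and does not
  divide q, all relations of p/q over R come from qX - p, so R[p/q] modulo q is the polynomial ring
  k[t]. Hence q is prime there, (q, t) has residue field k, and \<open>separated\<close> is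
  inherited because a non-zero polynomial over k is a power of t times a unit of the localization.
  Nagata's criterion also needs each non-zero element to have finite order at q; this comes from
  comparing the multiples of q^n in R[p/q] with the n-th power of (p, q). For D itself all arguments
  run modulo x, where D behaves like a discrete valuation ring with uniformizer y. The same results
  with x and y exchanged describe D[1/y]. Replacing x by x + ay changes neither the maximal ideal of
  D nor the ring D[x/y]. So one construction serves every a, and D[x/y] is a common subring of the
  whole family.\<close>

lemma subring_0: "subring R \<Longrightarrow> 0 \<in> R"
  and subring_1: "subring R \<Longrightarrow> 1 \<in> R"
  and subring_add: "subring R \<Longrightarrow> a \<in> R \<Longrightarrow> b \<in> R \<Longrightarrow> a + b \<in> R"
  and subring_mult: "subring R \<Longrightarrow> a \<in> R \<Longrightarrow> b \<in> R \<Longrightarrow> a * b \<in> R"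
  and subring_uminus: "subring R \<Longrightarrow> a \<in> R \<Longrightarrow> - a \<in> R"
  unfolding subring_def by auto

lemma subring_diff: "subring R \<Longrightarrow> a \<in> R \<Longrightarrow> b \<in> R \<Longrightarrow> a - b \<in> R"
  using subring_add[of R a "- b"] subring_uminus[of R b] by simp

lemma subring_power: "subring R \<Longrightarrow> a \<in> R \<Longrightarrow> a ^ n \<in> R"
  by (induction n) (auto intro: subring_1 subring_mult)

lemma subring_sum: "subring R \<Longrightarrow> (\<And>i. i \<in> A \<Longrightarrow> f i \<in> R) \<Longrightarrow> sum f A \<in> R"
  by (induction A rule: infinite_finite_induct) (auto intro: subring_0 subring_add)

lemmas subring_closed =
  subring_0 subring_1 subring_add subring_mult subring_uminus subring_diff subring_power

lemma ideal_0: "ideal_of R I \<Longrightarrow> 0 \<in> I"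
  and ideal_sub: "ideal_of R I \<Longrightarrow> a \<in> I \<Longrightarrow> a \<in> R"
  and ideal_add: "ideal_of R I \<Longrightarrow> a \<in> I \<Longrightarrow> b \<in> I \<Longrightarrow> a + b \<in> I"
  and ideal_mult: "ideal_of R I \<Longrightarrow> r \<in> R \<Longrightarrow> a \<in> I \<Longrightarrow> r * a \<in> I"
  unfolding ideal_of_def by auto

lemma ideal_mult_right: "ideal_of R I \<Longrightarrow> a \<in> I \<Longrightarrow> r \<in> R \<Longrightarrow> a * r \<in> I"
  using ideal_mult[of R I r a] by (simp add: mult.commute)

lemma ideal_diff: "subring R \<Longrightarrow> ideal_of R I \<Longrightarrow> a \<in> I \<Longrightarrow> b \<in> I \<Longrightarrow> a - b \<in> I"
  using ideal_add[of R I a "- 1 * b"] ideal_mult[of R I "- 1" b]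
    subring_uminus[of R 1] subring_1[of R] by simp

lemma ideal_sum: "ideal_of R I \<Longrightarrow> (\<And>i. i \<in> A \<Longrightarrow> f i \<in> I) \<Longrightarrow> sum f A \<in> I"
  by (induction A rule: infinite_finite_induct) (auto intro: ideal_0[of R I] ideal_add[of R I])

lemma ideal_1: "ideal_of R I \<Longrightarrow> 1 \<in> I \<Longrightarrow> I = R"
  using ideal_mult[of R I _ 1] ideal_sub[of R I] by auto

lemma genideal_least: "ideal_of R I \<Longrightarrow> S \<subseteq> I \<Longrightarrow> genideal R S \<subseteq> I"
  unfolding genideal_def by (auto intro!: ideal_sum[of R I] ideal_mult[of R I])

text \<open>A form of the ideal (p, q) without the finite sums of \<open>genideal\<close>:
  membership yields two coefficients at once. \<open>genideal_lin\<close> translates.\<close>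

definition lin :: "'a::field set \<Rightarrow> 'a \<Rightarrow> 'a \<Rightarrow> 'a set" where
  "lin R p q = {p * a + q * b | a b. a \<in> R \<and> b \<in> R}"

lemma linI: "a \<in> R \<Longrightarrow> b \<in> R \<Longrightarrow> z = p * a + q * b \<Longrightarrow> z \<in> lin R p q"
  unfolding lin_def by auto

lemma linE:
  assumes "z \<in> lin R p q"
  obtains a b where "a \<in> R" "b \<in> R" "z = p * a + q * b"
  using assms unfolding lin_def by auto

lemma lin_left: "subring R \<Longrightarrow> a \<in> R \<Longrightarrow> p * a \<in> lin R p q"
  by (rule linI[of a R 0]) (auto intro: subring_0)

lemma lin_right: "subring R \<Longrightarrow> b \<in> R \<Longrightarrow> q * b \<in> lin R p q"
  by (rule linI[of 0 R b]) (auto intro: subring_0)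

lemma ideal_add_multiples:
  assumes "subring R" "ideal_of R I" "r \<in> R"
  shows "ideal_of R {i + r * b | i b. i \<in> I \<and> b \<in> R}"
  unfolding ideal_of_def
proof (intro conjI ballI subsetI)
  show "0 \<in> {i + r * b | i b. i \<in> I \<and> b \<in> R}"
    using ideal_0[OF assms(2)] subring_0[OF assms(1)] by force
  fix z assume "z \<in> {i + r * b | i b. i \<in> I \<and> b \<in> R}"
  then obtain i b where 1: "i \<in> I" "b \<in> R" "z = i + r * b" by blast
  then show "z \<in> R" using assms ideal_sub[OF assms(2)] by (simp add: subring_add subring_mult)
  { fix w assume "w \<in> {i + r * b | i b. i \<in> I \<and> b \<in> R}"
    then obtain j c where 2: "j \<in> I" "c \<in> R" "w = j + r * c" by blast
    have "z + w = (i + j) + r * (b + c)" using 1 2 by (simp add: algebra_simps)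
    then show "z + w \<in> {i + r * b | i b. i \<in> I \<and> b \<in> R}"
      using 1 2 assms by (blast intro: ideal_add subring_add) }
next
  fix s z assume s: "s \<in> R" and "z \<in> {i + r * b | i b. i \<in> I \<and> b \<in> R}"
  then obtain i b where 1: "i \<in> I" "b \<in> R" "z = i + r * b" by blast
  have "s * z = s * i + r * (s * b)" using 1 by (simp add: algebra_simps)
  then show "s * z \<in> {i + r * b | i b. i \<in> I \<and> b \<in> R}"
    using 1 s assms by (blast intro: ideal_mult subring_mult)
qed

lemma ideal_principal: "subring R \<Longrightarrow> p \<in> R \<Longrightarrow> ideal_of R {p * a | a. a \<in> R}"
  using ideal_add_multiples[of R "{0}" p] unfolding ideal_of_def[of R "{0}"]
  by (simp add: subring_0)

lemma ideal_lin:
  assumes "subring R" "p \<in> R" "q \<in> R"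
  shows "ideal_of R (lin R p q)"
proof -
  have "lin R p q = {i + q * b | i b. i \<in> {p * a | a. a \<in> R} \<and> b \<in> R}"
    unfolding lin_def by auto
  then show ?thesis using ideal_add_multiples[OF assms(1) ideal_principal assms(3), of p] assms
    by simp
qed

lemma lin_subset: "subring R \<Longrightarrow> ideal_of R I \<Longrightarrow> p \<in> I \<Longrightarrow> q \<in> I \<Longrightarrow> lin R p q \<subseteq> I"
  by (auto elim!: linE intro!: ideal_add[of R I] ideal_mult_right[of R I])

lemma genideal_lin:
  assumes "subring R" "p \<in> R" "q \<in> R"
  shows "genideal R {p, q} = lin R p q"
proof
  have "p \<in> lin R p q" "q \<in> lin R p q"
    using lin_left[OF assms(1), of 1 p q] lin_right[OF assms(1), of 1 q p] subring_1[OF assms(1)]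
    by auto
  then show "genideal R {p, q} \<subseteq> lin R p q"
    using genideal_least[OF ideal_lin[OF assms]] by simp
  show "lin R p q \<subseteq> genideal R {p, q}"
  proof
    fix z assume "z \<in> lin R p q"
    then obtain a b where z: "a \<in> R" "b \<in> R" "z = p * a + q * b" by (rule linE)
    show "z \<in> genideal R {p, q}"
    \<comment> \<open>For p = q the generating set is a singleton, so the two coefficients have to
      be added.\<close>
    proof (cases "p = q")
      case True
      then have "z = (\<Sum>s\<in>{p}. (a + b) * s)" using z by (simp add: algebra_simps)
      then show ?thesis unfolding genideal_def using z assms
        by (intro CollectI exI[of _ "{p}"] exI[of _ "\<lambda>_. a + b"]) (auto intro: subring_add)
    next
      case False
      then have "z = (\<Sum>s\<in>{p, q}. (if s = p then a else b) * s)" using z by (simp add: algebra_simps)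
      then show ?thesis unfolding genideal_def using z
        by (intro CollectI exI[of _ "{p, q}"] exI[of _ "\<lambda>s. if s = p then a else b"]) auto
    qed
  qed
qed

section \<open>Factorial subrings\<close>

text \<open>The class relation \<open>dvd\<close> is trivial in a field, so divisibility is taken
  relative to a subring. Units are likewise detected by \<open>inverse p \<in> R\<close>; since
  \<open>inverse 0 = 0\<close>, the condition \<open>p \<noteq> 0\<close> is stated separately where
  it matters.\<close>

definition dvd_in :: "'a::field set \<Rightarrow> 'a \<Rightarrow> 'a \<Rightarrow> bool" where
  "dvd_in R p z \<longleftrightarrow> (\<exists>r\<in>R. z = p * r)"

definition prime_in :: "'a::field set \<Rightarrow> 'a \<Rightarrow> bool" where
  "prime_in R p \<longleftrightarrow> p \<in> R \<and> p \<noteq> 0 \<and> inverse p \<notin> R \<and>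
     (\<forall>a\<in>R. \<forall>b\<in>R. dvd_in R p (a * b) \<longrightarrow> dvd_in R p a \<or> dvd_in R p b)"

inductive_set prime_products :: "'a::field set \<Rightarrow> 'a set" for R where
  unit: "u \<in> R \<Longrightarrow> inverse u \<in> R \<Longrightarrow> u \<noteq> 0 \<Longrightarrow> u \<in> prime_products R"
| mult: "prime_in R p \<Longrightarrow> z \<in> prime_products R \<Longrightarrow> p * z \<in> prime_products R"

text \<open>Existence of factorizations is enough, because the factors are primes and not merely
  irreducible: uniqueness up to units and order is then automatic.\<close>

definition ufd :: "'a::field set \<Rightarrow> bool" where
  "ufd R \<longleftrightarrow> subring R \<and> (\<forall>z\<in>R. z \<noteq> 0 \<longrightarrow> z \<in> prime_products R)"

text \<open>No multiplicative set is named: the denominators are the elements of R that become units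
  in T. Localization at a prime, inversion of q and overrings of D are thereby treated
  alike.\<close>

definition localization_of :: "'a::field set \<Rightarrow> 'a set \<Rightarrow> bool" where
  "localization_of R T \<longleftrightarrow> subring R \<and> subring T \<and> R \<subseteq> T \<and>
     (\<forall>z\<in>T. \<exists>r\<in>R. \<exists>s\<in>R. s \<noteq> 0 \<and> inverse s \<in> T \<and> z = r / s)"

lemma dvd_inI: "r \<in> R \<Longrightarrow> z = p * r \<Longrightarrow> dvd_in R p z"
  unfolding dvd_in_def by auto

lemma prime_in_R: "prime_in R p \<Longrightarrow> p \<in> R"
  and prime_in_nz: "prime_in R p \<Longrightarrow> p \<noteq> 0"
  and prime_in_nonunit: "prime_in R p \<Longrightarrow> inverse p \<notin> R"
  and prime_in_mult: "prime_in R p \<Longrightarrow> a \<in> R \<Longrightarrow> b \<in> R \<Longrightarrow> dvd_in R p (a * b) \<Longrightarrow> dvd_in R p a \<or> dvd_in R p b"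
  unfolding prime_in_def by auto

lemma prime_in_not_dvd_unit:
  assumes "subring R" "prime_in R p" "u \<noteq> 0" "inverse u \<in> R"
  shows "\<not> dvd_in R p u"
proof
  assume "dvd_in R p u"
  then obtain r where r: "r \<in> R" "u = p * r" unfolding dvd_in_def by auto
  then have "inverse p = r * inverse u" using assms(3) by (simp add: field_simps)
  then show False using prime_in_nonunit[OF assms(2)] r assms subring_mult by metis
qed

text \<open>The prime p' divides p or c; the second would make p a unit, the first makes c
  one.\<close>

lemma prime_in_dvd_prime_in:
  assumes "subring R" "prime_in R p" "prime_in R p'" "p' = p * c" "c \<in> R"
  shows "inverse c \<in> R"
proof -
  have nz: "p' \<noteq> 0" "p \<noteq> 0" "c \<noteq> 0"
    using assms(4) prime_in_nz[OF assms(2)] prime_in_nz[OF assms(3)] by auto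
  have "dvd_in R p' (p * c)" using assms(1,4) by (auto intro!: dvd_inI[of 1] subring_1)
  then consider "dvd_in R p' p" | "dvd_in R p' c"
    using prime_in_mult[OF assms(3) prime_in_R[OF assms(2)] assms(5)] by auto
  then show ?thesis
  proof cases
    case 1
    then obtain r where "r \<in> R" "p = p' * r" unfolding dvd_in_def by auto
    moreover from this have "inverse c = r" using assms(4) nz by (simp add: field_simps)
    ultimately show ?thesis by simp
  next
    case 2
    then obtain r where "r \<in> R" "c = p' * r" unfolding dvd_in_def by auto
    moreover from this have "inverse p = r" using assms(4) nz by (simp add: field_simps)
    ultimately show ?thesis using prime_in_nonunit[OF assms(2)] by simp
  qed
qed

lemma prime_products_R: "subring R \<Longrightarrow> z \<in> prime_products R \<Longrightarrow> z \<in> R \<and> z \<noteq> 0"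
  by (rotate_tac, induction rule: prime_products.induct)
    (auto dest: prime_in_R prime_in_nz intro: subring_mult)

lemma prime_products_unit:
  assumes "subring R" "z \<in> prime_products R" "c \<in> R" "inverse c \<in> R" "c \<noteq> 0"
  shows "c * z \<in> prime_products R"
  using assms(2)
proof induction
  case (unit u)
  then show ?case using assms by (intro prime_products.unit) (auto intro: subring_mult)
next
  case (mult p z)
  then show ?case using prime_products.mult[of R p "c * z"] by (simp add: ac_simps)
qed

text \<open>As q does not divide a, each factor q of the product can be cancelled from w.\<close>

lemma prime_in_power_dvd:
  assumes "subring R" "prime_in R q" "a \<in> R" "w \<in> R" "\<not> dvd_in R q a" "a * w = q ^ n * c" "c \<in> R"
  shows "\<exists>w'\<in>R. w = q ^ n * w'"
  using assms(4,6,7)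
proof (induction n arbitrary: w)
  case 0
  then show ?case by auto
next
  case (Suc n)
  have "dvd_in R q (a * w)"
    using Suc.prems assms(1,2) by (intro dvd_inI[of "q ^ n * c"]) (auto intro: subring_closed prime_in_R)
  then obtain w1 where w1: "w1 \<in> R" "w = q * w1"
    using prime_in_mult[OF assms(2,3) Suc.prems(1)] assms(5) unfolding dvd_in_def by auto
  have "a * w1 = q ^ n * c" using Suc.prems(2) w1 prime_in_nz[OF assms(2)] by simp
  then obtain w' where "w' \<in> R" "w1 = q ^ n * w'" using Suc.IH w1 Suc.prems by blast
  then show ?case using w1 by auto
qed

text \<open>Finite order at p is read off a factorization of z, without a chain condition: a factor
  divisible by p is p times a unit and raises the exponent, every other factor is absorbed in
  r.\<close>

lemma prime_multiplicity:
  assumes R: "subring R" and p: "prime_in R p" and "z \<in> prime_products R"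
  shows "\<exists>n. \<exists>r\<in>R. z = p ^ n * r \<and> \<not> dvd_in R p r"
  using assms(3)
proof induction
  case (unit u)
  then show ?case using prime_in_not_dvd_unit[OF R p] by (intro exI[of _ 0]) auto
next
  case (mult p' z)
  then obtain n r where r: "r \<in> R" "z = p ^ n * r" "\<not> dvd_in R p r" by auto
  show ?case
  proof (cases "dvd_in R p p'")
    case False
    then have "\<not> dvd_in R p (p' * r)" using prime_in_mult[OF p] r mult prime_in_R by blast
    then show ?thesis using r mult prime_in_R[of R p'] subring_mult[OF R]
      by (intro exI[of _ n] bexI[of _ "p' * r"]) auto
  next
    case True
    then obtain c where c: "c \<in> R" "p' = p * c" unfolding dvd_in_def by auto
    have ic: "inverse c \<in> R" using prime_in_dvd_prime_in[OF R p mult(1) c(2,1)] .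
    have c0: "c \<noteq> 0" using c prime_in_nz[OF mult(1)] by auto
    have "\<not> dvd_in R p (c * r)"
    proof
      assume "dvd_in R p (c * r)"
      then show False using prime_in_mult[OF p c(1) r(1)] r(3) prime_in_not_dvd_unit[OF R p c0 ic]
        by blast
    qed
    then show ?thesis using r c subring_mult[OF R]
      by (intro exI[of _ "Suc n"] bexI[of _ "c * r"]) auto
  qed
qed

text \<open>A denominator divisible by p would make p a unit of T. So p divides no denominator, and
  primality removes the denominator from the product.\<close>

lemma localization_dvd:
  assumes L: "localization_of R T" and p: "prime_in R p" and np: "inverse p \<notin> T"
    and r: "r \<in> R" and d: "dvd_in T p r"
  shows "dvd_in R p r"
proof -
  have R: "subring R" and T: "subring T" and sub: "R \<subseteq> T" using L unfolding localization_of_def by auto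
  from d obtain z where z: "z \<in> T" "r = p * z" unfolding dvd_in_def by auto
  then obtain a s where as: "a \<in> R" "s \<in> R" "s \<noteq> 0" "inverse s \<in> T" "z = a / s"
    using L unfolding localization_of_def by blast
  have "dvd_in R p (r * s)" using z as by (intro dvd_inI[of a]) auto
  moreover have "\<not> dvd_in R p s"
  proof
    assume "dvd_in R p s"
    then obtain c where c: "c \<in> R" "s = p * c" unfolding dvd_in_def by auto
    then have "inverse p = c * inverse s" using as by (simp add: field_simps)
    then show False using np as c T sub subring_mult by (metis subsetD)
  qed
  ultimately show ?thesis using prime_in_mult[OF p r as(2)] by auto
qed

lemma localization_prime_in:
  assumes L: "localization_of R T" and p: "prime_in R p" and np: "inverse p \<notin> T"
  shows "prime_in T p"
  unfolding prime_in_def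
proof (intro conjI ballI impI)
  have R: "subring R" and T: "subring T" and sub: "R \<subseteq> T" using L unfolding localization_of_def by auto
  show "p \<in> T" "p \<noteq> 0" "inverse p \<notin> T" using np prime_in_R[OF p] prime_in_nz[OF p] sub by auto
  fix a b assume ab: "a \<in> T" "b \<in> T" "dvd_in T p (a * b)"
  obtain r s where rs: "r \<in> R" "s \<in> R" "s \<noteq> 0" "inverse s \<in> T" "a = r / s"
    using L ab unfolding localization_of_def by blast
  obtain r' s' where rs': "r' \<in> R" "s' \<in> R" "s' \<noteq> 0" "inverse s' \<in> T" "b = r' / s'"
    using L ab unfolding localization_of_def by blast
  obtain c where c: "c \<in> T" "a * b = p * c" using ab unfolding dvd_in_def by auto
  have "r * r' = p * (c * (s * s'))" using c rs rs' by (simp add: field_simps)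
  moreover have "c * (s * s') \<in> T" using c rs rs' sub by (auto intro!: subring_mult[OF T])
  ultimately have "dvd_in T p (r * r')" by (auto intro: dvd_inI)
  then have "dvd_in R p (r * r')" using localization_dvd[OF L p np] rs rs' subring_mult[OF R] by auto
  then have "dvd_in R p r \<or> dvd_in R p r'" using prime_in_mult[OF p] rs rs' by auto
  then show "dvd_in T p a \<or> dvd_in T p b"
  proof
    assume "dvd_in R p r"
    then obtain e where "e \<in> R" "r = p * e" unfolding dvd_in_def by auto
    then have "dvd_in T p a" using rs sub
      by (intro dvd_inI[of "e * inverse s"]) (auto intro: subring_mult[OF T] simp: divide_inverse)
    then show ?thesis ..
  next
    assume "dvd_in R p r'"
    then obtain e where "e \<in> R" "r' = p * e" unfolding dvd_in_def by auto
    then have "dvd_in T p b" using rs' sub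
      by (intro dvd_inI[of "e * inverse s'"]) (auto intro: subring_mult[OF T] simp: divide_inverse)
    then show ?thesis ..
  qed
qed

text \<open>Each prime of R either becomes a unit of T or stays prime there.\<close>

lemma localization_prime_products:
  assumes L: "localization_of R T" and "z \<in> prime_products R"
  shows "z \<in> prime_products T"
  using assms(2)
proof induction
  case (unit u)
  then show ?case using L by (auto intro!: prime_products.unit simp: localization_of_def)
next
  case (mult p z)
  then show ?case
  proof (cases "inverse p \<in> T")
    case True
    then show ?thesis using L mult prime_products_unit[of T z p] prime_in_R[of R p] prime_in_nz[of R p]
      by (auto simp: localization_of_def)
  next
    case False
    then show ?thesis using localization_prime_in[OF L mult(1)] mult by (auto intro: prime_products.mult)
  qed
qed

lemma localization_ufd:
  assumes L: "localization_of R T" and "ufd R"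
  shows "ufd T"
  unfolding ufd_def
proof (intro conjI ballI impI)
  show T: "subring T" using L unfolding localization_of_def by auto
  fix z assume z: "z \<in> T" "z \<noteq> 0"
  obtain r s where rs: "r \<in> R" "s \<in> R" "s \<noteq> 0" "inverse s \<in> T" "z = r / s"
    using L z unfolding localization_of_def by blast
  have "r \<in> prime_products T"
    using rs z assms localization_prime_products[OF L, of r] unfolding ufd_def by auto
  then have "inverse s * r \<in> prime_products T"
    using rs L by (intro prime_products_unit[OF T]) (auto simp: localization_of_def)
  then show "z \<in> prime_products T" using rs(5) by (simp add: divide_inverse mult.commute)
qed

lemma prime_products_cancel:
  assumes R: "subring R" and q: "prime_in R q" and "q * z \<in> prime_products R" and "z \<in> R"
  shows "z \<in> prime_products R"
proof -
  \<comment> \<open>The product \<open>q * z\<close> is replaced by a variable w so that rule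
    induction on \<open>prime_products\<close> applies.\<close>
  have "\<forall>z\<in>R. w = q * z \<longrightarrow> z \<in> prime_products R" if "w \<in> prime_products R" for w
    using that
  proof induction
    case (unit u)
    show ?case
    proof (intro ballI impI)
      fix z assume "z \<in> R" "u = q * z"
      then have "dvd_in R q u" by (auto intro: dvd_inI)
      then show "z \<in> prime_products R" using prime_in_not_dvd_unit[OF R q] unit by blast
    qed
  next
    case (mult p w)
    show ?case
    proof (intro ballI impI)
      fix z assume z: "z \<in> R" "p * w = q * z"
      have w: "w \<in> R" "w \<noteq> 0" using prime_products_R[OF R] mult by auto
      have q0: "q \<noteq> 0" using prime_in_nz q by auto
      consider "dvd_in R q p" | "dvd_in R q w"
        using prime_in_mult[OF q prime_in_R[OF mult(1)] w(1)] z by (auto intro: dvd_inI)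
      then show "z \<in> prime_products R"
      proof cases
        case 1
        then obtain c where c: "c \<in> R" "p = q * c" unfolding dvd_in_def by auto
        then have "z = c * w" using z q0 by simp
        moreover have "inverse c \<in> R" using prime_in_dvd_prime_in[OF R q mult(1)] c by auto
        moreover have "c \<noteq> 0" using c prime_in_nz[OF mult(1)] by auto
        ultimately show ?thesis using prime_products_unit[OF R] mult c by simp
      next
        case 2
        then obtain c where c: "c \<in> R" "w = q * c" unfolding dvd_in_def by auto
        then have "z = p * c" using z q0 by simp
        then show ?thesis using mult c by (auto intro: prime_products.mult)
      qed
    qed
  qed
  then show ?thesis using assms by blast
qed

lemma prime_products_power: "prime_in R q \<Longrightarrow> z \<in> prime_products R \<Longrightarrow> q ^ n * z \<in> prime_products R"
  by (induction n) (auto simp: mult.assoc intro: prime_products.mult)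

text \<open>Factor z in T, which is R[1/q], and clear powers of q. Up to powers of q, a prime of T
  is an element w of R not divisible by q, and w is prime in R because divisibility by it descends
  from T. The hypothesis \<open>mult\<close> yields w where a chain condition would usually be
  invoked.\<close>

lemma nagata_criterion:
  assumes R: "subring R" and q: "prime_in R q"
    and mult: "\<And>z. z \<in> R \<Longrightarrow> z \<noteq> 0 \<Longrightarrow> \<exists>n. \<exists>w\<in>R. z = q ^ n * w \<and> \<not> dvd_in R q w"
    and T: "ufd T" and T_eq: "T = {w / q ^ n | w n. w \<in> R}"
  shows "ufd R"
proof -
  have Ts: "subring T" using T unfolding ufd_def by simp
  have q0: "q \<noteq> 0" using prime_in_nz q by auto
  have RT: "R \<subseteq> T"
  proof
    fix z assume "z \<in> R"
    then show "z \<in> T" unfolding T_eq by (intro CollectI exI[of _ z] exI[of _ 0]) auto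
  qed
  have decomp: "\<exists>n j. \<exists>w\<in>R. z = q ^ j * w / q ^ n \<and> \<not> dvd_in R q w" if z: "z \<in> T" "z \<noteq> 0" for z
  proof -
    obtain v n where "v \<in> R" "z = v / q ^ n" using z unfolding T_eq by blast
    moreover from this obtain j w where "w \<in> R" "v = q ^ j * w" "\<not> dvd_in R q w"
      using mult[of v] z by fastforce
    ultimately show ?thesis by blast
  qed
  \<comment> \<open>In \<open>w * v = q ^ n * a\<close> the prime q does not divide w, so the whole
    power of q divides v and the denominator disappears.\<close>
  have dvdR: "dvd_in R w a" if w: "w \<in> R" "\<not> dvd_in R q w" and a: "a \<in> R" "dvd_in T w a" for w a
  proof -
    obtain v n where v: "v \<in> R" "a = w * (v / q ^ n)" using a unfolding dvd_in_def T_eq by blast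
    then have "w * v = q ^ n * a" using q0 by simp
    then obtain v' where "v' \<in> R" "v = q ^ n * v'"
      using prime_in_power_dvd[OF R q w(1) v(1) w(2)] a by blast
    then show ?thesis using v q0 by (auto intro: dvd_inI)
  qed
  have inv: "inverse w \<in> R" if w: "w \<in> R" "\<not> dvd_in R q w" "w \<noteq> 0" and "inverse w \<in> T" for w
  proof -
    have "dvd_in T w 1" using that by (intro dvd_inI[of "inverse w"]) auto
    then have "dvd_in R w 1" using dvdR[OF w(1,2)] subring_1[OF R] by auto
    then obtain r where "r \<in> R" "1 = w * r" unfolding dvd_in_def by auto
    then show ?thesis by (metis inverse_unique)
  qed
  have pow: "q ^ n \<in> T" "inverse (q ^ n) \<in> T" for n
  proof -
    show "q ^ n \<in> T" using prime_in_R[OF q] RT subring_power[OF Ts] by blast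
    show "inverse (q ^ n) \<in> T" unfolding T_eq using subring_1[OF R]
      by (intro CollectI exI[of _ 1] exI[of _ n]) (auto simp: field_simps)
  qed
  \<comment> \<open>The power of q pays for the denominators of the factors met in the induction;
    \<open>cancel\<close> removes it at the end.\<close>
  have *: "\<exists>n. q ^ n * z \<in> prime_products R" if "z \<in> prime_products T" for z
    using that
  proof induction
    case (unit u)
    then obtain n j w where w: "w \<in> R" "u = q ^ j * w / q ^ n" "\<not> dvd_in R q w"
      using decomp[of u] by auto
    have w0: "w \<noteq> 0" using w unit by auto
    have "inverse w = inverse u * q ^ j * inverse (q ^ n)" using w w0 q0 by (simp add: field_simps)
    then have "inverse w \<in> T" using unit pow subring_mult[OF Ts] by auto
    then have "inverse w \<in> R" using inv w w0 by auto
    then have "q ^ j * w \<in> prime_products R"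
      using w w0 by (intro prime_products_power[OF q] prime_products.unit)
    moreover have "q ^ n * u = q ^ j * w" using w q0 by simp
    ultimately show ?case by metis
  next
    case (mult p z)
    then obtain m where m: "q ^ m * z \<in> prime_products R" by auto
    have p0: "p \<noteq> 0" "p \<in> T" using mult prime_in_nz prime_in_R by auto
    then obtain n j w where w: "w \<in> R" "p = q ^ j * w / q ^ n" "\<not> dvd_in R q w"
      using decomp[of p] by auto
    have w0: "w \<noteq> 0" using w p0 by auto
    have assoc: "dvd_in T p a \<longleftrightarrow> dvd_in T w a" for a
    proof
      assume "dvd_in T p a"
      then obtain r where "r \<in> T" "a = p * r" unfolding dvd_in_def by auto
      then show "dvd_in T w a" using w(2)
        by (intro dvd_inI[of "q ^ j * inverse (q ^ n) * r"] subring_mult[OF Ts] pow)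
          (simp_all add: divide_inverse ac_simps)
    next
      assume "dvd_in T w a"
      then obtain r where "r \<in> T" "a = w * r" unfolding dvd_in_def by auto
      then show "dvd_in T p a" using w(2) q0
        by (intro dvd_inI[of "q ^ n * inverse (q ^ j) * r"] subring_mult[OF Ts] pow) simp_all
    qed
    have "prime_in R w"
      unfolding prime_in_def
    proof (intro conjI ballI impI)
      show "w \<in> R" "w \<noteq> 0" using w w0 by auto
      show "inverse w \<notin> R"
      proof
        assume "inverse w \<in> R"
        then have "dvd_in T w 1" using RT w0 by (intro dvd_inI[of "inverse w"]) auto
        then have "dvd_in T p 1" using assoc by simp
        then show False using prime_in_not_dvd_unit[OF Ts mult(1), of 1] subring_1[OF Ts] by simp
      qed
      fix a b assume ab: "a \<in> R" "b \<in> R" "dvd_in R w (a * b)"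
      then have "dvd_in T w (a * b)" using RT unfolding dvd_in_def by blast
      then have "dvd_in T w a \<or> dvd_in T w b"
        using prime_in_mult[OF mult(1), of a b] ab RT assoc by blast
      then show "dvd_in R w a \<or> dvd_in R w b" using dvdR w ab by blast
    qed
    then have "q ^ j * (w * (q ^ m * z)) \<in> prime_products R"
      by (intro prime_products_power[OF q] prime_products.mult m)
    moreover have "q ^ (n + m) * (p * z) = q ^ j * (w * (q ^ m * z))"
      using w q0 by (simp add: power_add field_simps)
    ultimately show ?case by metis
  qed
  have cancel: "q ^ n * z \<in> prime_products R \<Longrightarrow> z \<in> R \<Longrightarrow> z \<in> prime_products R" for n z
  proof (induction n)
    case (Suc n)
    then show ?case using prime_products_cancel[OF R q, of "q ^ n * z"] prime_in_R[OF q]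
      by (auto simp: mult.assoc intro: subring_mult[OF R] subring_power[OF R])
  qed auto
  show ?thesis unfolding ufd_def
  proof (intro conjI ballI impI)
    fix z assume "z \<in> R" "z \<noteq> 0"
    then show "z \<in> prime_products R" using * [of z] cancel T RT unfolding ufd_def by blast
  qed (rule R)
qed

section \<open>Fraction fields, p-adic valuations and the Krull property\<close>

lemma frac_closed:
  assumes "subring R"
  shows "a \<in> frac R \<Longrightarrow> b \<in> frac R \<Longrightarrow> a * b \<in> frac R"
    and "a \<in> frac R \<Longrightarrow> b \<in> frac R \<Longrightarrow> a + b \<in> frac R"
    and "r \<in> R \<Longrightarrow> r \<in> frac R"
    and "a \<in> frac R \<Longrightarrow> inverse a \<in> frac R"
proof -
  show "r \<in> frac R" if "r \<in> R" for r
    unfolding frac_def using that subring_1[OF assms]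
    by (intro CollectI exI[of _ r] exI[of _ 1]) auto
  { assume "a \<in> frac R"
    then obtain r s where 1: "r \<in> R" "s \<in> R" "s \<noteq> 0" "a = r / s" unfolding frac_def by auto
    { assume "b \<in> frac R"
      then obtain r' s' where 2: "r' \<in> R" "s' \<in> R" "s' \<noteq> 0" "b = r' / s'" unfolding frac_def by auto
      have "a * b = (r * r') / (s * s')" "a + b = (r * s' + r' * s) / (s * s')"
        using 1 2 by (simp_all add: add_frac_eq mult.commute)
      moreover have "s * s' \<in> R" "s * s' \<noteq> 0" "r * r' \<in> R" "r * s' + r' * s \<in> R"
        using 1 2 by (simp_all add: subring_mult[OF assms] subring_add[OF assms])
      ultimately show "a * b \<in> frac R" "a + b \<in> frac R" unfolding frac_def by blast+ }
    show "inverse a \<in> frac R"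
    proof (cases "r = 0")
      case True
      then have "inverse a = 0 / s" using 1 by simp
      then show ?thesis unfolding frac_def using 1 subring_0[OF assms] by blast
    next
      case False
      have "inverse a = s / r" using 1 by simp
      then show ?thesis unfolding frac_def using 1 False by blast
    qed }
qed

lemma subring_frac:
  assumes "subring R"
  shows "subring (frac R)"
  unfolding subring_def
proof (intro conjI ballI)
  show "0 \<in> frac R" "1 \<in> frac R" using frac_closed(3)[OF assms] subring_0 subring_1 assms by auto
  fix a b assume ab: "a \<in> frac R" "b \<in> frac R"
  then show "a + b \<in> frac R" "a * b \<in> frac R" using frac_closed[OF assms] by auto
  have "- 1 \<in> frac R" using frac_closed(3)[OF assms] subring_1[OF assms] subring_uminus[OF assms] by auto
  then have "- 1 * a \<in> frac R" using frac_closed(1)[OF assms _ ab(1)] by blast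
  then show "- a \<in> frac R" by simp
qed

text \<open>The element z has p-adic order n. A relation is used because existence and uniqueness of
  the order are theorems; the valuation is extracted from it afterwards.\<close>

definition val_decomp :: "'a::field set \<Rightarrow> 'a \<Rightarrow> 'a \<Rightarrow> int \<Rightarrow> bool" where
  "val_decomp R p z n \<longleftrightarrow> (\<exists>r\<in>R. \<exists>s\<in>R. \<not> dvd_in R p r \<and> \<not> dvd_in R p s \<and> z = p powi n * (r / s))"

text \<open>The localization of R at the prime ideal pR.\<close>

definition valuation_ring :: "'a::field set \<Rightarrow> 'a \<Rightarrow> 'a set" where
  "valuation_ring R p = {r / s | r s. r \<in> R \<and> s \<in> R \<and> \<not> dvd_in R p s}"

lemma dvd_in_0: "subring R \<Longrightarrow> dvd_in R p 0"
  by (rule dvd_inI[of 0]) (auto intro: subring_0)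

context
  fixes R :: "'a::field set" and p :: 'a
  assumes R: "subring R" and U: "ufd R" and p: "prime_in R p"
begin

lemma not_dvd_nz: "\<not> dvd_in R p s \<Longrightarrow> s \<noteq> 0"
  using dvd_in_0[OF R] by auto

lemma val_decomp_unique:
  assumes "val_decomp R p z n" "val_decomp R p z m"
  shows "n = m"
proof -
  have "False" if n: "val_decomp R p z n" and m: "val_decomp R p z m" and nm: "n < m" for n m
  proof -
    obtain r s where 1: "r \<in> R" "s \<in> R" "\<not> dvd_in R p r" "\<not> dvd_in R p s" "z = p powi n * (r / s)"
      using n unfolding val_decomp_def by blast
    obtain r' s' where 2: "r' \<in> R" "s' \<in> R" "\<not> dvd_in R p r'" "\<not> dvd_in R p s'" "z = p powi m * (r' / s')"
      using m unfolding val_decomp_def by blast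
    have nz: "p \<noteq> 0" "s \<noteq> 0" "s' \<noteq> 0" using not_dvd_nz 1 2 prime_in_nz[OF p] by auto
    \<comment> \<open>One less than the difference of the orders: the factor
      \<open>p ^ Suc e\<close> then shows a visible p that divides \<open>r * s'\<close>.\<close>
    define e where "e = nat (m - n) - 1"
    have e: "m = n + int (Suc e)" using nm unfolding e_def by simp
    have "p powi m = p powi n * p ^ Suc e" unfolding e using nz by (subst power_int_add) (auto simp del: of_nat_Suc)
    then have "p powi n * (r / s) = p powi n * (p ^ Suc e * (r' / s'))" using 1(5) 2(5)
      by (simp only: mult.assoc)
    then have "r / s = p ^ Suc e * (r' / s')" using nz
      by (subst (asm) mult_left_cancel) auto
    then have "r * s' = p * (p ^ e * r' * s)" using nz by (simp add: field_simps)
    then have "dvd_in R p (r * s')"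
      using 1 2 R p by (intro dvd_inI[of "p ^ e * r' * s"]) (auto intro: subring_closed prime_in_R)
    then show False using prime_in_mult[OF p] 1 2 by blast
  qed
  then show ?thesis using assms by (metis linorder_cases)
qed

lemma R_decomp:
  assumes "z \<in> R" "z \<noteq> 0"
  shows "\<exists>n. \<exists>r\<in>R. z = p ^ n * r \<and> \<not> dvd_in R p r"
proof -
  have "z \<in> prime_products R" using U assms unfolding ufd_def by blast
  then show ?thesis by (rule prime_multiplicity[OF R p])
qed

lemma val_decomp_exists:
  assumes "z \<in> frac R" "z \<noteq> 0"
  shows "\<exists>n. val_decomp R p z n"
proof -
  obtain a b where ab: "a \<in> R" "b \<in> R" "b \<noteq> 0" "z = a / b" using assms unfolding frac_def by blast
  obtain n r where 1: "r \<in> R" "a = p ^ n * r" "\<not> dvd_in R p r" using R_decomp[of a] ab assms by auto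
  obtain m s where 2: "s \<in> R" "b = p ^ m * s" "\<not> dvd_in R p s" using R_decomp[of b] ab by auto
  have "p \<noteq> 0" using prime_in_nz p by auto
  then have "z = p powi (int n - int m) * (r / s)" using 1 2 ab by (simp add: power_int_diff)
  then show ?thesis using 1 2 unfolding val_decomp_def by blast
qed

lemma val_decomp_mult:
  assumes "val_decomp R p a n" "val_decomp R p b m"
  shows "val_decomp R p (a * b) (n + m)"
proof -
  obtain r s where 1: "r \<in> R" "s \<in> R" "\<not> dvd_in R p r" "\<not> dvd_in R p s" "a = p powi n * (r / s)"
    using assms(1) unfolding val_decomp_def by blast
  obtain r' s' where 2: "r' \<in> R" "s' \<in> R" "\<not> dvd_in R p r'" "\<not> dvd_in R p s'" "b = p powi m * (r' / s')"
    using assms(2) unfolding val_decomp_def by blast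
  have "a * b = p powi (n + m) * ((r * r') / (s * s'))"
    using 1 2 prime_in_nz[OF p] by (simp add: power_int_add)
  moreover have "\<not> dvd_in R p (r * r')" "\<not> dvd_in R p (s * s')" using prime_in_mult[OF p] 1 2 by blast+
  ultimately show ?thesis unfolding val_decomp_def using 1 2 subring_mult[OF R] by blast
qed

lemma val_decomp_add:
  assumes "val_decomp R p a n" "val_decomp R p b m" "n \<le> m" "a + b \<noteq> 0"
  shows "\<exists>l\<ge>n. val_decomp R p (a + b) l"
proof -
  obtain r s where 1: "r \<in> R" "s \<in> R" "\<not> dvd_in R p r" "\<not> dvd_in R p s" "a = p powi n * (r / s)"
    using assms(1) unfolding val_decomp_def by blast
  obtain r' s' where 2: "r' \<in> R" "s' \<in> R" "\<not> dvd_in R p r'" "\<not> dvd_in R p s'" "b = p powi m * (r' / s')"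
    using assms(2) unfolding val_decomp_def by blast
  have nz: "p \<noteq> 0" "s \<noteq> 0" "s' \<noteq> 0" using not_dvd_nz 1 2 prime_in_nz[OF p] by auto
  define e where "e = nat (m - n)"
  have e: "m = n + int e" using assms(3) unfolding e_def by simp
  have "p powi m = p powi n * p ^ e" unfolding e using nz by (simp add: power_int_add)
  then have sum: "a + b = p powi n * ((r * s' + p ^ e * r' * s) / (s * s'))"
    using 1 2 nz by (simp add: field_simps)
  define w where "w = r * s' + p ^ e * r' * s"
  have w: "w \<in> R" unfolding w_def using 1 2 prime_in_R[OF p]
    by (intro subring_add subring_mult subring_power R)
  have "w \<noteq> 0" using sum assms(4) unfolding w_def by auto
  obtain j v where v: "v \<in> R" "w = p ^ j * v" "\<not> dvd_in R p v" using R_decomp[OF w \<open>w \<noteq> 0\<close>] by blast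
  have "a + b = p powi (n + int j) * (v / (s * s'))"
    using sum v nz unfolding w_def[symmetric] by (simp add: power_int_add)
  moreover have "\<not> dvd_in R p (s * s')" using prime_in_mult[OF p] 1 2 by blast
  ultimately have "val_decomp R p (a + b) (n + int j)"
    unfolding val_decomp_def using 1 2 v subring_mult[OF R] by blast
  then show ?thesis by (intro exI[of _ "n + int j"]) simp
qed

lemma dvr_valuation_ring: "dvr_of (frac R) (valuation_ring R p)"
proof -
  define v where "v z = (THE n. val_decomp R p z n)" for z
  have v_eq: "v z = n" if "val_decomp R p z n" for z n
    unfolding v_def using that val_decomp_unique by (intro the_equality) auto
  have v: "val_decomp R p z (v z)" if "z \<in> frac R" "z \<noteq> 0" for z
    using val_decomp_exists[OF that] v_eq by auto
  have p0: "p \<noteq> 0" and pR: "p \<in> R" using prime_in_nz[OF p] prime_in_R[OF p] by auto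
  have n1: "\<not> dvd_in R p 1" using prime_in_not_dvd_unit[OF R p] subring_1[OF R] by simp
  have nz: "val_decomp R p z n \<Longrightarrow> z \<noteq> 0" for z n
    unfolding val_decomp_def using not_dvd_nz p0 by auto
  show ?thesis unfolding dvr_of_def
  proof (intro exI[of _ v] conjI allI ballI impI)
    fix n :: int
    have d: "val_decomp R p (p powi n) n"
      unfolding val_decomp_def using subring_1[OF R] n1 by (intro bexI[of _ 1]) auto
    have "p powi n \<in> frac R"
    proof (cases "n \<ge> 0")
      case True
      then show ?thesis using frac_closed(3)[OF R] subring_power[OF R pR] by (simp add: power_int_def)
    next
      case False
      then show ?thesis using frac_closed(3,4)[OF R] subring_power[OF R pR]
        by (simp add: power_int_def power_inverse)
    qed
    then show "\<exists>z\<in>frac R. z \<noteq> 0 \<and> v z = n" using d v_eq nz by blast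
  next
    fix a b assume "a \<in> frac R" "b \<in> frac R" "a \<noteq> 0 \<and> b \<noteq> 0"
    then show "v (a * b) = v a + v b" by (intro v_eq val_decomp_mult v) auto
  next
    fix a b assume ab: "a \<in> frac R" "b \<in> frac R" "a \<noteq> 0 \<and> b \<noteq> 0 \<and> a + b \<noteq> 0"
    show "min (v a) (v b) \<le> v (a + b)"
    proof (cases "v a \<le> v b")
      case True
      then show ?thesis using val_decomp_add[of a "v a" b "v b"] v ab v_eq by fastforce
    next
      case False
      then show ?thesis using val_decomp_add[of b "v b" a "v a"] v ab v_eq by (fastforce simp: add.commute)
    qed
  next
    show "valuation_ring R p = {z \<in> frac R. z = 0 \<or> 0 \<le> v z}"
    proof (intro equalityI subsetI)
      fix z assume "z \<in> valuation_ring R p"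
      then obtain r s where rs: "r \<in> R" "s \<in> R" "\<not> dvd_in R p s" "z = r / s"
        unfolding valuation_ring_def by blast
      then have f: "z \<in> frac R" unfolding frac_def using not_dvd_nz by blast
      show "z \<in> {z \<in> frac R. z = 0 \<or> 0 \<le> v z}"
      proof (cases "r = 0")
        case False
        then obtain j w where "w \<in> R" "r = p ^ j * w" "\<not> dvd_in R p w" using R_decomp[OF rs(1)] by blast
        then have "val_decomp R p z (int j)" unfolding val_decomp_def using rs
          by (intro bexI[of _ w] bexI[of _ s]) auto
        then show ?thesis using v_eq f by auto
      qed (use rs f in auto)
    next
      fix z assume z: "z \<in> {z \<in> frac R. z = 0 \<or> 0 \<le> v z}"
      show "z \<in> valuation_ring R p"
      proof (cases "z = 0")
        case True
        then have "z = 0 / 1" by simp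
        then show ?thesis unfolding valuation_ring_def using n1 subring_0[OF R] subring_1[OF R] by blast
      next
        case False
        then obtain r s where rs: "r \<in> R" "s \<in> R" "\<not> dvd_in R p s" "z = p powi (v z) * (r / s)"
          using v[of z] z unfolding val_decomp_def by blast
        have "p powi (v z) = p ^ nat (v z)" using z False by (simp add: power_int_def)
        then have "z = (p ^ nat (v z) * r) / s" using rs(4) by simp
        then show ?thesis unfolding valuation_ring_def
          using rs subring_mult[OF R subring_power[OF R pR]] by blast
      qed
    qed
  qed
qed

end

text \<open>The defining family consists of the localizations at principal primes. It is a set of
  rings, not of primes: a non-zero element can have infinitely many prime divisors that differ by
  units, but these all give the same ring.\<close>

lemma ufd_krull_domain:
  assumes "ufd R"
  shows "krull_domain R"
proof -
  have R: "subring R" using assms unfolding ufd_def by auto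
  let ?V = "valuation_ring R ` {p. prime_in R p}"
  \<comment> \<open>The primes of the denominator s are removed one by one: membership of z in the
    valuation ring of p forces p to divide the numerator.\<close>
  have num: "z \<in> R" if s: "s \<in> prime_products R" and z: "z \<in> \<Inter>?V" and "z = r / s" "r \<in> R" for z r s
    using s that(3,4)
  proof (induction arbitrary: r)
    case (unit u)
    then show ?case by (auto simp: divide_inverse intro: subring_mult[OF R])
  next
    case (mult p s)
    have nz: "p \<noteq> 0" "s \<noteq> 0" using prime_in_nz mult(1) prime_products_R[OF R mult(2)] by auto
    have s: "s \<in> R" using prime_products_R[OF R mult(2)] by auto
    obtain a b where ab: "a \<in> R" "b \<in> R" "\<not> dvd_in R p b" "z = a / b"
      using z mult(1) unfolding valuation_ring_def by blast
    have b0: "b \<noteq> 0" using ab dvd_in_0[OF R] by auto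
    have "r * b = p * (s * a)" using mult.prems ab nz b0 by (simp add: field_simps)
    then have "dvd_in R p (r * b)" using s ab by (intro dvd_inI[of "s * a"]) (auto intro: subring_mult[OF R])
    then obtain c where "c \<in> R" "r = p * c"
      using prime_in_mult[OF mult(1) mult.prems(2) ab(2)] ab(3) unfolding dvd_in_def by blast
    then show ?case using mult.IH[of c] mult.prems nz by simp
  qed
  have fin: "finite {V \<in> ?V. inverse z \<notin> V}" if "z \<in> prime_products R" for z
    using that
  proof induction
    case (unit u)
    have "inverse u \<in> valuation_ring R p" if p: "prime_in R p" for p
    proof -
      have "\<not> dvd_in R p 1" using prime_in_not_dvd_unit[OF R p, of 1] subring_1[OF R] by simp
      moreover have "inverse u = inverse u / 1" by simp
      ultimately show ?thesis unfolding valuation_ring_def using unit subring_1[OF R] by blast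
    qed
    then have "{V \<in> ?V. inverse u \<notin> V} = {}" by auto
    then show ?case by (simp only: finite.emptyI)
  next
    case (mult q z)
    have "{V \<in> ?V. inverse (q * z) \<notin> V} \<subseteq> insert (valuation_ring R q) {V \<in> ?V. inverse z \<notin> V}"
    proof
      fix V assume "V \<in> {V \<in> ?V. inverse (q * z) \<notin> V}"
      then obtain p where p: "prime_in R p" "V = valuation_ring R p" "inverse (q * z) \<notin> V" by auto
      show "V \<in> insert (valuation_ring R q) {V \<in> ?V. inverse z \<notin> V}"
      proof (cases "inverse z \<in> V")
        case True
        then obtain r s where rs: "r \<in> R" "s \<in> R" "\<not> dvd_in R p s" "inverse z = r / s"
          using p unfolding valuation_ring_def by blast
        have "inverse (q * z) = r / (q * s)" using rs(4) by (simp add: divide_inverse ac_simps)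
        then have "dvd_in R p (q * s)"
          using p rs prime_in_R[OF mult(1)] subring_mult[OF R] unfolding valuation_ring_def by blast
        then have "dvd_in R p q" using prime_in_mult[OF p(1) prime_in_R[OF mult(1)] rs(2)] rs by blast
        then obtain c where c: "c \<in> R" "q = p * c" unfolding dvd_in_def by blast
        have ic: "inverse c \<in> R" using prime_in_dvd_prime_in[OF R p(1) mult(1) c(2,1)] .
        have c0: "c \<noteq> 0" using c prime_in_nz[OF mult(1)] by auto
        \<comment> \<open>Here p divides q, so the two are associated and define the same valuation
          ring.\<close>
        have "dvd_in R p w \<longleftrightarrow> dvd_in R q w" for w
        proof
          assume "dvd_in R p w"
          then obtain e where "e \<in> R" "w = p * e" unfolding dvd_in_def by blast
          then show "dvd_in R q w" using c c0 ic
            by (intro dvd_inI[of "inverse c * e"] subring_mult[OF R]) auto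
        next
          assume "dvd_in R q w"
          then obtain e where "e \<in> R" "w = q * e" unfolding dvd_in_def by blast
          then show "dvd_in R p w" using c
            by (intro dvd_inI[of "c * e"] subring_mult[OF R]) auto
        qed
        then have "V = valuation_ring R q" using p unfolding valuation_ring_def by simp
        then show ?thesis by simp
      qed (use p in auto)
    qed
    then show ?case using mult.IH finite_subset finite_insert by meson
  qed
  show ?thesis unfolding krull_domain_def
  proof (intro conjI exI[of _ ?V] ballI impI)
    fix V assume "V \<in> ?V"
    then obtain p where "prime_in R p" "V = valuation_ring R p" by auto
    then show "dvr_of (frac R) V" using dvr_valuation_ring[OF R assms] by simp
  next
    show "R = frac R \<inter> \<Inter>?V"
    proof (intro equalityI subsetI)
      fix z assume z: "z \<in> R"
      have "z \<in> valuation_ring R p" if p: "prime_in R p" for p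
      proof -
        have "\<not> dvd_in R p 1" using prime_in_not_dvd_unit[OF R p, of 1] subring_1[OF R] by simp
        moreover have "z = z / 1" by simp
        ultimately show ?thesis unfolding valuation_ring_def using z subring_1[OF R] by blast
      qed
      then show "z \<in> frac R \<inter> \<Inter>?V" using z frac_closed(3)[OF R] by auto
    next
      fix z assume z: "z \<in> frac R \<inter> \<Inter>?V"
      then obtain r s where "r \<in> R" "s \<in> R" "s \<noteq> 0" "z = r / s" unfolding frac_def by blast
      then show "z \<in> R" using num[of s z r] z assms unfolding ufd_def by blast
    qed
  next
    fix z assume "z \<in> R" "z \<noteq> 0"
    then show "finite {V \<in> ?V. inverse z \<notin> V}" using fin assms unfolding ufd_def by blast
  qed (rule R)
qed

section \<open>Two-dimensional regular local rings\<close>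

lemma noetherian_acc:
  assumes R: "subring R" and N: "noetherian R" and K: "\<And>n::nat. ideal_of R (K n)"
    and inc: "\<And>n. K n \<subseteq> K (Suc n)"
  shows "\<exists>N. \<forall>n\<ge>N. K n = K N"
proof -
  have mono: "m \<le> n \<Longrightarrow> K m \<subseteq> K n" for m n using lift_Suc_mono_le[of K] inc by blast
  have I: "ideal_of R (\<Union>n. K n)"
    unfolding ideal_of_def
  proof (intro conjI ballI subsetI)
    show "z \<in> R" if "z \<in> (\<Union>n. K n)" for z using that ideal_sub[OF K] by blast
    show "0 \<in> (\<Union>n. K n)" using ideal_0[OF K] by blast
    fix a b assume "a \<in> (\<Union>n. K n)" "b \<in> (\<Union>n. K n)"
    then obtain m n where "a \<in> K m" "b \<in> K n" by blast
    then have "a \<in> K (max m n)" "b \<in> K (max m n)"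
      using mono[of m "max m n"] mono[of n "max m n"] by auto
    then have "a + b \<in> K (max m n)" using ideal_add[OF K] by blast
    then show "a + b \<in> (\<Union>n. K n)" by blast
  next
    fix r a assume "r \<in> R" "a \<in> (\<Union>n. K n)"
    then show "r * a \<in> (\<Union>n. K n)" using ideal_mult[OF K] by blast
  qed
  obtain F where F: "finite F" "F \<subseteq> (\<Union>n. K n)" "(\<Union>n. K n) = genideal R F"
    using N[unfolded noetherian_def, rule_format, OF I] by (elim exE conjE)
  have "\<exists>N. F \<subseteq> K N" using F(1,2)
  proof induction
    case (insert a F)
    from insert.prems have "F \<subseteq> (\<Union>n. K n)" and a: "a \<in> (\<Union>n. K n)" by simp_all
    from insert.IH[OF this(1)] obtain n where "F \<subseteq> K n" by blast
    moreover from a obtain m where "a \<in> K m" by blast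
    ultimately have "insert a F \<subseteq> K (max m n)" using mono[of m "max m n"] mono[of n "max m n"] by auto
    then show ?case by blast
  qed simp
  then obtain N where "F \<subseteq> K N" by blast
  then have "(\<Union>n. K n) \<subseteq> K N" using genideal_least[OF K] F(3) by simp
  then show ?thesis using mono by (intro exI[of _ N]) blast
qed

lemma noetherian_maximal:
  assumes R: "subring R" and N: "noetherian R" and "ideal_of R I" "Q I"
  shows "\<exists>J. ideal_of R J \<and> Q J \<and> (\<forall>K. ideal_of R K \<and> Q K \<and> J \<subseteq> K \<longrightarrow> K = J)"
proof (rule ccontr)
  assume "\<not> ?thesis"
  then have *: "\<And>J. ideal_of R J \<and> Q J \<Longrightarrow> \<exists>K. (ideal_of R K \<and> Q K) \<and> J \<subset> K" by blast
  have "\<exists>f. \<forall>n::nat. (ideal_of R (f n) \<and> Q (f n)) \<and> f n \<subset> f (Suc n)"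
    by (rule dependent_nat_choice) (use assms * in blast)+
  then obtain f where f: "\<And>n. ideal_of R (f n)" "\<And>n::nat. f n \<subset> f (Suc n)" by blast
  then obtain M where "\<forall>n\<ge>M. f n = f M" using noetherian_acc[OF R N, of f] by blast
  then have "f (Suc M) = f M" using le_SucI[OF order_refl] by blast
  then show False using f(2)[of M] by blast
qed

lemma prime_idealD:
  assumes "prime_ideal_of R P"
  shows "ideal_of R P" "1 \<notin> P" "a \<in> R \<Longrightarrow> b \<in> R \<Longrightarrow> a * b \<in> P \<Longrightarrow> a \<in> P \<or> b \<in> P"
  using assms ideal_1[of R P] unfolding prime_ideal_of_def by auto

lemma prime_ideal_power:
  assumes "subring R" "prime_ideal_of R P" "a \<in> R" "a ^ n \<in> P"
  shows "a \<in> P"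
  using assms(4)
proof (induction n)
  case 0
  then show ?case using prime_idealD(2)[OF assms(2)] by simp
next
  case (Suc n)
  then show ?case using prime_idealD(3)[OF assms(2,3), of "a ^ n"] subring_power[OF assms(1,3)] by auto
qed

lemma prime_ideal_principal:
  assumes "subring R" "prime_ideal_of R P" "P = {f * a | a. a \<in> R}" "f \<noteq> 0"
  shows "prime_in R f"
proof -
  have dvd: "dvd_in R f z \<longleftrightarrow> z \<in> P" for z using assms(3) unfolding dvd_in_def by auto
  have "f \<in> P" unfolding dvd[symmetric] using subring_1[OF assms(1)] by (intro dvd_inI[of 1]) auto
  moreover have "inverse f \<notin> R"
  proof
    assume "inverse f \<in> R"
    then have "dvd_in R f 1" using assms(4) by (intro dvd_inI[of "inverse f"]) auto
    then show False using dvd prime_idealD(2)[OF assms(2)] by simp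
  qed
  ultimately show ?thesis
    unfolding prime_in_def dvd using prime_idealD[OF assms(2)] assms(4) ideal_sub by blast
qed

text \<open>If z were not a unit, an ideal maximal among those containing z but not 1 would be a
  maximal ideal, hence equal to M. The Noetherian property provides such an ideal.\<close>

lemma noetherian_local_unit:
  assumes R: "subring R" and N: "noetherian R" and L: "local_ring R M" and z: "z \<in> R" "z \<notin> M"
  shows "z \<noteq> 0 \<and> inverse z \<in> R"
proof (rule ccontr)
  assume n: "\<not> ?thesis"
  have M: "ideal_of R M" using L unfolding local_ring_def maximal_ideal_of_def by blast
  have z0: "z \<noteq> 0" using z ideal_0[OF M] by auto
  let ?I = "{z * a | a. a \<in> R}"
  have "1 \<notin> ?I"
  proof
    assume "1 \<in> ?I"
    then obtain a where "a \<in> R" "z * a = 1" by auto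
    then show False using n z0 inverse_unique[of z a] by simp
  qed
  moreover have "z \<in> ?I" using subring_1[OF R] by force
  ultimately have "z \<in> ?I \<and> 1 \<notin> ?I" by blast
  then obtain J where J: "ideal_of R J" "z \<in> J \<and> 1 \<notin> J"
    and max: "\<forall>K. ideal_of R K \<and> (z \<in> K \<and> 1 \<notin> K) \<and> J \<subseteq> K \<longrightarrow> K = J"
    using noetherian_maximal[OF R N ideal_principal[OF R z(1)], of "\<lambda>J. z \<in> J \<and> 1 \<notin> J"]
    by meson
  have "maximal_ideal_of R J"
    unfolding maximal_ideal_of_def
  proof (intro conjI allI impI)
    show "J \<noteq> R" using J subring_1[OF R] by auto
    fix K assume K: "ideal_of R K \<and> J \<subseteq> K"
    then show "K = J \<or> K = R" using max J ideal_1[of R K] by blast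
  qed (rule J)
  then have "J = M" using L unfolding local_ring_def by blast
  then show False using J z by blast
qed

text \<open>An ideal J maximal among those over I that miss every power of x is prime: for a and b
  outside J, both J + (a) and J + (b) contain powers of x, and the product of these would lie in J
  if \<open>a * b\<close> did.\<close>

lemma prime_ideal_avoiding_powers:
  assumes R: "subring R" and N: "noetherian R" and I: "ideal_of R I" and x: "x \<in> R"
    and av: "\<And>n. x ^ n \<notin> I"
  shows "\<exists>P. prime_ideal_of R P \<and> I \<subseteq> P \<and> x \<notin> P"
proof -
  define Q where "Q J \<longleftrightarrow> I \<subseteq> J \<and> (\<forall>n. x ^ n \<notin> J)" for J
  have "Q I" unfolding Q_def using av by blast
  then obtain J where J: "ideal_of R J" "Q J"
    and max: "\<And>K. ideal_of R K \<Longrightarrow> Q K \<Longrightarrow> J \<subseteq> K \<Longrightarrow> K = J"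
    using noetherian_maximal[OF R N I, of Q] by blast
  have IJ: "I \<subseteq> J" and J': "\<And>n. x ^ n \<notin> J" using J(2) unfolding Q_def by blast+
  have ext: "\<exists>n. \<exists>i\<in>J. \<exists>b\<in>R. x ^ n = i + a * b" if a: "a \<in> R" "a \<notin> J" for a
  proof (rule ccontr)
    assume n: "\<not> ?thesis"
    let ?K = "{i + a * b | i b. i \<in> J \<and> b \<in> R}"
    have JK: "J \<subseteq> ?K" using subring_0[OF R] by force
    have "Q ?K" unfolding Q_def using n JK IJ by blast
    then have "?K = J" using JK by (intro max ideal_add_multiples R J a(1))
    moreover have "a = 0 + a * 1" by simp
    ultimately show False using a ideal_0[OF J(1)] subring_1[OF R] by blast
  qed
  have "prime_ideal_of R J" unfolding prime_ideal_of_def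
  proof (intro conjI ballI impI)
    show "J \<noteq> R" using J'[of 0] subring_1[OF R] by auto
    fix a b assume ab: "a \<in> R" "b \<in> R" "a * b \<in> J"
    show "a \<in> J \<or> b \<in> J"
    proof (rule ccontr)
      assume "\<not> ?thesis"
      then obtain n i c m j d where *: "i \<in> J" "c \<in> R" "x ^ n = i + a * c" "j \<in> J" "d \<in> R" "x ^ m = j + b * d"
        using ext[OF ab(1)] ext[OF ab(2)] by blast
      then have "x ^ (n + m) = i * (j + b * d) + (a * c) * j + (a * b) * (c * d)"
        by (simp add: power_add algebra_simps)
      also have "\<dots> \<in> J"
      proof (intro ideal_add[OF J(1)])
        show "i * (j + b * d) \<in> J" using * ab ideal_sub[OF J(1)]
          by (intro ideal_mult_right[OF J(1)] subring_add[OF R] subring_mult[OF R])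
        show "a * c * j \<in> J" using * ab by (intro ideal_mult[OF J(1)] subring_mult[OF R])
        show "a * b * (c * d) \<in> J" using * ab by (intro ideal_mult_right[OF J(1), of "a * b"] subring_mult[OF R])
      qed
      finally show False using J' by blast
    qed
  qed (rule J)
  then show ?thesis using IJ J'[of 1] by auto
qed

text \<open>A proof from the ascending chain condition alone, without the Artin-Rees lemma. Two
  chains are stopped, one to cancel powers of r modulo I and one to express an element u as a
  multiple of \<open>r * u\<close> modulo I. The unit \<open>1 - c * r\<close> then puts u, and with
  it z, into I.\<close>

lemma krull_intersection:
  assumes R: "subring R" and N: "noetherian R" and I: "ideal_of R I" and r: "r \<in> R"
    and unit: "\<And>c. c \<in> R \<Longrightarrow> 1 - c * r \<noteq> 0 \<and> inverse (1 - c * r) \<in> R"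
    and z: "z \<in> R" "\<And>n. \<exists>w\<in>R. z - r ^ n * w \<in> I"
  shows "z \<in> I"
proof -
  obtain w where w: "\<And>n. w n \<in> R" "\<And>n. z - r ^ n * w n \<in> I" using z(2) by metis
  \<comment> \<open>The colon ideal (I : r^n). Since it stops growing at m, a factor r^n with n
    \<ge> m may be replaced by r^m in statements of membership in I.\<close>
  define K where "K n = {a \<in> R. r ^ n * a \<in> I}" for n
  have "ideal_of R (K n)" for n
    unfolding ideal_of_def
  proof (intro conjI ballI)
    show "K n \<subseteq> R" "0 \<in> K n" unfolding K_def using ideal_0[OF I] subring_0[OF R] by auto
    show "a + b \<in> K n" if "a \<in> K n" "b \<in> K n" for a b
      using that ideal_add[OF I, of "r ^ n * a" "r ^ n * b"] subring_add[OF R]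
      unfolding K_def by (auto simp: algebra_simps)
    show "s * a \<in> K n" if "s \<in> R" "a \<in> K n" for s a
      using that ideal_mult[OF I, of s "r ^ n * a"] subring_mult[OF R]
      unfolding K_def by (auto simp: algebra_simps)
  qed
  moreover have "K n \<subseteq> K (Suc n)" for n
    unfolding K_def using ideal_mult[OF I r] by (auto simp: mult.assoc)
  ultimately obtain m where m: "\<forall>n\<ge>m. K n = K m" using noetherian_acc[OF R N, of K] by blast
  define v where "v n = r ^ m * w n" for n
  have vR: "v n \<in> R" for n unfolding v_def using w r by (intro subring_mult[OF R] subring_power[OF R])
  have step: "v n - r * v (Suc n) \<in> I" if n: "n \<ge> m" for n
  proof -
    have "(z - r ^ Suc n * w (Suc n)) - (z - r ^ n * w n) \<in> I" by (rule ideal_diff[OF R I w(2) w(2)])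
    then have "r ^ n * (w n - r * w (Suc n)) \<in> I"
      by (rule back_subst[of "\<lambda>t. t \<in> I"]) (simp add: algebra_simps)
    moreover have "w n - r * w (Suc n) \<in> R" using w r by (intro subring_diff[OF R] subring_mult[OF R])
    ultimately have "w n - r * w (Suc n) \<in> K n" unfolding K_def by blast
    then have "w n - r * w (Suc n) \<in> K m" using m n by blast
    then show ?thesis unfolding K_def v_def by (simp add: algebra_simps)
  qed
  \<comment> \<open>By \<open>step\<close>, v_n is r v_(n+1) modulo I, so these ideals ascend. Where
    they stop, the later generator u is a multiple of the earlier one, which is itself r u modulo
    I.\<close>
  define L where "L n = {i + v (m + n) * b | i b. i \<in> I \<and> b \<in> R}" for n
  have "ideal_of R (L n)" for n unfolding L_def by (intro ideal_add_multiples R I vR)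
  moreover have "L n \<subseteq> L (Suc n)" for n
  proof
    fix a assume "a \<in> L n"
    then obtain i b where ib: "i \<in> I" "b \<in> R" "a = i + v (m + n) * b" unfolding L_def by blast
    then have "a = (i + (v (m + n) - r * v (Suc (m + n))) * b) + v (m + Suc n) * (r * b)"
      by (simp add: algebra_simps)
    moreover have "i + (v (m + n) - r * v (Suc (m + n))) * b \<in> I"
      using ib step[of "m + n"] by (intro ideal_add[OF I] ideal_mult_right[OF I]) auto
    ultimately show "a \<in> L (Suc n)" unfolding L_def using ib r subring_mult[OF R] by blast
  qed
  ultimately obtain n where "\<forall>l\<ge>n. L l = L n" using noetherian_acc[OF R N, of L] by blast
  then have Ln: "L (Suc n) = L n" using le_SucI[OF order_refl] by blast
  define u where "u = v (m + Suc n)"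
  have "u = 0 + v (m + Suc n) * 1" unfolding u_def by simp
  then have "u \<in> L (Suc n)" unfolding L_def using ideal_0[OF I] subring_1[OF R] by blast
  then obtain i c where ic: "i \<in> I" "c \<in> R" "u = i + v (m + n) * c" unfolding Ln unfolding L_def by blast
  have "v (m + n) - r * u \<in> I" using step[of "m + n"] unfolding u_def by simp
  then have "i + (v (m + n) - r * u) * c \<in> I" using ic by (intro ideal_add[OF I] ideal_mult_right[OF I])
  moreover have "i + (v (m + n) - r * u) * c = (1 - c * r) * u" using ic(3) by (simp add: algebra_simps)
  ultimately have "(1 - c * r) * u \<in> I" by simp
  then have "inverse (1 - c * r) * ((1 - c * r) * u) \<in> I" using unit[OF ic(2)] ideal_mult[OF I] by blast
  then have u: "u \<in> I" using unit[OF ic(2)] by (simp flip: mult.assoc)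
  have "r ^ (m + Suc n) * w (m + Suc n) = r ^ Suc n * u"
    unfolding u_def v_def by (simp add: power_add algebra_simps)
  then have "r ^ (m + Suc n) * w (m + Suc n) \<in> I"
    using ideal_mult[OF I subring_power[OF R r] u] by metis
  then have "(z - r ^ (m + Suc n) * w (m + Suc n)) + r ^ (m + Suc n) * w (m + Suc n) \<in> I"
    using w by (intro ideal_add[OF I])
  then show ?thesis by simp
qed

section \<open>Unique factorization in D by reduction modulo x\<close>

locale regular2 =
  fixes D :: "'a::field set" and x y :: 'a
  assumes reg: "regular_local_dim2 D x y"
begin

lemma D: "subring D" and noeth: "noetherian D" and xD: "x \<in> D" and yD: "y \<in> D"
  using reg unfolding regular_local_dim2_def by auto

abbreviation M where "M \<equiv> lin D x y"

lemma local_M: "local_ring D M"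
  using reg genideal_lin[OF D xD yD] unfolding regular_local_dim2_def by simp

lemma ideal_M: "ideal_of D M"
  by (intro ideal_lin D xD yD)

lemma one_notin_M: "1 \<notin> M"
  using local_M ideal_1[OF ideal_M] unfolding local_ring_def maximal_ideal_of_def by blast

lemma unit_D: "z \<in> D \<Longrightarrow> z \<notin> M \<Longrightarrow> z \<noteq> 0 \<and> inverse z \<in> D"
  using noetherian_local_unit[OF D noeth local_M] by blast

lemma xM: "x \<in> M" and yM: "y \<in> M"
  using lin_left[OF D subring_1[OF D]] lin_right[OF D subring_1[OF D]] by force+

lemma one_minus_unit:
  assumes "r \<in> M" "c \<in> D"
  shows "1 - c * r \<noteq> 0 \<and> inverse (1 - c * r) \<in> D"
proof (rule unit_D)
  have cr: "c * r \<in> M" using ideal_mult[OF ideal_M] assms by blast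
  then show "1 - c * r \<in> D" using ideal_sub[OF ideal_M] subring_diff[OF D] subring_1[OF D] by blast
  show "1 - c * r \<notin> M" using ideal_add[OF ideal_M _ cr, of "1 - c * r"] one_notin_M by auto
qed

lemma intersection:
  assumes "ideal_of D I" "r \<in> M" "z \<in> D" "\<And>n. \<exists>w\<in>D. z - r ^ n * w \<in> I"
  shows "z \<in> I"
  using krull_intersection[OF D noeth assms(1) ideal_sub[OF ideal_M assms(2)] one_minus_unit[OF assms(2)] assms(3,4)]
  by blast

lemma separated:
  assumes "z \<in> D" "\<And>n. z \<in> lin D x (y ^ n)"
  shows "dvd_in D x z"
proof -
  have "z \<in> {x * a | a. a \<in> D}"
  proof (rule intersection[OF ideal_principal[OF D xD] yM assms(1)])
    fix n
    obtain a b where "a \<in> D" "b \<in> D" "z = x * a + y ^ n * b" using assms(2) by (rule linE)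
    then show "\<exists>w\<in>D. z - y ^ n * w \<in> {x * a | a. a \<in> D}" by (intro bexI[of _ b]) auto
  qed
  then show ?thesis unfolding dvd_in_def by auto
qed

text \<open>Modulo x every non-zero element is a power of y times a unit, as in a discrete valuation
  ring: \<open>separated\<close> makes the order finite, and v outside M is a unit.\<close>

lemma mod_x:
  assumes w: "w \<in> D" "\<not> dvd_in D x w"
  shows "\<exists>n. \<exists>v\<in>D. \<exists>a\<in>D. v \<notin> M \<and> w = x * a + y ^ n * v"
proof -
  have "\<exists>n. w \<notin> lin D x (y ^ n)" using separated w by blast
  \<comment> \<open>n is the first exponent at which membership fails. It is not 0 because (x, 1) is
    all of D, so the order of w is n - 1.\<close>
  then obtain n where n: "w \<notin> lin D x (y ^ n)" and least: "\<And>m. m < n \<Longrightarrow> w \<in> lin D x (y ^ m)"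
    using exists_least_iff[of "\<lambda>n. w \<notin> lin D x (y ^ n)"] by blast
  have "w = x * 0 + y ^ 0 * w" by simp
  then have "w \<in> lin D x (y ^ 0)" using linI w(1) subring_0[OF D] by blast
  then have "n \<noteq> 0" using n by metis
  then obtain m where m: "n = Suc m" using not0_implies_Suc by blast
  obtain a v where av: "a \<in> D" "v \<in> D" "w = x * a + y ^ m * v" using least[of m] m by (auto elim: linE)
  have "v \<notin> M"
  proof
    assume "v \<in> M"
    then obtain c d where cd: "c \<in> D" "d \<in> D" "v = x * c + y * d" by (rule linE)
    then have "w = x * (a + y ^ m * c) + y ^ n * d" using av m by (simp add: algebra_simps)
    moreover have "a + y ^ m * c \<in> D" using av cd yD by (intro subring_closed D)
    ultimately show False using n linI cd by blast
  qed
  then show ?thesis using av by blast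
qed

text \<open>Modulo x every ideal is generated by a power of y, so \<open>P = fD + (P \<inter> xD) = fD + xP\<close> for some f,
  and Krull's intersection theorem gives \<open>P = fD\<close>. This replaces the principal ideal theorem below.\<close>

lemma prime_principal:
  assumes P: "prime_ideal_of D P" and x: "x \<notin> P"
  shows "\<exists>f\<in>P. P = {f * a | a. a \<in> D}"
proof -
  note I = prime_idealD(1)[OF P]
  have cancel_x: "h \<in> P" if "h \<in> D" "x * h \<in> P" for h using prime_idealD(3)[OF P xD] that x by blast
  obtain f where f: "f \<in> P" and gen: "\<And>g. g \<in> P \<Longrightarrow> \<exists>e\<in>D. \<exists>h\<in>P. g = f * e + x * h"
  \<comment> \<open>If P lies in xD, then P = xP because x is outside the prime P, and f = 0
    serves.\<close>
  proof (cases "\<forall>g\<in>P. dvd_in D x g")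
    case True
    have "\<exists>e\<in>D. \<exists>h\<in>P. g = 0 * e + x * h" if "g \<in> P" for g
      using True that cancel_x subring_0[OF D] unfolding dvd_in_def by fastforce
    then show ?thesis using that[of 0] ideal_0[OF I] by blast
  next
    case False
    \<comment> \<open>The least such n is the smallest y-adic order modulo x among elements of P; an
      element f of that order generates the image of P modulo x.\<close>
    define Q where "Q n \<longleftrightarrow> (\<exists>f\<in>P. \<exists>v\<in>D. \<exists>a\<in>D. v \<notin> M \<and> f = x * a + y ^ n * v)" for n
    have "\<exists>n. Q n" unfolding Q_def using False mod_x ideal_sub[OF I] by blast
    then obtain n where n: "Q n" and least: "\<And>m. Q m \<Longrightarrow> n \<le> m"
      using exists_least_iff[of Q] by (metis not_le)
    then obtain f v a where f: "f \<in> P" "v \<in> D" "a \<in> D" "v \<notin> M" "f = x * a + y ^ n * v"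
      unfolding Q_def by blast
    have v: "v \<noteq> 0" "inverse v \<in> D" using unit_D f by auto
    have "\<exists>e\<in>D. \<exists>h\<in>P. g = f * e + x * h" if g: "g \<in> P" for g
    proof (cases "dvd_in D x g")
      case True
      then obtain h where "h \<in> D" "g = x * h" unfolding dvd_in_def by blast
      then show ?thesis using g cancel_x subring_0[OF D] by (intro bexI[of _ 0] bexI[of _ h]) auto
    next
      case False
      then obtain m v' b where g': "v' \<in> D" "b \<in> D" "v' \<notin> M" "g = x * b + y ^ m * v'"
        using mod_x g ideal_sub[OF I] by blast
      then have "n \<le> m" using least g unfolding Q_def by blast
      then have ym: "y ^ m = y ^ n * y ^ (m - n)" by (simp flip: power_add)
      define e where "e = y ^ (m - n) * v' * inverse v"
      have e: "e \<in> D" unfolding e_def using g' v yD by (intro subring_closed D)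
      have "g - f * e = x * (b - a * e)"
        unfolding g'(4) f(5) ym unfolding e_def using v by (simp add: algebra_simps)
      moreover have "g - f * e \<in> P" using g f e by (intro ideal_diff[OF D I] ideal_mult_right[OF I])
      moreover have h: "b - a * e \<in> D" using g' f e by (intro subring_closed D)
      ultimately have "b - a * e \<in> P" using cancel_x by metis
      moreover have "g = f * e + x * (b - a * e)" using \<open>g - f * e = x * (b - a * e)\<close> by (simp add: algebra_simps)
      ultimately show ?thesis using e by blast
    qed
    then show ?thesis using that f by blast
  qed
  have fD: "f \<in> D" using ideal_sub[OF I f] .
  have pow: "\<exists>e\<in>D. \<exists>h\<in>P. g = f * e + x ^ n * h" if "g \<in> P" for g n
  proof (induction n)
    case 0
    show ?case using that subring_0[OF D] by (intro bexI[of _ 0] bexI[of _ g]) auto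
  next
    case (Suc n)
    then obtain e h where 1: "e \<in> D" "h \<in> P" "g = f * e + x ^ n * h" by blast
    obtain e' h' where 2: "e' \<in> D" "h' \<in> P" "h = f * e' + x * h'" using gen 1 by blast
    have "g = f * (e + x ^ n * e') + x ^ Suc n * h'" using 1 2 by (simp add: algebra_simps)
    moreover have "e + x ^ n * e' \<in> D" using 1 2 xD by (intro subring_closed D)
    ultimately show ?case using 2 by blast
  qed
  have "P = {f * a | a. a \<in> D}"
  proof (intro equalityI subsetI)
    fix g assume g: "g \<in> P"
    show "g \<in> {f * a | a. a \<in> D}"
    proof (rule intersection[OF ideal_principal[OF D fD] xM ideal_sub[OF I g]])
      fix n
      obtain e h where "e \<in> D" "h \<in> P" "g = f * e + x ^ n * h" using pow[OF g] by blast
      then show "\<exists>w\<in>D. g - x ^ n * w \<in> {f * a | a. a \<in> D}"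
        using ideal_sub[OF I] by (intro bexI[of _ h]) auto
    qed
  next
    fix g assume "g \<in> {f * a | a. a \<in> D}"
    then show "g \<in> P" using ideal_mult_right[OF I f] by auto
  qed
  then show ?thesis using f by blast
qed

text \<open>The middle member of a chain of three primes; it lies below M since elements outside M
  are units. In this form the dimension enters the argument.\<close>

lemma middle_prime:
  obtains P where "prime_ideal_of D P" "P \<subset> M" "P \<noteq> {0}"
proof -
  obtain P where P: "\<And>i. i \<le> 2 \<Longrightarrow> prime_ideal_of D (P i)" "\<And>i. i < 2 \<Longrightarrow> P i \<subset> P (Suc i)"
    using reg unfolding regular_local_dim2_def krull_dim_eq_def dim_ge_def by blast
  have P2: "P 2 \<subseteq> M"
  proof
    fix z assume z: "z \<in> P 2"
    note I = prime_idealD(1)[OF P(1)[of 2]]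
    show "z \<in> M"
    proof (rule ccontr)
      assume "z \<notin> M"
      then have "z \<noteq> 0 \<and> inverse z \<in> D" using unit_D z ideal_sub[OF I] by blast
      then have "inverse z * z \<in> P 2" "inverse z * z = 1" using ideal_mult[OF I, of "inverse z" z] z by simp_all
      then show False using prime_idealD(2)[OF P(1)[of 2]] by simp
    qed
  qed
  have P01: "P 1 \<subset> P 2" "P 0 \<subset> P 1" using P(2)[of 1] P(2)[of 0] by (simp_all add: numeral_2_eq_2)
  have "P 1 \<subset> M" by (rule psubset_subset_trans[OF P01(1) P2])
  moreover have "{0} \<subseteq> P 0" using ideal_0[OF prime_idealD(1)[OF P(1)[of 0]]] by simp
  then have "P 1 \<noteq> {0}" using P01(2) by auto
  ultimately show ?thesis using that[of "P 1"] P(1)[of 1] by simp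
qed

lemma y_notin_prime:
  assumes "prime_ideal_of D P" "P \<subset> M" "x \<in> P"
  shows "y ^ n \<notin> P"
proof
  assume "y ^ n \<in> P"
  then have "y \<in> P" using prime_ideal_power[OF D assms(1) yD] by blast
  then show False using lin_subset[OF D prime_idealD(1)[OF assms(1)] assms(3)] assms(2) by blast
qed

text \<open>Take a prime P strictly between 0 and M. If x is in P, then so is y^n, hence y, and P =
  M. Otherwise P = fD by \<open>prime_principal\<close>. From f in (x, y) follows that f^n lies in
  (x, y^n), which is xD when x divides y^n. As the prime f does not divide x, f^n divides the
  cofactor of x, and x would be a unit.\<close>

lemma x_not_dvd_y_power: "\<not> dvd_in D x (y ^ n)"
proof
  assume "dvd_in D x (y ^ n)"
  then obtain c where c: "c \<in> D" "y ^ n = x * c" unfolding dvd_in_def by blast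
  obtain P where P: "prime_ideal_of D P" "P \<subset> M" "P \<noteq> {0}" by (rule middle_prime)
  note I = prime_idealD(1)[OF P(1)]
  show False
  proof (cases "x \<in> P")
    case True
    then have "y ^ n \<in> P" using c ideal_mult_right[OF I] by simp
    then show False using y_notin_prime P True by blast
  next
    case False
    then obtain f where f: "f \<in> P" "P = {f * a | a. a \<in> D}" using prime_principal[OF P(1)] by blast
    have "f \<noteq> 0" using f P(3) by auto
    then have pf: "prime_in D f" using prime_ideal_principal[OF D P(1) f(2)] by blast
    have fM: "f \<in> M" using f P by blast
    have "f ^ m \<in> lin D x (y ^ m)" for m
    proof (induction m)
      case 0
      show ?case by (rule linI[of 0 D 1]) (auto intro: subring_closed D)
    next
      case (Suc m)
      obtain a b where 1: "a \<in> D" "b \<in> D" "f ^ m = x * a + y ^ m * b" using Suc by (rule linE)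
      obtain a' b' where 2: "a' \<in> D" "b' \<in> D" "f = x * a' + y * b'" using fM by (rule linE)
      have "f ^ Suc m = x * (a * f + y ^ m * b * a') + y ^ Suc m * (b * b')"
      proof -
        have "f ^ Suc m = x * (a * f) + y ^ m * b * f" using 1 by (simp add: algebra_simps)
        also have "y ^ m * b * f = y ^ m * b * (x * a' + y * b')" using 2 by simp
        finally show ?thesis by (simp add: algebra_simps)
      qed
      moreover have "a * f + y ^ m * b * a' \<in> D" "b * b' \<in> D"
        using 1 2 prime_in_R[OF pf] yD by (intro subring_closed D; simp)+
      ultimately show ?case using linI by blast
    qed
    then obtain a b where ab: "a \<in> D" "b \<in> D" "f ^ n = x * a + y ^ n * b" by (rule linE)
    then have e: "x * (a + c * b) = f ^ n * 1" using c by (simp add: algebra_simps)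
    have "\<not> dvd_in D f x" using False f unfolding dvd_in_def by blast
    moreover have "a + c * b \<in> D" using ab c by (intro subring_closed D)
    ultimately obtain w where w: "w \<in> D" "a + c * b = f ^ n * w"
      using prime_in_power_dvd[OF D pf xD _ _ e] subring_1[OF D] by blast
    then have "f ^ n * (x * w) = f ^ n * 1" using e by (simp add: ac_simps)
    then have "x * w = 1" using \<open>f \<noteq> 0\<close> by simp
    then show False using ideal_mult_right[OF ideal_M xM w(1)] one_notin_M by simp
  qed
qed

text \<open>Modulo x, a product of y^n times a unit and y^m times a unit is y^(n+m) times a unit,
  which is non-zero by \<open>x_not_dvd_y_power\<close>. If x were 0, a non-zero element of a middle
  prime would put a power of y into that prime.\<close>

lemma prime_x: "prime_in D x"
  unfolding prime_in_def
proof (intro conjI ballI impI)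
  show "x \<noteq> 0"
  proof
    assume x0: "x = 0"
    obtain P where P: "prime_ideal_of D P" "P \<subset> M" "P \<noteq> {0}" by (rule middle_prime)
    note I = prime_idealD(1)[OF P(1)]
    obtain w where w: "w \<in> P" "w \<noteq> 0" using P(3) ideal_0[OF I] by blast
    then have "\<not> dvd_in D x w" unfolding dvd_in_def x0 by auto
    then obtain n v a where v: "v \<in> D" "v \<notin> M" "w = x * a + y ^ n * v"
      using mod_x ideal_sub[OF I w(1)] by blast
    have "v \<noteq> 0 \<and> inverse v \<in> D" using unit_D v by auto
    then have "inverse v * w \<in> P" "inverse v * w = y ^ n" using ideal_mult[OF I] w v x0 by auto
    then have "y ^ n \<in> P" by simp
    moreover have "x \<in> P" using x0 ideal_0[OF I] by simp
    ultimately show False using y_notin_prime P by blast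
  qed
  then show "inverse x \<notin> D" using ideal_mult[OF ideal_M _ xM, of "inverse x"] one_notin_M by auto
  fix a b assume ab: "a \<in> D" "b \<in> D" "dvd_in D x (a * b)"
  show "dvd_in D x a \<or> dvd_in D x b"
  proof (rule ccontr)
    assume "\<not> ?thesis"
    then obtain n v c m v' c' where 1: "v \<in> D" "c \<in> D" "v \<notin> M" "a = x * c + y ^ n * v"
      and 2: "v' \<in> D" "c' \<in> D" "v' \<notin> M" "b = x * c' + y ^ m * v'"
      using mod_x ab by meson
    have v: "v \<noteq> 0" "inverse v \<in> D" "v' \<noteq> 0" "inverse v' \<in> D" using unit_D 1 2 by auto
    obtain d where d: "d \<in> D" "a * b = x * d" using ab unfolding dvd_in_def by blast
    have "y ^ (n + m) * (v * v') = a * b - x * (c * b + y ^ n * v * c')"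
      using 1(4) 2(4) by (simp add: power_add algebra_simps)
    also have "\<dots> = x * (d - (c * b + y ^ n * v * c'))" using d by (simp add: algebra_simps)
    finally have "y ^ (n + m) * (v * v') * (inverse v * inverse v')
        = x * ((d - (c * b + y ^ n * v * c')) * (inverse v * inverse v'))" by simp
    then have "y ^ (n + m) = x * ((d - (c * b + y ^ n * v * c')) * (inverse v * inverse v'))"
      using v by (simp add: field_simps)
    moreover have "(d - (c * b + y ^ n * v * c')) * (inverse v * inverse v') \<in> D"
      using d 1 2 v ab yD by (intro subring_closed D)
    ultimately show False using x_not_dvd_y_power unfolding dvd_in_def by blast
  qed
qed (rule xD)

text \<open>Among the non-zero elements that are not products of primes, take z with zD maximal. If
  zD contains a power of x, then x divides z, as z is not a unit. Otherwise zD lies in a prime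
  avoiding x, and that prime is generated by a prime element dividing z. Either way z has a prime
  divisor, and its cofactor generates a larger ideal.\<close>

lemma ufd_D: "ufd D"
proof (rule ccontr)
  assume "\<not> ufd D"
  then obtain z0 where z0: "z0 \<in> D" "z0 \<noteq> 0" "z0 \<notin> prime_products D" unfolding ufd_def using D by blast
  define Q where "Q I \<longleftrightarrow> (\<exists>z\<in>D. z \<noteq> 0 \<and> z \<notin> prime_products D \<and> I = {z * a | a. a \<in> D})" for I
  have "Q {z0 * a | a. a \<in> D}" unfolding Q_def using z0 by blast
  then obtain J where "Q J" and max: "\<And>K. ideal_of D K \<Longrightarrow> Q K \<Longrightarrow> J \<subseteq> K \<Longrightarrow> K = J"
    using noetherian_maximal[OF D noeth ideal_principal[OF D z0(1)], of Q] by blast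
  then obtain z where z: "z \<in> D" "z \<noteq> 0" "z \<notin> prime_products D" and J: "J = {z * a | a. a \<in> D}"
    unfolding Q_def by blast
  have zu: "inverse z \<notin> D" using z prime_products.unit by blast
  have "\<exists>f. prime_in D f \<and> dvd_in D f z"
  proof (cases "\<exists>n. x ^ n \<in> {z * a | a. a \<in> D}")
    case True
    then obtain n c where "c \<in> D" "x ^ n = z * c" by auto
    then have c: "c \<in> D" "z * c = x ^ n * 1" by simp_all
    have "dvd_in D x z"
    proof (rule ccontr)
      assume "\<not> dvd_in D x z"
      then obtain w where w: "w \<in> D" "c = x ^ n * w"
        using prime_in_power_dvd[OF D prime_x z(1) c(1) _ c(2)] subring_1[OF D] by blast
      then have "x ^ n * (z * w) = x ^ n * 1" using c by (simp add: ac_simps)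
      then have "z * w = 1" using prime_in_nz[OF prime_x] by simp
      then show False using zu w inverse_unique[of z w] by simp
    qed
    then show ?thesis using prime_x by blast
  next
    case False
    then obtain P where P: "prime_ideal_of D P" "{z * a | a. a \<in> D} \<subseteq> P" "x \<notin> P"
      using prime_ideal_avoiding_powers[OF D noeth ideal_principal[OF D z(1)] xD] by blast
    have "z * 1 \<in> P" using P(2) subring_1[OF D] by blast
    moreover obtain f where f: "f \<in> P" "P = {f * a | a. a \<in> D}" using prime_principal[OF P(1,3)] by blast
    ultimately have d: "dvd_in D f z" unfolding dvd_in_def by auto
    then have "f \<noteq> 0" using z unfolding dvd_in_def by auto
    then have "prime_in D f" using prime_ideal_principal[OF D P(1) f(2)] by blast
    then show ?thesis using d by blast
  qed
  then obtain f z' where f: "prime_in D f" "z' \<in> D" "z = f * z'" unfolding dvd_in_def by blast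
  have z'0: "z' \<noteq> 0" using z f by auto
  have "z' \<in> prime_products D"
  proof (rule ccontr)
    assume "z' \<notin> prime_products D"
    then have "Q {z' * a | a. a \<in> D}" unfolding Q_def using f z'0 by blast
    moreover have "J \<subseteq> {z' * a | a. a \<in> D}"
      unfolding J f(3) using subring_mult[OF D prime_in_R[OF f(1)]] by (fastforce simp: ac_simps)
    ultimately have "{z' * a | a. a \<in> D} = J" using max ideal_principal[OF D f(2)] by blast
    moreover have "z' * 1 \<in> {z' * a | a. a \<in> D}" using subring_1[OF D] by blast
    ultimately obtain e where e: "e \<in> D" "z' = z * e" unfolding J by auto
    then have "z' * (f * e) = z' * 1" using f(3) by (simp add: ac_simps)
    then have "f * e = 1" using z'0 by simp
    then show False using prime_in_nonunit[OF f(1)] e inverse_unique[of f e] by simp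
  qed
  then show False using prime_products.mult[OF f(1)] f(3) z(3) by blast
qed

text \<open>T contains D[1/x], whose primes are principal by \<open>prime_principal\<close>. In a
  fraction from T, a prime factor p of the denominator is either a unit of T or divides the
  numerator and cancels, so only denominators invertible in T remain.\<close>

lemma overring_localization:
  assumes T: "subring T" "D \<subseteq> T" "T \<subseteq> frac D" and xT: "inverse x \<in> T"
  shows "localization_of D T"
proof -
  have x0: "x \<noteq> 0" using prime_in_nz[OF prime_x] .
  have *: "\<forall>r\<in>D. r / s \<in> T \<longrightarrow> (\<exists>r'\<in>D. \<exists>s'\<in>D. s' \<noteq> 0 \<and> inverse s' \<in> T \<and> r / s = r' / s')"
    if "s \<in> prime_products D" for s
    using that
  proof induction
    case (unit u)
    then show ?case using T(2) by blast
  next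
    case (mult p s)
    have s: "s \<in> D" "s \<noteq> 0" using prime_products_R[OF D mult(2)] by auto
    have p0: "p \<noteq> 0" "p \<in> D" using prime_in_nz[OF mult(1)] prime_in_R[OF mult(1)] by auto
    show ?case
    proof (intro ballI impI)
      fix r assume r: "r \<in> D" "r / (p * s) \<in> T"
      show "\<exists>r'\<in>D. \<exists>s'\<in>D. s' \<noteq> 0 \<and> inverse s' \<in> T \<and> r / (p * s) = r' / s'"
      proof (cases "inverse p \<in> T")
        case True
        have "r / s = p * (r / (p * s))" using p0 by simp
        then have "r / s \<in> T" using r p0 T(2) subring_mult[OF T(1)] by (metis subsetD)
        then obtain r' s' where "r' \<in> D" "s' \<in> D" "s' \<noteq> 0" "inverse s' \<in> T" "r / s = r' / s'"
          using mult.IH r by blast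
        moreover from this have "inverse (p * s') \<in> T" using True subring_mult[OF T(1)] by simp
        moreover have "r / (p * s) = (r / s) / p" by simp
        ultimately show ?thesis using p0 subring_mult[OF D]
          by (intro bexI[of _ r'] bexI[of _ "p * s'"]) (auto simp: mult.commute)
      next
        case False
        have rp: "r / p \<in> T"
        proof -
          have "r / p = s * (r / (p * s))" using s by simp
          then show ?thesis using s T(2) r subring_mult[OF T(1)] by (metis subsetD)
        qed
        have "dvd_in D p r"
        proof (rule ccontr)
          assume n: "\<not> dvd_in D p r"
          \<comment> \<open>An equation x^n = ra + pb, divided by p and x^n, would express 1/p in T,
            because r/p and 1/x lie there. So a prime avoiding x contains both r and p.\<close>
          have "x ^ n \<notin> lin D r p" for n
          proof
            assume "x ^ n \<in> lin D r p"
            then obtain a b where ab: "a \<in> D" "b \<in> D" "x ^ n = r * a + p * b" by (rule linE)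
            have "inverse p = inverse (x ^ n) * (r * a + p * b) * inverse p"
              using x0 by (simp flip: ab(3))
            also have "\<dots> = inverse x ^ n * (r / p * a + b)"
              using p0 by (simp add: field_simps power_inverse)
            also have "\<dots> \<in> T" using xT rp ab T by (intro subring_closed) auto
            finally show False using False by simp
          qed
          then obtain P where P: "prime_ideal_of D P" "lin D r p \<subseteq> P" "x \<notin> P"
            using prime_ideal_avoiding_powers[OF D noeth ideal_lin[OF D r(1) p0(2)] xD] by blast
          obtain f where f: "f \<in> P" "P = {f * a | a. a \<in> D}" using prime_principal[OF P(1,3)] by blast
          have "r * 1 \<in> P" "p * 1 \<in> P"
            using P(2) lin_left[OF D subring_1[OF D]] lin_right[OF D subring_1[OF D]] by blast+
          then obtain c e where c: "c \<in> D" "p = f * c" and e: "e \<in> D" "r = f * e" using f by auto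
          then have "f \<noteq> 0" using p0 by auto
          then have "prime_in D f" using prime_ideal_principal[OF D P(1) f(2)] by blast
          then have "inverse c \<in> D" using prime_in_dvd_prime_in[OF D _ mult(1) c(2,1)] by blast
          moreover have "c \<noteq> 0" using c p0 by auto
          ultimately have "dvd_in D p r" using c e
            by (intro dvd_inI[of "inverse c * e"] subring_mult[OF D]) auto
          then show False using n by blast
        qed
        then obtain e where e: "e \<in> D" "r = p * e" unfolding dvd_in_def by blast
        then have "r / (p * s) = e / s" using p0 by simp
        then show ?thesis using mult.IH e r by simp
      qed
    qed
  qed
  show ?thesis unfolding localization_of_def
  proof (intro conjI ballI)
    fix z assume z: "z \<in> T"
    then obtain r s where "r \<in> D" "s \<in> D" "s \<noteq> 0" "z = r / s" using T(3) unfolding frac_def by blast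
    moreover from this have "s \<in> prime_products D" using ufd_D unfolding ufd_def by blast
    ultimately show "\<exists>r\<in>D. \<exists>s\<in>D. s \<noteq> 0 \<and> inverse s \<in> T \<and> z = r / s" using * z by blast
  qed (use D T in auto)
qed

end

section \<open>Quadratic transforms\<close>

definition polys_over :: "'a::field set \<Rightarrow> 'a poly set" where
  "polys_over R = {f. \<forall>i. coeff f i \<in> R}"

lemma polys_over_closed:
  assumes "subring R"
  shows "f \<in> polys_over R \<Longrightarrow> g \<in> polys_over R \<Longrightarrow> f + g \<in> polys_over R"
    and "f \<in> polys_over R \<Longrightarrow> g \<in> polys_over R \<Longrightarrow> f - g \<in> polys_over R"
    and "f \<in> polys_over R \<Longrightarrow> - f \<in> polys_over R"
    and "f \<in> polys_over R \<Longrightarrow> g \<in> polys_over R \<Longrightarrow> f * g \<in> polys_over R"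
    and "c \<in> R \<Longrightarrow> f \<in> polys_over R \<Longrightarrow> smult c f \<in> polys_over R"
    and "pCons c f \<in> polys_over R \<longleftrightarrow> c \<in> R \<and> f \<in> polys_over R"
    and "0 \<in> polys_over R" and "1 \<in> polys_over R"
proof -
  show pc: "pCons c f \<in> polys_over R \<longleftrightarrow> c \<in> R \<and> f \<in> polys_over R" for c f
  proof
    assume "pCons c f \<in> polys_over R"
    then have "coeff (pCons c f) 0 \<in> R" "\<And>i. coeff (pCons c f) (Suc i) \<in> R"
      unfolding polys_over_def by blast+
    then show "c \<in> R \<and> f \<in> polys_over R" unfolding polys_over_def by simp
  next
    assume "c \<in> R \<and> f \<in> polys_over R"
    then show "pCons c f \<in> polys_over R"
      unfolding polys_over_def by (auto simp: coeff_pCons split: nat.split)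
  qed
  show z: "0 \<in> polys_over R" unfolding polys_over_def using subring_0[OF assms] by simp
  show "1 \<in> polys_over R" unfolding one_pCons pc using z subring_1[OF assms] by simp
  show "f + g \<in> polys_over R" if "f \<in> polys_over R" "g \<in> polys_over R"
    using that subring_add[OF assms] unfolding polys_over_def by simp
  show "f - g \<in> polys_over R" if "f \<in> polys_over R" "g \<in> polys_over R"
    using that subring_diff[OF assms] unfolding polys_over_def by simp
  show "- f \<in> polys_over R" if "f \<in> polys_over R"
    using that subring_uminus[OF assms] unfolding polys_over_def by simp
  show "smult c f \<in> polys_over R" if "c \<in> R" "f \<in> polys_over R"
    using that subring_mult[OF assms] unfolding polys_over_def by simp
  show "f * g \<in> polys_over R" if "f \<in> polys_over R" "g \<in> polys_over R"
    using that unfolding polys_over_def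
    by (auto simp: coeff_mult intro!: subring_sum[OF assms] subring_mult[OF assms])
qed

lemma poly_in_subring:
  assumes "subring R" "f \<in> polys_over R" "t \<in> R"
  shows "poly f t \<in> R"
  using assms(2) unfolding poly_altdef polys_over_def
  by (intro subring_sum subring_mult subring_power assms) auto

lemma adjoin_eq:
  assumes "subring R"
  shows "adjoin R t = {poly f t | f. f \<in> polys_over R}"
proof (intro equalityI subsetI)
  fix z assume "z \<in> adjoin R t"
  then obtain n c where c: "\<And>i. c i \<in> R" "z = (\<Sum>i\<le>n. c i * t ^ i)" unfolding adjoin_def by auto
  define f where "f = (\<Sum>i\<le>n. monom (c i) i)"
  have "coeff f i = (if i \<le> n then c i else 0)" for i unfolding f_def by (simp add: coeff_sum)
  then have "f \<in> polys_over R" unfolding polys_over_def using c subring_0[OF assms] by auto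
  moreover have "z = poly f t" unfolding f_def c(2) by (simp add: poly_sum poly_monom)
  ultimately show "z \<in> {poly f t | f. f \<in> polys_over R}" by blast
next
  fix z assume "z \<in> {poly f t | f. f \<in> polys_over R}"
  then obtain f where "f \<in> polys_over R" "z = poly f t" by blast
  then show "z \<in> adjoin R t" unfolding adjoin_def poly_altdef polys_over_def by blast
qed

lemma adjoin_props:
  assumes "subring R"
  shows "subring (adjoin R t)" and "R \<subseteq> adjoin R t" and "t \<in> adjoin R t"
proof -
  note P = polys_over_closed[OF assms]
  have A: "poly f t \<in> adjoin R t" if "f \<in> polys_over R" for f using that adjoin_eq[OF assms] by blast
  show "subring (adjoin R t)" unfolding subring_def
  proof (intro conjI ballI)
    show "0 \<in> adjoin R t" "1 \<in> adjoin R t" using A[OF P(7)] A[OF P(8)] by simp_all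
    fix a b assume "a \<in> adjoin R t" "b \<in> adjoin R t"
    then obtain f g where "f \<in> polys_over R" "a = poly f t" "g \<in> polys_over R" "b = poly g t"
      unfolding adjoin_eq[OF assms] by blast
    then show "a + b \<in> adjoin R t" "a * b \<in> adjoin R t" "- a \<in> adjoin R t"
      using A[OF P(1)] A[OF P(3)] A[OF P(4)] by simp_all
  qed
  show "R \<subseteq> adjoin R t"
  proof
    fix c assume "c \<in> R"
    then show "c \<in> adjoin R t" using A[of "[:c:]"] P(6,7) by simp
  qed
  show "t \<in> adjoin R t" using A[of "[:0, 1:]"] P(6,7) subring_0[OF assms] subring_1[OF assms] by simp
qed

lemma adjoin_least:
  assumes "subring T" "R \<subseteq> T" "t \<in> T"
  shows "adjoin R t \<subseteq> T"
  unfolding adjoin_def using assms by (auto intro!: subring_sum[OF assms(1)] subring_mult[OF assms(1)] subring_power[OF assms(1)])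

text \<open>The elements congruent modulo J to a polynomial in t over k form a subring that contains
  R, by the residue assumption, and t.\<close>

lemma adjoin_mod:
  assumes R: "subring R" and k: "subring k" and J: "ideal_of (adjoin R t) J"
    and kR: "k \<subseteq> R" and res: "\<And>r. r \<in> R \<Longrightarrow> \<exists>c\<in>k. r - c \<in> J" and f: "f \<in> adjoin R t"
  shows "\<exists>\<phi>\<in>polys_over k. f - poly \<phi> t \<in> J"
proof -
  note S = adjoin_props(1)[OF R, of t] and P = polys_over_closed[OF k]
  have kS: "poly \<phi> t \<in> adjoin R t" if "\<phi> \<in> polys_over k" for \<phi>
    using that kR unfolding adjoin_eq[OF R] polys_over_def by blast
  define T where "T = {f \<in> adjoin R t. \<exists>\<phi>\<in>polys_over k. f - poly \<phi> t \<in> J}"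
  have TI: "f \<in> T" if "f \<in> adjoin R t" "\<phi> \<in> polys_over k" "f - poly \<phi> t \<in> J" for f \<phi>
    unfolding T_def using that by blast
  have "subring T" unfolding subring_def
  proof (intro conjI ballI)
    show "0 \<in> T" "1 \<in> T"
      using TI[of 0 0] TI[of 1 1] P subring_0[OF S] subring_1[OF S] ideal_0[OF J] by simp_all
    fix a b assume "a \<in> T" "b \<in> T"
    then obtain \<phi> \<psi> where a: "a \<in> adjoin R t" "\<phi> \<in> polys_over k" "a - poly \<phi> t \<in> J"
      and b: "b \<in> adjoin R t" "\<psi> \<in> polys_over k" "b - poly \<psi> t \<in> J" unfolding T_def by blast
    have "(a - poly \<phi> t) + (b - poly \<psi> t) \<in> J" using ideal_add[OF J] a b by blast
    then show "a + b \<in> T"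
      using a b subring_add[OF S] P by (intro TI[of _ "\<phi> + \<psi>"]) (simp_all add: algebra_simps)
    have "(a - poly \<phi> t) * b + poly \<phi> t * (b - poly \<psi> t) \<in> J"
      using a b kS by (intro ideal_add[OF J] ideal_mult_right[OF J _ b(1)] ideal_mult[OF J])
    then show "a * b \<in> T"
      using a b subring_mult[OF S] P by (intro TI[of _ "\<phi> * \<psi>"]) (simp_all add: algebra_simps)
    have "0 - (a - poly \<phi> t) \<in> J" using ideal_diff[OF S J ideal_0[OF J]] a by blast
    then show "- a \<in> T"
      using a subring_uminus[OF S] P by (intro TI[of _ "- \<phi>"]) (simp_all add: algebra_simps)
  qed
  moreover have "R \<subseteq> T"
  proof
    fix r assume r: "r \<in> R"
    then obtain c where "c \<in> k" "r - c \<in> J" using res by blast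
    then show "r \<in> T" using r adjoin_props(2)[OF R] P by (intro TI[of _ "[:c:]"]) auto
  qed
  moreover have "t \<in> T"
    using adjoin_props(3)[OF R] P subring_0[OF k] subring_1[OF k] ideal_0[OF J]
    by (intro TI[of _ "[:0, 1:]"]) auto
  ultimately have "adjoin R t \<subseteq> T" by (rule adjoin_least)
  then show ?thesis using f unfolding T_def by blast
qed

lemma loc_localization:
  assumes R: "subring R" and P: "prime_ideal_of R P"
  shows "localization_of R (loc R P)"
    and "s \<in> R \<Longrightarrow> s \<notin> P \<Longrightarrow> s \<noteq> 0 \<and> inverse s \<in> loc R P"
    and "s \<in> P \<Longrightarrow> s \<noteq> 0 \<Longrightarrow> inverse s \<notin> loc R P"
proof -
  note I = prime_idealD(1)[OF P]
  have L: "r / s \<in> loc R P" if "r \<in> R" "s \<in> R" "s \<notin> P" for r s unfolding loc_def using that by blast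
  show inv: "s \<noteq> 0 \<and> inverse s \<in> loc R P" if "s \<in> R" "s \<notin> P" for s
    using L[of 1 s] that subring_1[OF R] ideal_0[OF I] by (auto simp: divide_inverse)
  have mult: "s * s' \<in> R \<and> s * s' \<notin> P" if "s \<in> R" "s \<notin> P" "s' \<in> R" "s' \<notin> P" for s s'
    using that prime_idealD(3)[OF P] subring_mult[OF R] by blast
  have sub: "R \<subseteq> loc R P" using L[of _ 1] subring_1[OF R] prime_idealD(2)[OF P] by auto
  show "localization_of R (loc R P)" unfolding localization_of_def
  proof (intro conjI ballI R sub)
    show "subring (loc R P)" unfolding subring_def
    proof (intro conjI ballI)
      show "0 \<in> loc R P" "1 \<in> loc R P" using sub subring_0[OF R] subring_1[OF R] by auto
      fix a b assume "a \<in> loc R P" "b \<in> loc R P"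
      then obtain r s r' s' where 1: "r \<in> R" "s \<in> R" "s \<notin> P" "a = r / s"
        and 2: "r' \<in> R" "s' \<in> R" "s' \<notin> P" "b = r' / s'" unfolding loc_def by blast
      have "s \<noteq> 0" "s' \<noteq> 0" using 1 2 ideal_0[OF I] by auto
      then have "a + b = (r * s' + r' * s) / (s * s')" "a * b = (r * r') / (s * s')" "- a = (- r) / s"
        using 1 2 by (simp_all add: add_frac_eq)
      moreover have "r * s' + r' * s \<in> R" "r * r' \<in> R" "- r \<in> R"
        using 1 2 by (auto intro!: subring_add[OF R] subring_mult[OF R] subring_uminus[OF R])
      ultimately show "a + b \<in> loc R P" "a * b \<in> loc R P" "- a \<in> loc R P"
        using L[of "r * s' + r' * s" "s * s'"] L[of "r * r'" "s * s'"] L[of "- r" s]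
          mult[OF 1(2,3) 2(2,3)] 1(2,3) by metis+
    qed
  next
    fix z assume "z \<in> loc R P"
    then show "\<exists>r\<in>R. \<exists>s\<in>R. s \<noteq> 0 \<and> inverse s \<in> loc R P \<and> z = r / s"
      using inv loc_def[of R P] by blast
  qed
  show "inverse s \<notin> loc R P" if s: "s \<in> P" "s \<noteq> 0"
  proof
    assume "inverse s \<in> loc R P"
    then obtain a b where ab: "a \<in> R" "b \<in> R" "b \<notin> P" "inverse s = a / b" unfolding loc_def by blast
    then have "b \<noteq> 0" using ideal_0[OF I] by auto
    then have "b = a * s" using ab s by (simp add: field_simps)
    then show False using ideal_mult[OF I ab(1) s(1)] ab by simp
  qed
qed

lemma prime_in_dvd_power:
  assumes "subring R" "prime_in R q" "a \<in> R" "dvd_in R q (a ^ n)"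
  shows "dvd_in R q a"
  using assms(4)
proof (induction n)
  case 0
  then show ?case using prime_in_not_dvd_unit[OF assms(1,2), of 1] subring_1[OF assms(1)] by simp
next
  case (Suc n)
  then show ?case using prime_in_mult[OF assms(2,3) subring_power[OF assms(1,3), of n]] by auto
qed

text \<open>The properties of a two-dimensional regular local ring with parameters p, q and coefficient
  field k that survive a quadratic transform without any appeal to the Noetherian property.\<close>

locale param_ring =
  fixes k R :: "'a::field set" and p q :: 'a
  assumes k: "subfield k" and kR: "k \<subseteq> R" and R: "subring R" and ufd_R: "ufd R"
    and prime_p: "prime_in R p" and qR: "q \<in> R" and p_ndvd_q: "\<not> dvd_in R p q"
    and residue: "z \<in> R \<Longrightarrow> \<exists>c\<in>k. z - c \<in> lin R p q"
    and unit: "z \<in> R \<Longrightarrow> z \<notin> lin R p q \<Longrightarrow> inverse z \<in> R"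
    and proper: "1 \<notin> lin R p q"
    and separated: "z \<in> R \<Longrightarrow> (\<And>n. z \<in> lin R p (q ^ n)) \<Longrightarrow> dvd_in R p z"
begin

lemma ks: "subring k" using k unfolding subfield_def by blast

lemma pR: "p \<in> R" and p0: "p \<noteq> 0" and q0: "q \<noteq> 0"
  using prime_in_R[OF prime_p] prime_in_nz[OF prime_p] p_ndvd_q dvd_in_0[OF R] by auto

abbreviation M where "M \<equiv> lin R p q"

lemma ideal_M: "ideal_of R M" by (intro ideal_lin R pR qR)

lemma k_M: "c \<in> k \<Longrightarrow> c \<in> M \<Longrightarrow> c = 0"
proof (rule ccontr)
  assume c: "c \<in> k" "c \<in> M" "c \<noteq> 0"
  then have "inverse c \<in> R" using k kR unfolding subfield_def by blast
  then have "inverse c * c \<in> M" using ideal_mult[OF ideal_M] c by blast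
  then show False using proper c by simp
qed

end

locale quadratic = param_ring k R p q for k R :: "'a::field set" and p q :: 'a +
  fixes t :: 'a
  assumes t_eq: "t = p / q"
begin

section \<open>The ring R[p/q] and its reduction modulo q\<close>

definition S where "S = adjoin R t"
definition N where "N = lin S q t"
text \<open>Written with \<open>genideal\<close> to match \<open>alpha_ring\<close> and
  \<open>beta_ring\<close> literally; \<open>T_eq\<close> passes to N.\<close>

definition T where "T = loc S (genideal S {q, t})"

lemma t0: "t \<noteq> 0" and p_eq: "p = q * t"
  using t_eq p0 q0 by auto

lemma S: "subring S" and RS: "R \<subseteq> S" and tS: "t \<in> S" and qS: "q \<in> S"
  unfolding S_def using adjoin_props[OF R, of t] qR by auto

lemma ideal_N: "ideal_of S N" unfolding N_def by (intro ideal_lin S qS tS)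

lemma qN: "q \<in> N" and tN: "t \<in> N"
  unfolding N_def using lin_left[OF S subring_1[OF S]] lin_right[OF S subring_1[OF S]] by force+

text \<open>Since p = qt, the ideal M becomes principal in S, generated by q.\<close>

lemma M_dvd: "z \<in> M \<Longrightarrow> dvd_in S q z"
proof -
  assume "z \<in> M"
  then obtain a b where "a \<in> R" "b \<in> R" "z = p * a + q * b" by (rule linE)
  then show ?thesis using RS tS p_eq
    by (intro dvd_inI[of "t * a + b"]) (auto intro!: subring_add[OF S] subring_mult[OF S] simp: algebra_simps)
qed

text \<open>Homogenization: multiplying by q^n turns the terms c (p/q)^i into c p^i q^(n-i).\<close>

lemma form_in_R: "\<phi> \<in> polys_over R \<Longrightarrow> degree \<phi> \<le> n \<Longrightarrow> q ^ n * poly \<phi> t \<in> R"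
proof (induction n arbitrary: \<phi>)
  case 0
  then obtain c where "\<phi> = [:c:]" using degree_eq_zeroE by blast
  then show ?case using 0 polys_over_closed(6)[OF R] by simp
next
  case (Suc n)
  obtain c \<psi> where \<phi>: "\<phi> = pCons c \<psi>" by (cases \<phi>)
  then have c: "c \<in> R" "\<psi> \<in> polys_over R" using Suc polys_over_closed(6)[OF R] by auto
  have "degree \<psi> \<le> n" using Suc \<phi> by (auto split: if_splits)
  then have "q ^ n * poly \<psi> t \<in> R" using Suc c by blast
  moreover have "q ^ Suc n * poly \<phi> t = q ^ Suc n * c + p * (q ^ n * poly \<psi> t)"
    unfolding \<phi> p_eq by (simp add: algebra_simps)
  ultimately show ?case using c qR pR by (auto intro!: subring_add[OF R] subring_mult[OF R] subring_power[OF R])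
qed

lemma p_dvd_cancel: "c \<in> R \<Longrightarrow> dvd_in R p (q ^ n * c) \<Longrightarrow> dvd_in R p c"
  using prime_in_mult[OF prime_p subring_power[OF R qR, of n], of c]
    prime_in_dvd_power[OF R prime_p qR, of n] p_ndvd_q by blast

text \<open>Every relation of t = p/q is a multiple of qX - p, whose coefficients lie in M. Clearing
  denominators shows that p divides q^(n+1) c for the constant term c, so c = p c'. As p = qt, one
  factor t cancels from the relation, and the degree drops.\<close>

lemma relation_coeffs:
  "\<phi> \<in> polys_over R \<Longrightarrow> degree \<phi> \<le> n \<Longrightarrow> poly \<phi> t = 0 \<Longrightarrow> coeff \<phi> i \<in> M"
proof (induction n arbitrary: \<phi> i)
  case 0
  then obtain c where "\<phi> = [:c:]" using degree_eq_zeroE by blast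
  then have "\<phi> = 0" using 0 by simp
  then show ?case using ideal_0[OF ideal_M] by simp
next
  case (Suc n)
  obtain c \<psi> where \<phi>: "\<phi> = pCons c \<psi>" by (cases \<phi>)
  then have c: "c \<in> R" "\<psi> \<in> polys_over R" using Suc polys_over_closed(6)[OF R] by auto
  have d: "degree \<psi> \<le> n" using Suc \<phi> by (auto split: if_splits)
  then have e: "q ^ n * poly \<psi> t \<in> R" using form_in_R c by blast
  have rel: "c + t * poly \<psi> t = 0" using Suc \<phi> by simp
  then have "q ^ Suc n * (c + t * poly \<psi> t) = 0" by simp
  then have "q ^ Suc n * c = p * - (q ^ n * poly \<psi> t)"
    unfolding p_eq by (simp add: algebra_simps add_eq_0_iff)
  then have "dvd_in R p (q ^ Suc n * c)" using e subring_uminus[OF R] by (blast intro: dvd_inI)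
  then obtain c' where c': "c' \<in> R" "c = p * c'" using p_dvd_cancel[OF c(1)] unfolding dvd_in_def by blast
  have "t * (q * c' + poly \<psi> t) = 0" using rel unfolding c'(2) p_eq by (simp add: algebra_simps)
  then have "poly (\<psi> + [:q * c':]) t = 0" using t0 by (simp add: add.commute)
  moreover have "\<psi> + [:q * c':] \<in> polys_over R"
    using c c' polys_over_closed[OF R] subring_mult[OF R qR] by auto
  moreover have "degree (\<psi> + [:q * c':]) \<le> n" using d by (intro degree_add_le) auto
  ultimately have IH: "coeff (\<psi> + [:q * c':]) j \<in> M" for j using Suc.IH by blast
  show ?case
  proof (cases i)
    case 0
    then show ?thesis using \<phi> c' lin_left[OF R] by simp
  next
    case (Suc j)
    show ?thesis
    proof (cases j)
      case 0
      have "coeff \<psi> 0 + q * c' - q * c' \<in> M"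
        using IH[of 0] lin_right[OF R c'(1)] by (intro ideal_diff[OF R ideal_M]) auto
      then show ?thesis using \<phi> Suc 0 by simp
    next
      case (Suc l)
      then show ?thesis using \<phi> \<open>i = Suc j\<close> IH[of j] by simp
    qed
  qed
qed

text \<open>If the value is q g(t), then subtracting q g from the polynomial gives a relation, to
  which \<open>relation_coeffs\<close> applies.\<close>

lemma dvd_coeffs:
  assumes "\<phi> \<in> polys_over R" "dvd_in S q (poly \<phi> t)"
  shows "coeff \<phi> i \<in> M"
proof -
  obtain g where g: "g \<in> polys_over R" "poly \<phi> t = q * poly g t"
    using assms(2) unfolding dvd_in_def S_def adjoin_eq[OF R] by blast
  have "coeff (\<phi> - smult q g) i \<in> M"
    using assms(1) g polys_over_closed[OF R] qR by (intro relation_coeffs[OF _ order_refl]) auto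
  moreover have "q * coeff g i \<in> M" using g lin_right[OF R] unfolding polys_over_def by blast
  ultimately have "coeff (\<phi> - smult q g) i + q * coeff g i \<in> M" by (rule ideal_add[OF ideal_M])
  then show ?thesis by simp
qed

lemma k_poly_indep:
  assumes "\<phi> \<in> polys_over k" "dvd_in S q (poly \<phi> t)"
  shows "\<phi> = 0"
proof (rule poly_eqI)
  fix i
  have "\<phi> \<in> polys_over R" using assms(1) kR unfolding polys_over_def by blast
  then have "coeff \<phi> i \<in> M" using dvd_coeffs assms(2) by blast
  then show "coeff \<phi> i = coeff 0 i" using k_M assms(1) unfolding polys_over_def by simp
qed

lemma k_poly_S: "\<phi> \<in> polys_over k \<Longrightarrow> poly \<phi> t \<in> S"
  unfolding S_def adjoin_eq[OF R] using kR unfolding polys_over_def by blast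

text \<open>Elements of R are constants of k up to M, and M vanishes modulo q. Together with
  \<open>k_poly_indep\<close> this identifies S/qS with the polynomial ring k[t].\<close>

lemma S_mod_q:
  assumes "f \<in> S"
  shows "\<exists>\<phi>\<in>polys_over k. dvd_in S q (f - poly \<phi> t)"
proof -
  have J: "ideal_of (adjoin R t) {q * a | a. a \<in> S}" using ideal_principal[OF S qS] unfolding S_def .
  have "\<exists>c\<in>k. r - c \<in> {q * a | a. a \<in> S}" if r: "r \<in> R" for r
  proof -
    obtain c where c: "c \<in> k" "r - c \<in> M" using residue[OF r] by blast
    then show ?thesis using M_dvd[OF c(2)] unfolding dvd_in_def by blast
  qed
  then show ?thesis using adjoin_mod[OF R ks J kR] assms unfolding S_def dvd_in_def by blast
qed

text \<open>Otherwise t would be invertible in S/qS = k[t]; the constant coefficient exhibits the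
  contradiction.\<close>

lemma one_notin_N: "1 \<notin> N"
proof
  assume "1 \<in> N"
  then obtain f h where fh: "f \<in> S" "h \<in> S" "1 = q * f + t * h" unfolding N_def by (rule linE)
  obtain \<psi> where \<psi>: "\<psi> \<in> polys_over k" "dvd_in S q (h - poly \<psi> t)" using S_mod_q fh by blast
  obtain e where e: "e \<in> S" "h - poly \<psi> t = q * e" using \<psi> unfolding dvd_in_def by blast
  have "poly (1 - pCons 0 \<psi>) t = q * f + t * (h - poly \<psi> t)" using fh(3) by (simp add: algebra_simps)
  also have "\<dots> = q * (f + t * e)" unfolding e(2) by (simp add: algebra_simps)
  finally have "dvd_in S q (poly (1 - pCons 0 \<psi>) t)"
    using fh e tS by (intro dvd_inI[of "f + t * e"] subring_add[OF S] subring_mult[OF S])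
  moreover have "1 - pCons 0 \<psi> \<in> polys_over k"
    using \<psi> polys_over_closed[OF ks] subring_0[OF ks] by auto
  ultimately have "1 - pCons 0 \<psi> = 0" using k_poly_indep by blast
  then have "coeff (1 - pCons 0 \<psi>) 0 = 0" by simp
  then show False by simp
qed

lemma residue_S:
  assumes "f \<in> S"
  shows "\<exists>c\<in>k. f - c \<in> N"
proof -
  obtain \<phi> where \<phi>: "\<phi> \<in> polys_over k" "dvd_in S q (f - poly \<phi> t)" using S_mod_q assms by blast
  obtain e where e: "e \<in> S" "f - poly \<phi> t = q * e" using \<phi> unfolding dvd_in_def by blast
  obtain c \<psi> where c: "\<phi> = pCons c \<psi>" by (cases \<phi>)
  then have c': "c \<in> k" "\<psi> \<in> polys_over k" using \<phi> polys_over_closed(6)[OF ks] by auto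
  have "f - c = q * e + t * poly \<psi> t" using e(2) c by (simp add: algebra_simps)
  then show ?thesis unfolding N_def using c' e k_poly_S linI by blast
qed

lemma k_N:
  assumes "c \<in> k" "c \<in> N"
  shows "c = 0"
proof (rule ccontr)
  assume c: "c \<noteq> 0"
  then have "inverse c \<in> S" using assms k kR RS unfolding subfield_def by blast
  then have "inverse c * c \<in> N" using ideal_mult[OF ideal_N] assms by blast
  then show False using one_notin_N c by simp
qed

text \<open>S/N is the field k: the product of the residues c and d of f and g lies in N, hence
  vanishes.\<close>

lemma prime_N: "prime_ideal_of S N"
  unfolding prime_ideal_of_def
proof (intro conjI ballI impI ideal_N)
  show "N \<noteq> S" using one_notin_N subring_1[OF S] by blast
  fix f g assume fg: "f \<in> S" "g \<in> S" "f * g \<in> N"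
  obtain c d where c: "c \<in> k" "f - c \<in> N" and d: "d \<in> k" "g - d \<in> N" using residue_S fg by blast
  have dS: "d \<in> S" using d kR RS by blast
  have "f * g - (f * (g - d) + (f - c) * d) \<in> N"
    using ideal_diff[OF S ideal_N fg(3) ideal_add[OF ideal_N
        ideal_mult[OF ideal_N fg(1) d(2)] ideal_mult_right[OF ideal_N c(2) dS]]] .
  then have "c * d \<in> N" by (simp add: algebra_simps)
  then have "c * d = 0" using k_N subring_mult[OF ks c(1) d(1)] by blast
  then show "f \<in> N \<or> g \<in> N" using c d by auto
qed

text \<open>S/qS is the domain k[t].\<close>

lemma prime_q_S: "prime_in S q"
  unfolding prime_in_def
proof (intro conjI ballI impI qS q0)
  show "inverse q \<notin> S" using ideal_mult[OF ideal_N _ qN, of "inverse q"] one_notin_N q0 by auto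
  fix f g assume fg: "f \<in> S" "g \<in> S" "dvd_in S q (f * g)"
  obtain \<phi> where \<phi>: "\<phi> \<in> polys_over k" "dvd_in S q (f - poly \<phi> t)" using S_mod_q fg by blast
  obtain \<psi> where \<psi>: "\<psi> \<in> polys_over k" "dvd_in S q (g - poly \<psi> t)" using S_mod_q fg by blast
  obtain a b c where a: "a \<in> S" "f - poly \<phi> t = q * a" and b: "b \<in> S" "g - poly \<psi> t = q * b"
    and c: "c \<in> S" "f * g = q * c" using \<phi> \<psi> fg unfolding dvd_in_def by blast
  have "poly (\<phi> * \<psi>) t = f * g - (f - poly \<phi> t) * g - poly \<phi> t * (g - poly \<psi> t)"
    by (simp add: algebra_simps)
  also have "\<dots> = q * (c - a * g - poly \<phi> t * b)" unfolding a b c by (simp add: algebra_simps)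
  finally have "dvd_in S q (poly (\<phi> * \<psi>) t)"
    using a b c fg k_poly_S[OF \<phi>(1)]
    by (intro dvd_inI[of "c - a * g - poly \<phi> t * b"] subring_diff[OF S] subring_mult[OF S])
  then have "\<phi> * \<psi> = 0" using k_poly_indep polys_over_closed(4)[OF ks] \<phi> \<psi> by blast
  then have "\<phi> = 0 \<or> \<psi> = 0" by simp
  then show "dvd_in S q f \<or> dvd_in S q g" using \<phi> \<psi> by auto
qed

section \<open>The localization T of S at N\<close>

lemma T_eq: "T = loc S N"
  unfolding T_def N_def genideal_lin[OF S qS tS] ..

lemma ST: "localization_of S T" and subring_T: "subring T" and S_sub_T: "S \<subseteq> T"
  using loc_localization(1)[OF S prime_N] unfolding T_eq localization_of_def by auto

lemma T_inverse: "s \<in> S \<Longrightarrow> s \<notin> N \<Longrightarrow> s \<noteq> 0 \<and> inverse s \<in> T"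
  using loc_localization(2)[OF S prime_N] unfolding T_eq by blast

lemma T_cases:
  assumes "z \<in> T"
  obtains f g where "f \<in> S" "g \<in> S" "g \<notin> N" "g \<noteq> 0" "inverse g \<in> T" "z = f / g"
  using assms T_inverse unfolding T_eq loc_def[of S N] by blast

lemma q_ndvd_t: "\<not> dvd_in T q t"
proof
  have nq: "inverse q \<notin> T" using loc_localization(3)[OF S prime_N qN q0] unfolding T_eq .
  assume "dvd_in T q t"
  then have "dvd_in S q t" using localization_dvd[OF ST prime_q_S nq tS] by blast
  then have "dvd_in S q (poly [:0, 1:] t)" by simp
  then have "[:0, 1:] = (0 :: 'a poly)"
    using polys_over_closed[OF ks] subring_0[OF ks] subring_1[OF ks] by (intro k_poly_indep) auto
  then show False by simp
qed

lemma prime_q_T: "prime_in T q"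
  using loc_localization(3)[OF S prime_N qN q0] localization_prime_in[OF ST prime_q_S] unfolding T_eq by blast

abbreviation M' where "M' \<equiv> lin T q t"

lemma qT: "q \<in> T" and tT: "t \<in> T" using qS tS S_sub_T by auto

lemma ideal_M': "ideal_of T M'" by (intro ideal_lin subring_T qT tT)

lemma N_sub_M': "N \<subseteq> M'" unfolding N_def lin_def using S_sub_T by blast

lemma proper_T: "1 \<notin> M'"
proof
  assume "1 \<in> M'"
  then obtain a b where ab: "a \<in> T" "b \<in> T" "1 = q * a + t * b" by (rule linE)
  obtain f g where 1: "f \<in> S" "g \<in> S" "g \<notin> N" "g \<noteq> 0" "a = f / g" using ab(1) by (rule T_cases)
  obtain f' g' where 2: "f' \<in> S" "g' \<in> S" "g' \<notin> N" "g' \<noteq> 0" "b = f' / g'" using ab(2) by (rule T_cases)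
  have "g * g' = g * g' * (q * a + t * b)" using ab(3) by simp
  also have "\<dots> = q * (a * g * g') + t * (b * g' * g)" by (simp add: algebra_simps)
  also have "\<dots> = q * (f * g') + t * (f' * g)" using 1 2 by simp
  also have "\<dots> \<in> N" unfolding N_def using 1 2 subring_mult[OF S] linI by blast
  finally show False using prime_idealD(3)[OF prime_N] 1 2 by blast
qed

lemma unit_T:
  assumes "z \<in> T" "z \<notin> M'"
  shows "z \<noteq> 0 \<and> inverse z \<in> T"
proof -
  obtain f g where fg: "f \<in> S" "g \<in> S" "g \<notin> N" "g \<noteq> 0" "inverse g \<in> T" "z = f / g"
    using assms(1) by (rule T_cases)
  have "f \<notin> N"
  proof
    assume "f \<in> N"
    then have "f * inverse g \<in> M'" using N_sub_M' ideal_mult_right[OF ideal_M'] fg by blast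
    then show False using assms fg by (simp add: divide_inverse)
  qed
  then have f: "f \<noteq> 0" "inverse f \<in> T" using T_inverse fg by auto
  then have "inverse z = g * inverse f" using fg by (simp add: divide_inverse)
  then show ?thesis using f fg S_sub_T subring_mult[OF subring_T] by auto
qed

lemma residue_T:
  assumes "z \<in> T"
  shows "\<exists>c\<in>k. z - c \<in> M'"
proof -
  obtain f g where fg: "f \<in> S" "g \<in> S" "g \<notin> N" "g \<noteq> 0" "inverse g \<in> T" "z = f / g"
    using assms by (rule T_cases)
  obtain c where c: "c \<in> k" "f - c \<in> N" using residue_S fg by blast
  obtain d where d: "d \<in> k" "g - d \<in> N" using residue_S fg by blast
  have d0: "d \<noteq> 0" using d fg by auto
  have id: "inverse d \<in> k" using d d0 k unfolding subfield_def by blast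
  have cd: "c * inverse d \<in> k" using subring_mult[OF ks c(1) id] .
  have cdS: "c * inverse d \<in> S" using cd kR RS by blast
  have "(f - c) - (c * inverse d) * (g - d) \<in> N"
    by (rule ideal_diff[OF S ideal_N c(2) ideal_mult[OF ideal_N cdS d(2)]])
  then have "((f - c) - (c * inverse d) * (g - d)) * inverse g \<in> M'"
    using N_sub_M' ideal_mult_right[OF ideal_M'] fg by blast
  moreover have "((f - c) - (c * inverse d) * (g - d)) * inverse g = z - c * inverse d"
    using fg d0 by (simp add: field_simps)
  ultimately show ?thesis using cd by metis
qed

text \<open>Splits off the order at t. The remaining factor has non-zero constant term c and becomes
  a unit in T.\<close>

lemma k_poly_lowest_term:
  "\<phi> \<in> polys_over k \<Longrightarrow> \<phi> \<noteq> 0 \<Longrightarrow>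
    \<exists>j. \<exists>c\<in>k. \<exists>\<psi>\<in>polys_over k. c \<noteq> 0 \<and> poly \<phi> t = t ^ j * (c + t * poly \<psi> t)"
proof (induction \<phi>)
  case (pCons a \<phi>)
  then have a: "a \<in> k" "\<phi> \<in> polys_over k" using polys_over_closed(6)[OF ks] by auto
  show ?case
  proof (cases "a = 0")
    case False
    then show ?thesis using a by (intro exI[of _ 0] bexI[of _ a] bexI[of _ \<phi>]) auto
  next
    case True
    then have "\<phi> \<noteq> 0" using pCons.hyps by auto
    then obtain j c \<psi> where *: "c \<in> k" "\<psi> \<in> polys_over k" "c \<noteq> 0" "poly \<phi> t = t ^ j * (c + t * poly \<psi> t)"
      using pCons.IH a by blast
    then have "poly (pCons a \<phi>) t = t ^ Suc j * (c + t * poly \<psi> t)" using True by (simp add: mult.assoc)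
    then show ?thesis using * by blast
  qed
qed simp

text \<open>Modulo q the ring T is k[t] localized at (t), where orders at t are visible: if the
  numerator is t^j times a unit modulo q, then z cannot lie in (q, t^(j+1)), since q does not divide
  t^j.\<close>

lemma separated_T:
  assumes z: "z \<in> T" and in_lin: "\<And>n. z \<in> lin T q (t ^ n)"
  shows "dvd_in T q z"
proof -
  obtain f g where fg: "f \<in> S" "g \<in> S" "g \<notin> N" "g \<noteq> 0" "inverse g \<in> T" "z = f / g"
    using z by (rule T_cases)
  obtain \<phi> where \<phi>: "\<phi> \<in> polys_over k" "dvd_in S q (f - poly \<phi> t)" using S_mod_q fg by blast
  obtain e where e: "e \<in> S" "f - poly \<phi> t = q * e" using \<phi> unfolding dvd_in_def by blast
  show ?thesis
  proof (cases "\<phi> = 0")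
    case True
    then have "z = q * (e * inverse g)" using e fg by (simp add: divide_inverse)
    then show ?thesis using e fg S_sub_T subring_mult[OF subring_T] by (blast intro: dvd_inI)
  next
    case False
    then obtain j c \<psi> where *: "c \<in> k" "\<psi> \<in> polys_over k" "c \<noteq> 0" "poly \<phi> t = t ^ j * (c + t * poly \<psi> t)"
      using k_poly_lowest_term \<phi> by blast
    \<comment> \<open>One exponent beyond the order j of the numerator modulo q.\<close>
    obtain a b where ab: "a \<in> T" "b \<in> T" "z = q * a + t ^ Suc j * b" using in_lin by (rule linE)
    \<comment> \<open>What remains of \<open>f - t ^ Suc j * b * g\<close> modulo q after t^j is
      taken out; it is a unit because its residue is c.\<close>
    define w where "w = c + t * (poly \<psi> t - b * g)"
    have ps: "poly \<psi> t \<in> T" using k_poly_S[OF *(2)] S_sub_T by blast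
    have gT: "g \<in> T" and eT: "e \<in> T" using fg e S_sub_T by auto
    have cT: "c \<in> T" using * kR RS S_sub_T by blast
    have pb: "poly \<psi> t - b * g \<in> T" using ps ab gT by (intro subring_diff[OF subring_T] subring_mult[OF subring_T])
    have wT: "w \<in> T" unfolding w_def using cT tT pb by (intro subring_add[OF subring_T] subring_mult[OF subring_T])
    have "w \<notin> M'"
    proof
      assume "w \<in> M'"
      then have "w - t * (poly \<psi> t - b * g) \<in> M'"
        using lin_right[OF subring_T pb] by (intro ideal_diff[OF subring_T ideal_M'])
      then have "c \<in> M'" unfolding w_def by simp
      moreover have "inverse c \<in> T" using * k kR RS S_sub_T unfolding subfield_def by blast
      ultimately have "inverse c * c \<in> M'" using ideal_mult[OF ideal_M'] by blast
      then show False using proper_T * by simp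
    qed
    then have iw: "w \<noteq> 0" "inverse w \<in> T" using unit_T wT by auto
    have "f = z * g" using fg by simp
    then have "t ^ j * w = q * (a * g - e)"
      using ab(3) e(2) unfolding *(4) w_def by (simp add: algebra_simps)
    then have "t ^ j * w * inverse w = q * ((a * g - e) * inverse w)" by (simp only: mult.assoc)
    then have "t ^ j = q * ((a * g - e) * inverse w)" by (simp only: mult.assoc right_inverse[OF iw(1)] mult_1_right)
    moreover have "(a * g - e) * inverse w \<in> T"
      using ab gT eT iw by (intro subring_diff[OF subring_T] subring_mult[OF subring_T])
    ultimately have "dvd_in T q (t ^ j)" by (blast intro: dvd_inI)
    then show ?thesis using prime_in_dvd_power[OF subring_T prime_q_T tT] q_ndvd_t by blast
  qed
qed

section \<open>Finite order at q and unique factorization in T\<close>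

lemma clear_denominator:
  assumes "f \<in> S"
  shows "\<exists>n. q ^ n * f \<in> R"
proof -
  obtain \<phi> where "\<phi> \<in> polys_over R" "f = poly \<phi> t" using assms unfolding S_def adjoin_eq[OF R] by blast
  then show ?thesis using form_in_R[of \<phi> "degree \<phi>"] by blast
qed

text \<open>The n-th power of M, written as the forms of degree n in p and q with coefficients in
  R.\<close>

definition forms :: "nat \<Rightarrow> 'a set" where
  "forms n = {q ^ n * poly \<phi> t | \<phi>. \<phi> \<in> polys_over R \<and> degree \<phi> \<le> n}"

text \<open>Elements of R divisible by q^n in S lie in the n-th power of M. In the step, the value
  of the form's polynomial at t is divisible by q, so its coefficients are in M and raise the degree
  by one.\<close>

lemma forms_I:
  "h \<in> R \<Longrightarrow> e \<in> S \<Longrightarrow> h = q ^ n * e \<Longrightarrow> h \<in> forms n"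
proof (induction n arbitrary: e)
  case 0
  then show ?case unfolding forms_def using polys_over_closed[OF R]
    by (intro CollectI exI[of _ "[:h:]"]) auto
next
  case (Suc n)
  have "h \<in> forms n" using Suc.IH[of "q * e"] Suc.prems qS subring_mult[OF S] by (simp add: ac_simps)
  then obtain \<phi> where \<phi>: "h = q ^ n * poly \<phi> t" "\<phi> \<in> polys_over R" "degree \<phi> \<le> n"
    unfolding forms_def by blast
  have "q ^ n * poly \<phi> t = q ^ n * (q * e)" unfolding \<phi>(1)[symmetric] Suc.prems(3) by (simp only: power_Suc2 mult.assoc)
  then have "poly \<phi> t = q * e" using q0 by simp
  then have "dvd_in S q (poly \<phi> t)" using Suc.prems by (blast intro: dvd_inI)
  then have "coeff \<phi> i \<in> M" for i using dvd_coeffs \<phi>(2) by blast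
  then have "\<forall>i. \<exists>a b. a \<in> R \<and> b \<in> R \<and> coeff \<phi> i = p * a + q * b" unfolding lin_def by blast
  then obtain a b where ab: "\<And>i. a i \<in> R" "\<And>i. b i \<in> R" "\<And>i. coeff \<phi> i = p * a i + q * b i" by metis
  define A where "A = (\<Sum>i\<le>n. monom (a i) i)"
  define B where "B = (\<Sum>i\<le>n. monom (b i) i)"
  have cA: "coeff A i = (if i \<le> n then a i else 0)" for i unfolding A_def by (simp add: coeff_sum)
  have cB: "coeff B i = (if i \<le> n then b i else 0)" for i unfolding B_def by (simp add: coeff_sum)
  have AB: "A \<in> polys_over R" "B \<in> polys_over R"
    unfolding polys_over_def using cA cB ab subring_0[OF R] by auto
  have dAB: "degree A \<le> n" "degree B \<le> n" by (intro degree_le; simp add: cA cB)+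
  have "\<phi> = smult p A + smult q B"
  proof (rule poly_eqI)
    fix i
    show "coeff \<phi> i = coeff (smult p A + smult q B) i"
    proof (cases "i \<le> n")
      case False
      then show ?thesis using \<phi>(3) by (simp add: cA cB coeff_eq_0)
    qed (simp add: cA cB ab(3))
  qed
  then have "poly \<phi> t = q * poly (pCons 0 A + B) t" using p_eq by (simp add: algebra_simps)
  then have "h = q ^ Suc n * poly (pCons 0 A + B) t" using \<phi>(1) by simp
  moreover have "pCons 0 A + B \<in> polys_over R" using AB polys_over_closed[OF R] subring_0[OF R] by auto
  moreover have "degree (pCons 0 A + B) \<le> Suc n"
    using dAB by (intro degree_add_le) (auto intro: order.trans[OF degree_pCons_le])
  ultimately show ?case unfolding forms_def by blast
qed

text \<open>Modulo p only the term q^(n+1) c of the form survives. Hence p divides c, and cancelling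
  p leaves a form of degree n.\<close>

lemma forms_cancel_p:
  assumes w: "w \<in> R" and "p * w \<in> forms (Suc n)"
  shows "w \<in> forms n"
proof -
  obtain \<phi> where \<phi>: "p * w = q ^ Suc n * poly \<phi> t" "\<phi> \<in> polys_over R" "degree \<phi> \<le> Suc n"
    using assms(2) unfolding forms_def by blast
  obtain c \<psi> where c: "\<phi> = pCons c \<psi>" by (cases \<phi>)
  then have c': "c \<in> R" "\<psi> \<in> polys_over R" using \<phi> polys_over_closed(6)[OF R] by auto
  have d: "degree \<psi> \<le> n" using \<phi> c by (auto split: if_splits)
  have e: "q ^ n * poly \<psi> t \<in> R" using form_in_R c' d by blast
  have "q ^ Suc n * c = p * (w - q ^ n * poly \<psi> t)"
    using \<phi>(1) unfolding c by (simp add: algebra_simps p_eq)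
  then have "dvd_in R p (q ^ Suc n * c)" using subring_diff[OF R w e] by (blast intro: dvd_inI)
  then obtain b where b: "b \<in> R" "c = p * b" using p_dvd_cancel[OF c'(1)] unfolding dvd_in_def by blast
  have "p * (w - q ^ n * poly \<psi> t) = p * (q ^ Suc n * b)"
    unfolding \<open>q ^ Suc n * c = p * (w - q ^ n * poly \<psi> t)\<close>[symmetric] b(2) by (rule mult.left_commute)
  then have "w - q ^ n * poly \<psi> t = q ^ Suc n * b" using p0 by simp
  then have "w = q ^ n * poly (\<psi> + [:q * b:]) t" by (simp add: algebra_simps)
  moreover have "\<psi> + [:q * b:] \<in> polys_over R"
    using c' b polys_over_closed[OF R] subring_mult[OF R qR] by auto
  moreover have "degree (\<psi> + [:q * b:]) \<le> n" using d by (intro degree_add_le) auto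
  ultimately show ?thesis unfolding forms_def by blast
qed

lemma forms_lin:
  assumes "z \<in> forms n"
  shows "z \<in> lin R p (q ^ n)"
proof -
  obtain \<phi> where \<phi>: "z = q ^ n * poly \<phi> t" "\<phi> \<in> polys_over R" "degree \<phi> \<le> n"
    using assms unfolding forms_def by blast
  obtain c \<psi> where c: "\<phi> = pCons c \<psi>" by (cases \<phi>)
  then have c': "c \<in> R" "\<psi> \<in> polys_over R" using \<phi> polys_over_closed(6)[OF R] by auto
  show ?thesis
  proof (cases n)
    case 0
    then have "\<psi> = 0" using \<phi> c by (auto split: if_splits)
    then show ?thesis using \<phi> c c' 0 subring_0[OF R] by (intro linI[of 0 R c]) auto
  next
    case (Suc m)
    have d: "degree \<psi> \<le> m" using \<phi> c Suc by (auto split: if_splits)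
    have "z = p * (q ^ m * poly \<psi> t) + q ^ n * c" using \<phi> c Suc p_eq by (simp add: algebra_simps)
    then show ?thesis using form_in_R[OF c'(2) d] c' linI by blast
  qed
qed

text \<open>Otherwise h lies in every power of M. Write h = p^j h' with p not dividing h'.
  Cancelling p^j puts h' into every power of M, hence into every (p, q^n), against
  \<open>separated\<close>.\<close>

lemma R_q_separated:
  assumes h: "h \<in> R" "h \<noteq> 0"
  shows "\<exists>n. \<forall>e\<in>S. h \<noteq> q ^ n * e"
proof (rule ccontr)
  assume "\<not> ?thesis"
  then have all: "h \<in> forms n" for n using forms_I[OF h(1)] by blast
  obtain j h' where h': "h' \<in> R" "h = p ^ j * h'" "\<not> dvd_in R p h'"
    using prime_multiplicity[OF R prime_p, of h] h ufd_R unfolding ufd_def by blast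
  then obtain n where n: "h' \<notin> lin R p (q ^ n)" using separated by blast
  have "p ^ i * h' \<in> forms (n + i) \<Longrightarrow> h' \<in> forms n" for i
  proof (induction i)
    case (Suc i)
    have "p * (p ^ i * h') \<in> forms (Suc (n + i))" using Suc.prems by (simp add: ac_simps)
    then show ?case using Suc.IH forms_cancel_p h' pR subring_mult[OF R] subring_power[OF R] by blast
  qed simp
  then have "h' \<in> forms n" using all h'(2) by blast
  then show False using forms_lin n by blast
qed

lemma S_power_dvd:
  "f \<in> S \<Longrightarrow> w \<in> T \<Longrightarrow> f = q ^ n * w \<Longrightarrow> \<exists>e\<in>S. f = q ^ n * e"
proof (induction n arbitrary: f)
  case (Suc n)
  have nq: "inverse q \<notin> T" using prime_in_nonunit[OF prime_q_T] .
  have "dvd_in T q f" using Suc.prems qT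
    by (intro dvd_inI[of "q ^ n * w"] subring_mult[OF subring_T] subring_power[OF subring_T]) auto
  then obtain f' where f': "f' \<in> S" "f = q * f'"
    using localization_dvd[OF ST prime_q_S nq Suc.prems(1)] unfolding dvd_in_def by blast
  then have "q * f' = q * (q ^ n * w)" using Suc.prems(3) by (simp only: power_Suc mult.assoc)
  then have "f' = q ^ n * w" using q0 by simp
  then obtain e where "e \<in> S" "f' = q ^ n * e" using Suc.IH f' Suc.prems by blast
  then show ?case using f' by auto
qed auto

lemma T_multiplicity:
  assumes z: "z \<in> T" "z \<noteq> 0"
  shows "\<exists>n. \<exists>w\<in>T. z = q ^ n * w \<and> \<not> dvd_in T q w"
proof (rule ccontr)
  assume n: "\<not> ?thesis"
  have all: "\<exists>w\<in>T. z = q ^ n * w" for n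
  proof (induction n)
    case (Suc n)
    then obtain w where w: "w \<in> T" "z = q ^ n * w" by blast
    then have "dvd_in T q w" using n by blast
    then obtain w' where "w' \<in> T" "w = q * w'" unfolding dvd_in_def by blast
    then show ?case using w by (intro bexI[of _ w']) auto
  qed (use z in auto)
  obtain f g where fg: "f \<in> S" "g \<in> S" "g \<notin> N" "g \<noteq> 0" "inverse g \<in> T" "z = f / g"
    using z(1) by (rule T_cases)
  \<comment> \<open>Unbounded divisibility of z by q is moved to this element of R, where
    \<open>R_q_separated\<close> bounds it.\<close>
  obtain m where m: "q ^ m * f \<in> R" using clear_denominator fg by blast
  have "q ^ m * f \<noteq> 0" using z fg q0 by auto
  then obtain n where n: "\<And>e. e \<in> S \<Longrightarrow> q ^ m * f \<noteq> q ^ n * e" using R_q_separated m by blast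
  obtain w where w: "w \<in> T" "z = q ^ n * w" using all by blast
  have "q ^ m * f = q ^ m * (z * g)" using fg by simp
  also have "\<dots> = q ^ n * (q ^ m * w * g)" unfolding w(2) by (simp add: ac_simps)
  finally have e: "q ^ m * f = q ^ n * (q ^ m * w * g)" .
  have "q ^ m * w * g \<in> T"
    using w fg qT S_sub_T by (intro subring_mult[OF subring_T] subring_power[OF subring_T]) auto
  moreover have "q ^ m * f \<in> S" using m RS by blast
  ultimately show False using S_power_dvd e n by blast
qed

text \<open>Inverting q restores p/q from R, so T[1/q] is a localization of the factorial ring R,
  and Nagata's criterion descends to T.\<close>

lemma ufd_T: "ufd T"
proof (rule nagata_criterion[OF subring_T prime_q_T T_multiplicity])
  let ?L = "{w / q ^ n | w n. w \<in> T}"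
  have LI: "w / q ^ n \<in> ?L" if "w \<in> T" for w n using that by blast
  have TL: "T \<subseteq> ?L" using LI[of _ 0] by auto
  have qp: "q ^ n \<in> T" for n by (intro subring_power[OF subring_T] qT)
  have L: "subring ?L" unfolding subring_def
  proof (intro conjI ballI)
    show "0 \<in> ?L" "1 \<in> ?L" using TL subring_0[OF subring_T] subring_1[OF subring_T] by auto
    fix a b assume "a \<in> ?L" "b \<in> ?L"
    then obtain v m w n where a: "v \<in> T" "a = v / q ^ m" and b: "w \<in> T" "b = w / q ^ n" by blast
    have "a + b = (v * q ^ n + w * q ^ m) / q ^ (m + n)" "a * b = (v * w) / q ^ (m + n)" "- a = (- v) / q ^ m"
      using a b q0 by (simp_all add: add_frac_eq power_add)
    moreover have "v * q ^ n + w * q ^ m \<in> T" "v * w \<in> T" "- v \<in> T"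
      using a b qp by (auto intro!: subring_add[OF subring_T] subring_mult[OF subring_T] subring_uminus[OF subring_T])
    ultimately show "a + b \<in> ?L" "a * b \<in> ?L" "- a \<in> ?L" by blast+
  qed
  have "localization_of R ?L" unfolding localization_of_def
  proof (intro conjI ballI R L)
    show "R \<subseteq> ?L" using RS S_sub_T TL by blast
    fix z assume "z \<in> ?L"
    then obtain w n where w: "w \<in> T" "z = w / q ^ n" by blast
    obtain f g where fg: "f \<in> S" "g \<in> S" "g \<notin> N" "g \<noteq> 0" "inverse g \<in> T" "w = f / g"
      using w(1) by (rule T_cases)
    obtain i where i: "q ^ i * f \<in> R" using clear_denominator fg by blast
    obtain j where j: "q ^ j * g \<in> R" using clear_denominator fg by blast
    have "q ^ j * (q ^ i * f) \<in> R" "q ^ (i + n) * (q ^ j * g) \<in> R"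
      using i j qR by (auto intro!: subring_mult[OF R] subring_power[OF R])
    moreover have "q ^ (i + n) * (q ^ j * g) \<noteq> 0" using q0 fg by simp
    moreover have "inverse (q ^ (i + n) * (q ^ j * g)) = inverse g / q ^ (i + n + j)"
      by (simp add: divide_inverse power_add ac_simps)
    then have "inverse (q ^ (i + n) * (q ^ j * g)) \<in> ?L" using LI[OF fg(5)] by simp
    moreover have "z = (q ^ j * (q ^ i * f)) / (q ^ (i + n) * (q ^ j * g))"
      using w fg q0 by (simp add: power_add field_simps)
    ultimately show "\<exists>r\<in>R. \<exists>s\<in>R. s \<noteq> 0 \<and> inverse s \<in> ?L \<and> z = r / s" by blast
  qed
  then show "ufd ?L" using localization_ufd ufd_R by blast
qed auto

theorem quadratic_transform: "param_ring k T q t"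
proof
  show "k \<subseteq> T" using kR RS S_sub_T by blast
  show "inverse z \<in> T" if "z \<in> T" "z \<notin> M'" for z using unit_T that by blast
qed (use k subring_T ufd_T prime_q_T tT q_ndvd_t residue_T proper_T separated_T in auto)

end

section \<open>The family of second quadratic transforms\<close>

lemma regular2_param_ring:
  assumes "regular_local_dim2 D x y" "coefficient_field D (lin D x y) k"
  shows "param_ring k D x y"
proof -
  interpret regular2 D x y by standard (rule assms)
  show ?thesis
  proof
    show "subfield k" "k \<subseteq> D" using assms(2) unfolding coefficient_field_def by auto
    show "\<not> dvd_in D x y" using x_not_dvd_y_power[of 1] by simp
    show "\<exists>c\<in>k. z - c \<in> M" if "z \<in> D" for z
      using assms(2) that unfolding coefficient_field_def by blast
    show "inverse z \<in> D" if "z \<in> D" "z \<notin> M" for z using unit_D that by blast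
  qed (use D ufd_D prime_x yD one_notin_M separated in auto)
qed

section \<open>Polynomials over an algebraically closed subfield\<close>

lemma alg_closed_root:
  assumes k: "alg_closed_subfield k" and \<phi>: "\<phi> \<in> polys_over k" "degree \<phi> \<ge> 1"
  shows "\<exists>r\<in>k. poly \<phi> r = 0"
proof -
  \<comment> \<open>\<open>alg_closed_subfield\<close> speaks of monic polynomials, hence the
    division by the leading coefficient.\<close>
  define l where "l = lead_coeff \<phi>"
  have l0: "l \<noteq> 0" unfolding l_def using \<phi>(2) by auto
  have ks: "subfield k" "subring k" using k unfolding alg_closed_subfield_def subfield_def by auto
  have lk: "l \<in> k" "coeff \<phi> i \<in> k" for i using \<phi>(1) unfolding l_def polys_over_def by auto
  then have "inverse l \<in> k" using ks l0 unfolding subfield_def by blast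
  then have "\<forall>i<degree \<phi>. inverse l * coeff \<phi> i \<in> k" using lk subring_mult[OF ks(2)] by blast
  then obtain r where r: "r \<in> k" "r ^ degree \<phi> + (\<Sum>i<degree \<phi>. inverse l * coeff \<phi> i * r ^ i) = 0"
    using k[unfolded alg_closed_subfield_def, THEN conjunct2, rule_format,
        of "degree \<phi>" "\<lambda>i. inverse l * coeff \<phi> i"] \<phi>(2) by blast
  have "poly \<phi> r = (\<Sum>i<degree \<phi>. coeff \<phi> i * r ^ i) + l * r ^ degree \<phi>"
    unfolding poly_altdef l_def by (simp flip: lessThan_Suc_atMost)
  also have "(\<Sum>i<degree \<phi>. coeff \<phi> i * r ^ i) = l * (\<Sum>i<degree \<phi>. inverse l * coeff \<phi> i * r ^ i)"
    using l0 by (simp add: sum_distrib_left field_simps)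
  finally have "poly \<phi> r = l * (r ^ degree \<phi> + (\<Sum>i<degree \<phi>. inverse l * coeff \<phi> i * r ^ i))"
    by (simp add: algebra_simps)
  then show ?thesis using r by auto
qed

text \<open>For finite k, the polynomial vanishing on all of k, increased by 1, would have no root
  in k.\<close>

lemma alg_closed_infinite:
  assumes k: "alg_closed_subfield k"
  shows "infinite k"
proof
  assume fin: "finite k"
  have ks: "subring k" using k unfolding alg_closed_subfield_def subfield_def by auto
  define \<phi> where "\<phi> = (\<Prod>a\<in>k. [:- a, 1:])"
  have "finite A \<Longrightarrow> A \<subseteq> k \<Longrightarrow> (\<Prod>a\<in>A. [:- a, 1:]) \<in> polys_over k" for A
    by (induction A rule: finite_induct)
      (auto simp del: mult_pCons_left intro!: polys_over_closed[OF ks]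
        simp: polys_over_closed(6)[OF ks] polys_over_closed(7,8)[OF ks] subring_uminus[OF ks] subring_1[OF ks])
  then have "\<phi> \<in> polys_over k" unfolding \<phi>_def using fin by blast
  then have "\<phi> + 1 \<in> polys_over k" using polys_over_closed[OF ks] by blast
  moreover have "degree \<phi> = card k" unfolding \<phi>_def by (subst degree_prod_eq_sum_degree) auto
  then have "degree \<phi> \<ge> 1" using fin subring_0[OF ks] by (auto simp: Suc_le_eq card_gt_0_iff)
  then have "degree (\<phi> + 1) \<ge> 1" by (simp add: degree_add_eq_left)
  ultimately obtain r where r: "r \<in> k" "poly (\<phi> + 1) r = 0" using alg_closed_root[OF k] by blast
  have "poly \<phi> r = 0" unfolding \<phi>_def poly_prod using fin r by (intro prod_zero) auto
  then show False using r by simp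
qed

lemma synthetic_div_polys_over:
  assumes "subring k" "r \<in> k" "\<phi> \<in> polys_over k"
  shows "synthetic_div \<phi> r \<in> polys_over k"
  using assms(3)
proof (induction \<phi>)
  case (pCons a \<phi>)
  then show ?case using polys_over_closed(6)[OF assms(1)] poly_in_subring[OF assms(1) _ assms(2)]
    by (simp add: synthetic_div_pCons)
qed simp

section \<open>The members of the family and their parameters\<close>

locale beta_family = regular2 D x y for D :: "'a::field set" and x y :: 'a +
  fixes k :: "'a set"
  assumes coef: "coefficient_field D (lin D x y) k" and alg: "alg_closed_subfield k"
begin

abbreviation \<tau> where "\<tau> a \<equiv> (x + a * y) / y"
abbreviation \<upsilon> where "\<upsilon> a \<equiv> y ^ 2 / (x + a * y)"
abbreviation \<alpha> where "\<alpha> a \<equiv> alpha_ring D x y a"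
abbreviation \<beta> where "\<beta> a \<equiv> beta_ring D x y a"
text \<open>Each \<open>\<tau> a\<close> differs from x/y by the constant a, so this is the first
  adjunction for all a at once.\<close>

definition S where "S = adjoin D (x / y)"
definition \<mm> where "\<mm> a = lin (\<beta> a) (\<tau> a) (\<upsilon> a)"
definition B where "B = (\<Inter>a\<in>k. \<beta> a)"

lemma k: "subfield k" and ks: "subring k" and kD: "k \<subseteq> D"
  using coef unfolding coefficient_field_def subfield_def by auto

lemma y0: "y \<noteq> 0"
  using param_ring.q0[OF regular2_param_ring[OF reg coef]] .

text \<open>x + ay and y generate the same maximal ideal as x and y, so they are regular parameters
  with the same coefficient field.\<close>

lemma quadratic_D:
  assumes a: "a \<in> k"
  shows "quadratic k D (x + a * y) y (\<tau> a)"
proof -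
  have aD: "a \<in> D" using a kD by blast
  have x'D: "x + a * y \<in> D" using aD xD yD by (intro subring_closed D)
  have "lin D (x + a * y) y \<subseteq> lin D x y"
    using xM yM aD by (intro lin_subset[OF D ideal_M] ideal_add[OF ideal_M] ideal_mult[OF ideal_M])
  moreover have "lin D x y \<subseteq> lin D (x + a * y) y"
  proof (rule lin_subset[OF D ideal_lin[OF D x'D yD]])
    show "y \<in> lin D (x + a * y) y" using subring_0[OF D] subring_1[OF D] by (intro linI[of 0 D 1]) auto
    show "x \<in> lin D (x + a * y) y"
      using subring_1[OF D] subring_uminus[OF D aD] by (intro linI[of 1 D "- a"]) (auto simp: algebra_simps)
  qed
  ultimately have eq: "lin D (x + a * y) y = lin D x y" by blast
  then have "regular_local_dim2 D (x + a * y) y"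
    using reg x'D unfolding regular_local_dim2_def genideal_lin[OF D xD yD] genideal_lin[OF D x'D yD] by simp
  then have "param_ring k D (x + a * y) y"
    by (rule regular2_param_ring) (unfold eq, rule coef)
  then show ?thesis by (intro quadratic.intro quadratic_axioms.intro) simp_all
qed

lemma quadratic_S: "a \<in> k \<Longrightarrow> quadratic.S D (\<tau> a) = adjoin D (\<tau> a)"
  by (rule quadratic.S_def[OF quadratic_D])

lemma alpha_eq: "a \<in> k \<Longrightarrow> quadratic.T D y (\<tau> a) = \<alpha> a"
  unfolding quadratic.T_def[OF quadratic_D] quadratic.S_def[OF quadratic_D] alpha_ring_def Let_def ..

lemma quadratic_alpha:
  assumes a: "a \<in> k"
  shows "quadratic k (\<alpha> a) y (\<tau> a) (\<upsilon> a)"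
proof -
  have "param_ring k (\<alpha> a) y (\<tau> a)"
    using quadratic.quadratic_transform[OF quadratic_D[OF a]] alpha_eq[OF a] by simp
  then show ?thesis by (intro quadratic.intro quadratic_axioms.intro) (simp_all add: power2_eq_square)
qed

lemma beta_eq: "a \<in> k \<Longrightarrow> quadratic.T (\<alpha> a) (\<tau> a) (\<upsilon> a) = \<beta> a"
  unfolding quadratic.T_def[OF quadratic_alpha] quadratic.S_def[OF quadratic_alpha] beta_ring_def Let_def ..

lemma param_beta: "a \<in> k \<Longrightarrow> param_ring k (\<beta> a) (\<tau> a) (\<upsilon> a)"
  using quadratic.quadratic_transform[OF quadratic_alpha] beta_eq by simp

lemma tau0: "a \<in> k \<Longrightarrow> \<tau> a \<noteq> 0"
  using quadratic.t0[OF quadratic_D] .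

lemma tau_upsilon: "a \<in> k \<Longrightarrow> \<tau> a * \<upsilon> a = y"
  using tau0[of a] by (simp add: power2_eq_square)

lemma tau_diff: "\<tau> a - \<tau> b = a - b"
  using y0 by (simp add: field_simps)

lemma S_eq: "a \<in> k \<Longrightarrow> S = adjoin D (\<tau> a)"
proof -
  assume a: "a \<in> k"
  have t: "\<tau> a = x / y + a" using y0 by (simp add: field_simps)
  have aD: "a \<in> D" using a kD by blast
  have "\<tau> a \<in> S" unfolding t S_def using adjoin_props[OF D, of "x / y"] aD
    by (intro subring_add[OF adjoin_props(1)[OF D]]) auto
  moreover have "x / y = \<tau> a - a" unfolding t by simp
  then have "x / y \<in> adjoin D (\<tau> a)" using adjoin_props[OF D, of "\<tau> a"] aD
    by (metis subring_diff subsetD)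
  ultimately show ?thesis using adjoin_props[OF D] adjoin_least unfolding S_def by (metis subset_antisym)
qed

lemma S: "subring S" and DS: "D \<subseteq> S" and kS: "k \<subseteq> S" and yS: "y \<in> S"
  unfolding S_def using adjoin_props[OF D, of "x / y"] kD yD by auto

lemma tauS: "a \<in> k \<Longrightarrow> \<tau> a \<in> S"
  using S_eq adjoin_props(3)[OF D] by simp

lemma qS_eq: "a \<in> k \<Longrightarrow> quadratic.S D (\<tau> a) = S"
  using quadratic_S S_eq by simp

lemma S_alpha: "a \<in> k \<Longrightarrow> S \<subseteq> \<alpha> a"
  using quadratic.S_sub_T[OF quadratic_D] qS_eq alpha_eq by simp

lemma alpha: "a \<in> k \<Longrightarrow> subring (\<alpha> a)"
  using param_ring.R[OF quadratic.axioms(1)[OF quadratic_alpha]] .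

lemma beta: "a \<in> k \<Longrightarrow> subring (\<beta> a)"
  using param_ring.R[OF param_beta] .

lemma ufd_beta: "a \<in> k \<Longrightarrow> ufd (\<beta> a)"
  using param_ring.ufd_R[OF param_beta] .

lemma adjoin_beta: "a \<in> k \<Longrightarrow> adjoin (\<alpha> a) (\<upsilon> a) \<subseteq> \<beta> a"
  using quadratic.S_sub_T[OF quadratic_alpha] quadratic.S_def[OF quadratic_alpha] beta_eq by simp

lemma alpha_beta: "a \<in> k \<Longrightarrow> \<alpha> a \<subseteq> \<beta> a"
  using adjoin_beta adjoin_props(2)[OF alpha] by blast

lemma S_beta: "a \<in> k \<Longrightarrow> S \<subseteq> \<beta> a"
  using S_alpha alpha_beta by blast

lemma upsilon_beta: "a \<in> k \<Longrightarrow> \<upsilon> a \<in> \<beta> a"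
  using adjoin_beta adjoin_props(3)[OF alpha] by blast

lemma alpha_cases:
  assumes "a \<in> k" "z \<in> \<alpha> a"
  obtains f g where "f \<in> S" "g \<in> S" "g \<noteq> 0" "inverse g \<in> \<alpha> a" "z = f / g"
  using quadratic.T_cases[OF quadratic_D[OF assms(1)], unfolded alpha_eq[OF assms(1)] qS_eq[OF assms(1)], OF assms(2)]
  by blast

lemma beta_cases0:
  assumes "a \<in> k" "z \<in> \<beta> a"
  obtains f g where "f \<in> adjoin (\<alpha> a) (\<upsilon> a)" "g \<in> adjoin (\<alpha> a) (\<upsilon> a)"
    "g \<noteq> 0" "inverse g \<in> \<beta> a" "z = f / g"
  using quadratic.T_cases[OF quadratic_alpha[OF assms(1)], unfolded beta_eq[OF assms(1)]
      quadratic.S_def[OF quadratic_alpha[OF assms(1)]], OF assms(2)]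
  by blast

lemma ideal_m: "a \<in> k \<Longrightarrow> ideal_of (\<beta> a) (\<mm> a)"
  unfolding \<mm>_def using param_ring.ideal_M[OF param_beta] .

lemma one_notin_m: "a \<in> k \<Longrightarrow> 1 \<notin> \<mm> a"
  unfolding \<mm>_def using param_ring.proper[OF param_beta] .

lemma m_unit: "a \<in> k \<Longrightarrow> z \<in> \<beta> a \<Longrightarrow> z \<notin> \<mm> a \<Longrightarrow> z \<noteq> 0 \<and> inverse z \<in> \<beta> a"
  using param_ring.unit[OF param_beta, of a z] ideal_0[OF ideal_m, of a] unfolding \<mm>_def by auto

lemma m_nonunit: "a \<in> k \<Longrightarrow> z \<in> \<mm> a \<Longrightarrow> z \<noteq> 0 \<Longrightarrow> inverse z \<notin> \<beta> a"
  using ideal_mult[OF ideal_m, of a "inverse z" z] one_notin_m by auto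

lemma tau_m: "a \<in> k \<Longrightarrow> \<tau> a \<in> \<mm> a" and upsilon_m: "a \<in> k \<Longrightarrow> \<upsilon> a \<in> \<mm> a"
  unfolding \<mm>_def
  using lin_left[OF beta subring_1[OF beta], of a "\<tau> a" "\<upsilon> a"]
    lin_right[OF beta subring_1[OF beta], of a "\<upsilon> a" "\<tau> a"] by (simp_all only: mult_1_right)

lemma y_m: "a \<in> k \<Longrightarrow> y \<in> \<mm> a"
  using ideal_mult_right[OF ideal_m tau_m upsilon_beta, of a] tau_upsilon[of a] by (simp only:)

lemma k_m: "a \<in> k \<Longrightarrow> c \<in> k \<Longrightarrow> c \<noteq> 0 \<Longrightarrow> c \<notin> \<mm> a"
proof
  assume a: "a \<in> k" and c: "c \<in> k" "c \<noteq> 0" "c \<in> \<mm> a"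
  have "inverse c \<in> k" using k c unfolding subfield_def by blast
  then have "inverse c \<in> \<beta> a" using kS S_beta[OF a] by blast
  then show False using m_nonunit[OF a c(3,2)] by blast
qed

text \<open>\<open>\<tau> a\<close> and \<open>\<tau> b\<close> differ by the non-zero constant a -
  b, and \<open>\<tau> b\<close> lies in the maximal ideal at b.\<close>

lemma inverse_tau:
  assumes "a \<in> k" "b \<in> k" "a \<noteq> b"
  shows "inverse (\<tau> a) \<in> \<beta> b"
proof -
  have "\<tau> a \<notin> \<mm> b"
  proof
    assume "\<tau> a \<in> \<mm> b"
    then have "\<tau> a - \<tau> b \<in> \<mm> b" by (rule ideal_diff[OF beta[OF assms(2)] ideal_m[OF assms(2)] _ tau_m[OF assms(2)]])
    then have "a - b \<in> \<mm> b" unfolding tau_diff .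
    then show False using k_m[of b "a - b"] assms subring_diff[OF ks] by simp
  qed
  then show ?thesis using m_unit[of b "\<tau> a"] tauS assms S_beta by blast
qed

lemma upsilon_mb: "a \<in> k \<Longrightarrow> b \<in> k \<Longrightarrow> \<upsilon> a \<in> \<mm> b"
proof (cases "a = b")
  case False
  assume ab: "a \<in> k" "b \<in> k"
  have "\<upsilon> a = y * inverse (\<tau> a)" using tau_upsilon[OF ab(1)] tau0[OF ab(1)]
    by (simp add: power2_eq_square divide_inverse)
  moreover have "y * inverse (\<tau> a) \<in> \<mm> b"
    using ideal_mult_right[OF ideal_m y_m inverse_tau[OF ab False]] ab by blast
  ultimately show ?thesis by (simp only:)
qed (use upsilon_m in blast)

section \<open>The intersection B and its localizations at the centers\<close>

lemma B: "subring B"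
  unfolding B_def subring_def
  by (intro conjI ballI INT_I subring_0[OF beta] subring_1[OF beta] subring_add[OF beta]
      subring_mult[OF beta] subring_uminus[OF beta]) auto

lemma B_beta: "a \<in> k \<Longrightarrow> B \<subseteq> \<beta> a" unfolding B_def by blast

lemma SB: "S \<subseteq> B" unfolding B_def using S_beta by blast

lemma upsilon_B: "a \<in> k \<Longrightarrow> \<upsilon> a \<in> B"
  unfolding B_def by (intro INT_I ideal_sub[OF ideal_m upsilon_mb])

lemma adjoin_B: "a \<in> k \<Longrightarrow> adjoin S (\<upsilon> a) \<subseteq> B"
  by (rule adjoin_least[OF B SB upsilon_B])

text \<open>The elements that admit such a denominator form a subring containing
  \<open>\<alpha> a\<close> and \<open>\<upsilon> a\<close>. Thus the localization in the first
  transform can be postponed to the end.\<close>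

lemma adjoin_alpha_denominator:
  assumes a: "a \<in> k" and "f \<in> adjoin (\<alpha> a) (\<upsilon> a)"
  shows "\<exists>s\<in>S. s \<noteq> 0 \<and> inverse s \<in> \<alpha> a \<and> s * f \<in> adjoin S (\<upsilon> a)"
proof -
  let ?A = "adjoin S (\<upsilon> a)"
  let ?E = "{f. \<exists>s\<in>S. s \<noteq> 0 \<and> inverse s \<in> \<alpha> a \<and> s * f \<in> ?A}"
  note A = adjoin_props[OF S, of "\<upsilon> a"]
  have EI: "f \<in> ?E" if "s \<in> S" "s \<noteq> 0" "inverse s \<in> \<alpha> a" "s * f \<in> ?A" for s f using that by blast
  have one: "1 \<in> S" "inverse 1 \<in> \<alpha> a" using subring_1[OF S] subring_1[OF alpha[OF a]] by auto
  have "subring ?E" unfolding subring_def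
  proof (intro conjI ballI)
    show "0 \<in> ?E" by (rule EI[of 1]) (use one subring_0[OF A(1)] in simp_all)
    show "1 \<in> ?E" by (rule EI[of 1]) (use one subring_1[OF A(1)] in simp_all)
    fix f g assume "f \<in> ?E" "g \<in> ?E"
    then obtain s r where s: "s \<in> S" "s \<noteq> 0" "inverse s \<in> \<alpha> a" "s * f \<in> ?A"
      and r: "r \<in> S" "r \<noteq> 0" "inverse r \<in> \<alpha> a" "r * g \<in> ?A" by blast
    have sr: "s * r \<in> S" "s * r \<noteq> 0" "inverse (s * r) \<in> \<alpha> a"
      using s r subring_mult[OF S] subring_mult[OF alpha[OF a]] by simp_all
    have rs: "r \<in> ?A" "s \<in> ?A" using r s A(2) by blast+
    have "s * r * (f + g) = r * (s * f) + s * (r * g)" "s * r * (f * g) = (s * f) * (r * g)"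
      "s * (- f) = - (s * f)" by (simp_all add: algebra_simps)
    moreover have "r * (s * f) + s * (r * g) \<in> ?A" "(s * f) * (r * g) \<in> ?A" "- (s * f) \<in> ?A"
      using rs r(4) s(4) by (simp_all add: subring_add[OF A(1)] subring_mult[OF A(1)] subring_uminus[OF A(1)])
    ultimately have "s * r * (f + g) \<in> ?A" "s * r * (f * g) \<in> ?A" "s * (- f) \<in> ?A" by metis+
    then show "f + g \<in> ?E" "f * g \<in> ?E" "- f \<in> ?E"
      using EI[OF sr] EI[OF s(1,2,3)] by blast+
  qed
  moreover have "\<alpha> a \<subseteq> ?E"
  proof
    fix z assume "z \<in> \<alpha> a"
    then obtain f g where fg: "f \<in> S" "g \<in> S" "g \<noteq> 0" "inverse g \<in> \<alpha> a" "z = f / g"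
      using alpha_cases[OF a] by blast
    then show "z \<in> ?E" using A(2) by (intro EI[of g]) auto
  qed
  moreover have "\<upsilon> a \<in> ?E" using one A(3) by (intro EI[of 1]) auto
  ultimately have "adjoin (\<alpha> a) (\<upsilon> a) \<subseteq> ?E" by (rule adjoin_least)
  then show ?thesis using assms(2) by blast
qed

text \<open>Both localizations are merged into one: \<open>\<beta> a\<close> consists of fractions
  over S[\<open>\<upsilon> a\<close>]. Unlike \<open>\<alpha> a\<close> with
  \<open>\<upsilon> a\<close> adjoined, this ring is known to lie in B by \<open>adjoin_B\<close>,
  which gives \<open>essential\<close>.\<close>

lemma beta_cases:
  assumes a: "a \<in> k" and z: "z \<in> \<beta> a"
  obtains f g where "f \<in> adjoin S (\<upsilon> a)" "g \<in> adjoin S (\<upsilon> a)" "g \<noteq> 0" "inverse g \<in> \<beta> a" "z = f / g"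
proof -
  obtain f g where fg: "f \<in> adjoin (\<alpha> a) (\<upsilon> a)" "g \<in> adjoin (\<alpha> a) (\<upsilon> a)"
    "g \<noteq> 0" "inverse g \<in> \<beta> a" "z = f / g" using beta_cases0[OF a z] by blast
  note A = adjoin_props[OF S, of "\<upsilon> a"]
  obtain s where s: "s \<in> S" "s \<noteq> 0" "inverse s \<in> \<alpha> a" "s * f \<in> adjoin S (\<upsilon> a)"
    using adjoin_alpha_denominator[OF a fg(1)] by blast
  obtain r where r: "r \<in> S" "r \<noteq> 0" "inverse r \<in> \<alpha> a" "r * g \<in> adjoin S (\<upsilon> a)"
    using adjoin_alpha_denominator[OF a fg(2)] by blast
  have "r * (s * f) \<in> adjoin S (\<upsilon> a)" "s * (r * g) \<in> adjoin S (\<upsilon> a)"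
    using r s A(2) by (auto intro!: subring_mult[OF A(1)])
  moreover have "s * (r * g) \<noteq> 0" using s r fg by simp
  moreover have "inverse (s * (r * g)) \<in> \<beta> a"
    using s r fg alpha_beta[OF a] by (auto intro!: subring_mult[OF beta[OF a]])
  moreover have "z = (r * (s * f)) / (s * (r * g))" using fg s r by simp
  ultimately show ?thesis by (rule that)
qed

definition center where "center a = B \<inter> \<mm> a"

lemma prime_center:
  assumes a: "a \<in> k"
  shows "prime_ideal_of B (center a)"
  unfolding prime_ideal_of_def
proof (intro conjI ballI impI)
  show "ideal_of B (center a)"
    unfolding ideal_of_def center_def
  proof (intro conjI ballI IntI)
    show "0 \<in> B" "0 \<in> \<mm> a" using subring_0[OF B] ideal_0[OF ideal_m[OF a]] by auto
    show "u + v \<in> B" "u + v \<in> \<mm> a" if "u \<in> B \<inter> \<mm> a" "v \<in> B \<inter> \<mm> a" for u v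
      using that subring_add[OF B] ideal_add[OF ideal_m[OF a]] by auto
    show "r * u \<in> B" "r * u \<in> \<mm> a" if "r \<in> B" "u \<in> B \<inter> \<mm> a" for r u
      using that subring_mult[OF B] ideal_mult[OF ideal_m[OF a]] B_beta[OF a] by auto
  qed simp
  show "center a \<noteq> B" unfolding center_def using one_notin_m[OF a] subring_1[OF B] by blast
  fix r s assume rs: "r \<in> B" "s \<in> B" "r * s \<in> center a"
  show "r \<in> center a \<or> s \<in> center a"
  proof (rule ccontr)
    assume "\<not> ?thesis"
    then have "r \<noteq> 0 \<and> inverse r \<in> \<beta> a" "s \<noteq> 0 \<and> inverse s \<in> \<beta> a"
      using m_unit[OF a] rs B_beta[OF a] unfolding center_def by blast+
    then have "r * s \<noteq> 0" "inverse (r * s) \<in> \<beta> a" using subring_mult[OF beta[OF a]] by simp_all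
    then show False using m_nonunit[OF a] rs unfolding center_def by blast
  qed
qed

lemma essential:
  assumes a: "a \<in> k"
  shows "\<beta> a = loc B (center a)"
proof (intro equalityI subsetI)
  fix z assume "z \<in> \<beta> a"
  then obtain f g where fg: "f \<in> adjoin S (\<upsilon> a)" "g \<in> adjoin S (\<upsilon> a)" "g \<noteq> 0" "inverse g \<in> \<beta> a" "z = f / g"
    using beta_cases[OF a] by blast
  then have "g \<notin> center a" unfolding center_def using m_nonunit[OF a] by blast
  then show "z \<in> loc B (center a)" unfolding loc_def using fg adjoin_B[OF a] by blast
next
  fix z assume "z \<in> loc B (center a)"
  then obtain r s where rs: "r \<in> B" "s \<in> B" "s \<notin> center a" "z = r / s" unfolding loc_def by blast
  then have "inverse s \<in> \<beta> a" using m_unit[OF a] B_beta[OF a] unfolding center_def by blast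
  then show "z \<in> \<beta> a" using rs B_beta[OF a] subring_mult[OF beta[OF a]] by (auto simp: divide_inverse)
qed

lemma irredundant:
  assumes b: "b \<in> k"
  shows "(\<Inter>a\<in>k - {b}. \<beta> a) \<noteq> B"
proof -
  have "inverse (\<tau> b) \<in> (\<Inter>a\<in>k - {b}. \<beta> a)" using inverse_tau b by blast
  moreover have "inverse (\<tau> b) \<notin> B" using m_nonunit[OF b tau_m[OF b] tau0[OF b]] B_beta[OF b] by blast
  ultimately show ?thesis by blast
qed

text \<open>At b outside F every factor of the denominator is a unit. At b in F the factor
  \<open>\<tau> b\<close> cancels against y = \<open>\<tau> b * \<upsilon> b\<close>, and the others
  are units.\<close>

lemma y_div_prod_B:
  assumes F: "finite F" "F \<subseteq> k"
  shows "y / (\<Prod>a\<in>F. \<tau> a) \<in> B"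
  unfolding B_def
proof
  fix b assume b: "b \<in> k"
  have inv: "inverse (\<Prod>a\<in>G. \<tau> a) \<in> \<beta> b" if "finite G" "G \<subseteq> k - {b}" for G
    using that
  proof (induction G rule: finite_induct)
    case empty
    then show ?case using subring_1[OF beta[OF b]] by simp
  next
    case (insert a G)
    have "inverse (\<tau> a) \<in> \<beta> b" using inverse_tau insert b by blast
    moreover have "inverse (\<Prod>a\<in>G. \<tau> a) \<in> \<beta> b" using insert by blast
    moreover have "inverse (\<Prod>a\<in>insert a G. \<tau> a) = inverse (\<tau> a) * inverse (\<Prod>a\<in>G. \<tau> a)"
      unfolding prod.insert[OF insert.hyps] by (rule inverse_mult_distrib)
    ultimately show ?case using subring_mult[OF beta[OF b]] by metis
  qed
  show "y / (\<Prod>a\<in>F. \<tau> a) \<in> \<beta> b"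
  proof (cases "b \<in> F")
    case True
    have "(\<Prod>a\<in>F. \<tau> a) = \<tau> b * (\<Prod>a\<in>F - {b}. \<tau> a)" by (rule prod.remove[OF F(1) True])
    then have "y / (\<Prod>a\<in>F. \<tau> a) = (\<tau> b * \<upsilon> b) / (\<tau> b * (\<Prod>a\<in>F - {b}. \<tau> a))"
      using tau_upsilon[OF b] by (simp only:)
    also have "\<dots> = \<upsilon> b * inverse (\<Prod>a\<in>F - {b}. \<tau> a)"
      unfolding mult_divide_mult_cancel_left[OF tau0[OF b]] by (rule divide_inverse)
    also have "\<dots> \<in> \<beta> b" using F upsilon_beta[OF b] by (intro subring_mult[OF beta[OF b]] inv) auto
    finally show ?thesis .
  next
    case False
    have "y / (\<Prod>a\<in>F. \<tau> a) = y * inverse (\<Prod>a\<in>F. \<tau> a)" by (simp only: divide_inverse)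
    also have "\<dots> \<in> \<beta> b" using F False yS S_beta[OF b] by (intro subring_mult[OF beta[OF b]] inv) auto
    finally show ?thesis .
  qed
qed

text \<open>Distinct indices exist without end since k is infinite. Each quotient p n is
  \<open>\<tau> (f n)\<close> times the next one, and \<open>\<tau> (f n)\<close> is not a unit of B
  because it lies in the maximal ideal at f n. So the principal ideals never become
  stationary.\<close>

lemma not_noetherian: "\<not> noetherian B"
proof
  assume N: "noetherian B"
  obtain f :: "nat \<Rightarrow> 'a" where f: "inj f" "range f \<subseteq> k"
    using alg_closed_infinite[OF alg] infinite_countable_subset by blast
  define p where "p n = y / (\<Prod>a\<in>f ` {..<n}. \<tau> a)" for n
  have pB: "p n \<in> B" for n unfolding p_def using f by (intro y_div_prod_B) auto
  have nz: "(\<Prod>a\<in>f ` {..<n}. \<tau> a) \<noteq> 0" for n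
  proof -
    have "\<forall>a\<in>f ` {..<n}. \<tau> a \<noteq> 0" using tau0 f by blast
    then show ?thesis by (simp only: prod_zero_iff finite_imageI finite_lessThan) blast
  qed
  have p0: "p n \<noteq> 0" for n unfolding p_def using y0 nz[of n] by (simp only: divide_eq_0_iff) blast
  have step: "p n = \<tau> (f n) * p (Suc n)" for n
  proof -
    have "f n \<notin> f ` {..<n}" using f(1) by (auto dest: injD)
    then have "(\<Prod>a\<in>f ` {..<Suc n}. \<tau> a) = \<tau> (f n) * (\<Prod>a\<in>f ` {..<n}. \<tau> a)"
      unfolding lessThan_Suc image_insert by (intro prod.insert) auto
    then have "\<tau> (f n) * p (Suc n) = (\<tau> (f n) * y) / (\<tau> (f n) * (\<Prod>a\<in>f ` {..<n}. \<tau> a))"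
      unfolding p_def by (simp only: times_divide_eq_right)
    also have "\<dots> = p n" unfolding p_def by (rule mult_divide_mult_cancel_left) (use tau0 f in blast)
    finally show ?thesis by (rule sym)
  qed
  have tB: "\<tau> (f n) \<in> B" for n using tauS SB f by blast
  define K where "K n = {p n * a | a. a \<in> B}" for n
  have "ideal_of B (K n)" for n unfolding K_def by (intro ideal_principal B pB)
  moreover have "K n \<subseteq> K (Suc n)" for n
  proof
    fix z assume "z \<in> K n"
    then obtain a where "a \<in> B" "z = p n * a" unfolding K_def by blast
    then have "\<tau> (f n) * a \<in> B" "z = p (Suc n) * (\<tau> (f n) * a)"
      using step[of n] tB subring_mult[OF B] by (simp_all only: ac_simps)
    then show "z \<in> K (Suc n)" unfolding K_def by blast
  qed
  ultimately obtain n where "\<forall>m\<ge>n. K m = K n" using noetherian_acc[OF B N, of K] by blast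
  then have "K (Suc n) = K n" using le_SucI[OF order_refl] by blast
  moreover have "p (Suc n) * 1 \<in> K (Suc n)" unfolding K_def using subring_1[OF B] by blast
  ultimately obtain c where c: "c \<in> B" "p (Suc n) * 1 = p n * c" unfolding K_def by blast
  then have "p (Suc n) * 1 = p (Suc n) * (\<tau> (f n) * c)" using step[of n] by (simp only: ac_simps)
  then have "\<tau> (f n) * c = 1" unfolding mult_left_cancel[OF p0] by (rule sym)
  then have "inverse (\<tau> (f n)) = c" by (rule inverse_unique)
  moreover have fn: "f n \<in> k" using f by blast
  ultimately show False using m_nonunit[OF fn tau_m[OF fn] tau0[OF fn]] B_beta[OF fn] c by blast
qed

section \<open>The localizations of B are Krull domains\<close>

lemma loc_frac:
  assumes "R \<subseteq> frac D"
  shows "loc R P \<subseteq> frac D"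
proof
  fix z assume "z \<in> loc R P"
  then obtain r s where "r \<in> frac D" "s \<in> frac D" "z = r * inverse s"
    using assms unfolding loc_def by (auto simp: divide_inverse)
  then show "z \<in> frac D" using frac_closed(1,4)[OF D] by simp
qed

lemma B_frac: "B \<subseteq> frac D"
proof -
  note F = subring_frac[OF D]
  have D_frac: "D \<subseteq> frac D" using frac_closed(3)[OF D] by blast
  have z: "0 \<in> k" using subring_0[OF ks] .
  have loc_sub: "loc R P \<subseteq> frac D" if "R \<subseteq> frac D" for R P
    using that by (rule loc_frac)
  have x'D: "x + 0 * y \<in> frac D" "y \<in> frac D" using D_frac xD yD by auto
  then have t: "\<tau> 0 \<in> frac D" "\<upsilon> 0 \<in> frac D"
    using frac_closed[OF D] unfolding divide_inverse power2_eq_square by blast+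
  have "\<alpha> 0 \<subseteq> frac D" unfolding alpha_ring_def Let_def
    by (intro loc_sub adjoin_least F D_frac t)
  then have "\<beta> 0 \<subseteq> frac D" unfolding beta_ring_def Let_def
    by (intro loc_sub adjoin_least F t)
  then show ?thesis using B_beta[OF z] by blast
qed

text \<open>The hypotheses on D are symmetric in x and y, so \<open>overring_localization\<close> is
  used with the two exchanged.\<close>

lemma krull_away_from_y:
  assumes P: "prime_ideal_of B P" and "y \<notin> P"
  shows "krull_domain (loc B P)"
proof -
  have reg': "regular_local_dim2 D y x"
    using reg unfolding regular_local_dim2_def by (simp add: insert_commute)
  interpret swap: regular2 D y x by standard (rule reg')
  have L: "localization_of B (loc B P)" using loc_localization(1)[OF B P] .
  have "inverse y \<in> loc B P" using loc_localization(2)[OF B P] assms(2) yS SB by blast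
  moreover have "loc B P \<subseteq> frac D" by (rule loc_frac[OF B_frac])
  moreover have "D \<subseteq> loc B P" using L DS SB unfolding localization_of_def by blast
  ultimately have "localization_of D (loc B P)"
    using L swap.overring_localization unfolding localization_of_def by blast
  then show ?thesis using localization_ufd ufd_D ufd_krull_domain by blast
qed

text \<open>An element s of B outside the center is a unit at a. Multiplying by the denominator g,
  also a unit there, moves it into S[\<open>\<upsilon> a\<close>], where it can be reduced to a
  polynomial over k.\<close>

lemma center_complement:
  assumes a: "a \<in> k" and s: "s \<in> B" "s \<notin> center a"
  obtains f g where "f \<in> adjoin S (\<upsilon> a)" "g \<in> B" "f = s * g" "f \<notin> \<mm> a"
proof -
  have s': "s \<in> \<beta> a" "s \<noteq> 0" "inverse s \<in> \<beta> a"
    using m_unit[OF a] s B_beta[OF a] unfolding center_def by blast+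
  obtain f g where fg: "f \<in> adjoin S (\<upsilon> a)" "g \<in> adjoin S (\<upsilon> a)" "g \<noteq> 0" "inverse g \<in> \<beta> a" "s = f / g"
    using beta_cases[OF a s'(1)] by blast
  have f: "f = s * g" using fg by simp
  have "f \<noteq> 0" unfolding f using s' fg(3) by simp
  moreover have "inverse f \<in> \<beta> a"
    unfolding f inverse_mult_distrib using s'(3) fg(4) by (rule subring_mult[OF beta[OF a]])
  ultimately have "f \<notin> \<mm> a" using m_nonunit[OF a] by blast
  then show ?thesis using that fg(1,2) f adjoin_B[OF a] by blast
qed

text \<open>Modulo \<open>\<tau> a\<close> also y = \<open>\<tau> a * \<upsilon> a\<close> vanishes,
  so S[\<open>\<upsilon> a\<close>] reduces to polynomials in \<open>\<upsilon> a\<close> over k. An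
  element f of P that is a unit at a reduces to one with non-zero constant term. As
  \<open>\<upsilon> a\<close> lies in all the maximal ideals, that polynomial is a unit of B, yet it
  belongs to P.\<close>

lemma subset_center_if_tau:
  assumes P: "prime_ideal_of B P" and a: "a \<in> k" and tP: "\<tau> a \<in> P"
  shows "P \<subseteq> center a"
proof
  fix s assume sP: "s \<in> P"
  note I = prime_idealD(1)[OF P]
  show "s \<in> center a"
  proof (rule ccontr)
    assume "s \<notin> center a"
    then obtain f g where f: "f \<in> adjoin S (\<upsilon> a)" "g \<in> B" "f = s * g" "f \<notin> \<mm> a"
      using center_complement[OF a ideal_sub[OF I sP]] by blast
    have fP: "f \<in> P" using f sP ideal_mult_right[OF I] by blast
    let ?A = "adjoin S (\<upsilon> a)"
    note A = adjoin_props[OF S, of "\<upsilon> a"]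
    have tA: "\<tau> a \<in> ?A" using tauS[OF a] A(2) by blast
    \<comment> \<open>Residues of S modulo (y, \<open>\<tau> a\<close>) become residues modulo
      \<open>\<tau> a\<close> alone, because y is a multiple of \<open>\<tau> a\<close> once
      \<open>\<upsilon> a\<close> is adjoined.\<close>
    have "\<exists>c\<in>k. r - c \<in> {\<tau> a * h | h. h \<in> ?A}" if r: "r \<in> S" for r
    proof -
      obtain c where c: "c \<in> k" "r - c \<in> lin S y (\<tau> a)"
        using quadratic.residue_S[OF quadratic_D[OF a], unfolded quadratic.N_def[OF quadratic_D[OF a]] qS_eq[OF a], OF r]
        by blast
      obtain e e' where e: "e \<in> S" "e' \<in> S" "r - c = y * e + \<tau> a * e'" using c(2) by (rule linE)
      have "r - c = \<tau> a * \<upsilon> a * e + \<tau> a * e'" unfolding tau_upsilon[OF a] by (rule e(3))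
      also have "\<dots> = \<tau> a * (\<upsilon> a * e + e')" by (simp only: distrib_left mult.assoc)
      finally have "r - c = \<tau> a * (\<upsilon> a * e + e')" .
      moreover have "\<upsilon> a * e + e' \<in> ?A"
        using e A by (intro subring_add[OF A(1)] subring_mult[OF A(1)]) auto
      ultimately show ?thesis using c by blast
    qed
    then obtain \<phi> where \<phi>: "\<phi> \<in> polys_over k" "f - poly \<phi> (\<upsilon> a) \<in> {\<tau> a * h | h. h \<in> ?A}"
      using adjoin_mod[OF S ks ideal_principal[OF A(1) tA] kS _ f(1)] by blast
    then obtain h where h: "h \<in> ?A" "f - poly \<phi> (\<upsilon> a) = \<tau> a * h" by blast
    have hB: "h \<in> B" using h adjoin_B[OF a] by blast
    obtain c \<psi> where c: "\<phi> = pCons c \<psi>" by (cases \<phi>)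
    then have c': "c \<in> k" "\<psi> \<in> polys_over k" using \<phi> polys_over_closed(6)[OF ks] by auto
    define w where "w = poly \<psi> (\<upsilon> a)"
    have "\<psi> \<in> polys_over B" using c' kS SB unfolding polys_over_def by blast
    then have w: "w \<in> B" unfolding w_def using poly_in_subring[OF B _ upsilon_B[OF a]] by blast
    define v where "v = c + \<upsilon> a * w"
    have "poly \<phi> (\<upsilon> a) = v" unfolding v_def w_def c by (rule poly_pCons)
    then have f_eq: "f - v = \<tau> a * h" using h by simp
    have cB: "c \<in> B" using c' kS SB by blast
    have vB: "v \<in> B" unfolding v_def using cB w upsilon_B[OF a] by (intro subring_add[OF B] subring_mult[OF B])
    have um: "\<upsilon> a * w \<in> \<mm> b" if "b \<in> k" for b
      using ideal_mult_right[OF ideal_m upsilon_mb[OF a]] that w B_beta by blast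
    have "c \<noteq> 0"
    proof
      assume "c = 0"
      then have "f = \<tau> a * h + \<upsilon> a * w" using f_eq unfolding v_def by (simp add: algebra_simps)
      moreover have "\<tau> a * h \<in> \<mm> a" using ideal_mult_right[OF ideal_m[OF a] tau_m[OF a]] hB B_beta[OF a] by blast
      ultimately show False using f ideal_add[OF ideal_m[OF a]] um[OF a] by simp
    qed
    \<comment> \<open>Invertibility is needed at every b, not only at a, to obtain the inverse of v
      in B.\<close>
    have v_unit: "v \<noteq> 0 \<and> inverse v \<in> \<beta> b" if b: "b \<in> k" for b
    proof (rule m_unit[OF b])
      show "v \<in> \<beta> b" using vB B_beta[OF b] by blast
      show "v \<notin> \<mm> b"
      proof
        assume "v \<in> \<mm> b"
        then have "v - \<upsilon> a * w \<in> \<mm> b" using ideal_diff[OF beta[OF b] ideal_m[OF b] _ um[OF b]] by blast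
        then have "c \<in> \<mm> b" unfolding v_def by simp
        then show False using k_m[OF b c'(1)] \<open>c \<noteq> 0\<close> by blast
      qed
    qed
    then have "inverse v \<in> B" unfolding B_def by blast
    moreover have "v = f - \<tau> a * h" using f_eq by (simp add: algebra_simps)
    then have "v \<in> P" using ideal_diff[OF B I fP ideal_mult_right[OF I tP hB]] by simp
    ultimately have "inverse v * v \<in> P" using ideal_mult[OF I] by blast
    then show False using v_unit[OF a] prime_idealD(2)[OF P] by simp
  qed
qed

text \<open>Over k the polynomial splits into linear factors, and the factor for the root r takes
  the value \<open>\<tau> 0 - r\<close>, which is \<open>\<tau> (- r)\<close> and so outside
  P.\<close>

lemma tau_poly_notin:
  assumes P: "prime_ideal_of B P" and nt: "\<And>a. a \<in> k \<Longrightarrow> \<tau> a \<notin> P"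
  shows "\<phi> \<in> polys_over k \<Longrightarrow> \<phi> \<noteq> 0 \<Longrightarrow> poly \<phi> (\<tau> 0) \<notin> P"
proof (induction "degree \<phi>" arbitrary: \<phi>)
  case 0
  obtain c where c: "\<phi> = [:c:]" using degree_eq_zeroE[OF 0(1)[symmetric]] .
  then have c': "c \<in> k" "c \<noteq> 0" using 0 polys_over_closed(6)[OF ks] by auto
  then have "inverse c \<in> B" using k kS SB unfolding subfield_def by blast
  then show ?case using c c' ideal_mult[OF prime_idealD(1)[OF P], of "inverse c" c] prime_idealD(2)[OF P] by auto
next
  case (Suc n)
  then obtain r where r: "r \<in> k" "poly \<phi> r = 0" using alg_closed_root[OF alg, of \<phi>] by auto
  define \<psi> where "\<psi> = synthetic_div \<phi> r"
  have \<psi>: "\<psi> \<in> polys_over k" unfolding \<psi>_def using synthetic_div_polys_over[OF ks r(1)] Suc by blast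
  have eq: "\<phi> = [:- r, 1:] * \<psi>" unfolding \<psi>_def using synthetic_div_correct'[of r \<phi>] r by simp
  have "\<psi> \<noteq> 0" using eq Suc by auto
  moreover have "degree \<psi> = n" unfolding \<psi>_def using Suc.hyps by (simp add: degree_synthetic_div)
  ultimately have nP: "poly \<psi> (\<tau> 0) \<notin> P" using Suc.hyps \<psi> by blast
  have mr: "- r \<in> k" using subring_uminus[OF ks r(1)] .
  have "poly [:- r, 1:] (\<tau> 0) = \<tau> (- r)" using y0 by (simp add: field_simps)
  then have "poly \<phi> (\<tau> 0) = \<tau> (- r) * poly \<psi> (\<tau> 0)" unfolding eq poly_mult by (simp only:)
  moreover have "\<psi> \<in> polys_over S" using \<psi> kS unfolding polys_over_def by blast
  then have "poly \<psi> (\<tau> 0) \<in> B" using poly_in_subring[OF S _ tauS[OF subring_0[OF ks]]] SB by blast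
  moreover have "\<tau> (- r) \<in> B" using tauS[OF mr] SB by blast
  ultimately show ?case using prime_idealD(3)[OF P, of "\<tau> (- r)" "poly \<psi> (\<tau> 0)"] nP nt[OF mr] by (simp only:) blast
qed

text \<open>From y = \<open>\<tau> 0 * \<upsilon> 0\<close> in P follows \<open>\<upsilon> 0\<close>
  in P. An element of P in S[\<open>\<upsilon> 0\<close>] that is a unit at 0 therefore has its
  constant term f0 in P. Modulo y, f0 is a polynomial in \<open>\<tau> 0\<close> over k, non-zero
  because f0 is a unit at 0, against \<open>tau_poly_notin\<close>. The index 0 is merely a
  convenient element of k.\<close>

lemma subset_center_if_no_tau:
  assumes P: "prime_ideal_of B P" and yP: "y \<in> P" and nt: "\<And>a. a \<in> k \<Longrightarrow> \<tau> a \<notin> P"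
  shows "P \<subseteq> center 0"
proof
  fix s assume sP: "s \<in> P"
  note I = prime_idealD(1)[OF P]
  have z: "0 \<in> k" using subring_0[OF ks] .
  have tB: "\<tau> 0 \<in> B" using tauS[OF z] SB by blast
  have "\<tau> 0 * \<upsilon> 0 \<in> P" unfolding tau_upsilon[OF z] by (rule yP)
  then have uP: "\<upsilon> 0 \<in> P" using prime_idealD(3)[OF P tB upsilon_B[OF z]] nt[OF z] by blast
  show "s \<in> center 0"
  proof (rule ccontr)
    assume "s \<notin> center 0"
    then obtain f g where f: "f \<in> adjoin S (\<upsilon> 0)" "g \<in> B" "f = s * g" "f \<notin> \<mm> 0"
      using center_complement[OF z ideal_sub[OF I sP]] by blast
    have fP: "f \<in> P" using f sP ideal_mult_right[OF I] by blast
    obtain F where F: "F \<in> polys_over S" "f = poly F (\<upsilon> 0)" using f unfolding adjoin_eq[OF S] by blast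
    obtain f0 G where G: "F = pCons f0 G" by (cases F)
    then have G': "f0 \<in> S" "G \<in> polys_over S" using F polys_over_closed(6)[OF S] by auto
    define w where "w = poly G (\<upsilon> 0)"
    have "G \<in> polys_over B" using G' SB unfolding polys_over_def by blast
    then have w: "w \<in> B" unfolding w_def using poly_in_subring[OF B _ upsilon_B[OF z]] by blast
    have f_eq: "f = f0 + \<upsilon> 0 * w" unfolding F(2) G w_def by (rule poly_pCons)
    have "f - \<upsilon> 0 * w \<in> P" using ideal_diff[OF B I fP ideal_mult_right[OF I uP w]] .
    then have f0P: "f0 \<in> P" using f_eq by simp
    have um: "\<upsilon> 0 * w \<in> \<mm> 0" using ideal_mult_right[OF ideal_m[OF z] upsilon_m[OF z]] w B_beta[OF z] by blast
    have f0m: "f0 \<notin> \<mm> 0" using f(4) ideal_add[OF ideal_m[OF z] _ um, of f0] f_eq by auto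
    obtain \<phi> where \<phi>: "\<phi> \<in> polys_over k" "dvd_in S y (f0 - poly \<phi> (\<tau> 0))"
      using quadratic.S_mod_q[OF quadratic_D[OF z], unfolded qS_eq[OF z], OF G'(1)] by blast
    obtain e where e: "e \<in> S" "f0 - poly \<phi> (\<tau> 0) = y * e" using \<phi> unfolding dvd_in_def by blast
    have "\<phi> \<noteq> 0"
    proof
      assume "\<phi> = 0"
      then have "f0 = y * e" using e by simp
      then show False using f0m ideal_mult_right[OF ideal_m[OF z] y_m[OF z]] e S_beta[OF z] by blast
    qed
    moreover have "f0 - y * e \<in> P" using e SB ideal_diff[OF B I f0P ideal_mult_right[OF I yP]] by blast
    moreover have "f0 - y * e = poly \<phi> (\<tau> 0)" unfolding e(2)[symmetric] by (rule diff_diff_eq2[THEN trans]) simp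
    ultimately show False using tau_poly_notin[OF P nt \<phi>(1)] by simp
  qed
qed

text \<open>A prime inside the center of \<open>\<beta> a\<close> inverts more elements of B, so its
  localization contains \<open>\<beta> a\<close> and is a localization of that factorial
  ring.\<close>

lemma krull_at_y:
  assumes P: "prime_ideal_of B P" and yP: "y \<in> P"
  shows "krull_domain (loc B P)"
proof -
  obtain a where a: "a \<in> k" "P \<subseteq> center a"
  proof (cases "\<exists>a\<in>k. \<tau> a \<in> P")
    case True
    then obtain a where "a \<in> k" "\<tau> a \<in> P" by blast
    then show ?thesis by (intro that subset_center_if_tau[OF P])
  next
    case False
    then have "P \<subseteq> center 0" by (intro subset_center_if_no_tau[OF P yP]) blast
    then show ?thesis using that subring_0[OF ks] by blast
  qed
  have L: "localization_of B (loc B P)" using loc_localization(1)[OF B P] .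
  have "\<beta> a \<subseteq> loc B P" unfolding essential[OF a(1)] loc_def using a(2) by blast
  then have "localization_of (\<beta> a) (loc B P)"
    using L beta[OF a(1)] B_beta[OF a(1)] unfolding localization_of_def by blast
  then show ?thesis using localization_ufd ufd_beta[OF a(1)] ufd_krull_domain by blast
qed

lemma almost_krull_B: "almost_krull B"
  unfolding almost_krull_def
proof (intro conjI allI impI B)
  fix P assume "prime_ideal_of B P"
  then show "krull_domain (loc B P)"
    by (cases "y \<in> P") (rule krull_at_y krull_away_from_y; assumption)+
qed

end

theorem theorem6p15:
  fixes D k :: "'a::field set" and x y :: 'a
  assumes "regular_local_dim2 D x y"
    and "coefficient_field D (genideal D {x, y}) k"
    and "alg_closed_subfield k"
  defines "B \<equiv> (\<Inter>a\<in>k. beta_ring D x y a)"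
  shows "almost_krull B \<and> \<not> noetherian B
    \<and> (\<forall>b\<in>k. (\<Inter>a\<in>k - {b}. beta_ring D x y a) \<noteq> B)
    \<and> (\<forall>a\<in>k. \<exists>P. prime_ideal_of B P \<and> beta_ring D x y a = loc B P)"
proof -
  interpret regular2 D x y by standard (rule assms)
  have "coefficient_field D (lin D x y) k" using assms(2) unfolding genideal_lin[OF D xD yD] .
  then interpret E: beta_family D x y k
    by (intro beta_family.intro beta_family_axioms.intro regular2_axioms assms(3))
  have B: "B = E.B" unfolding E.B_def assms(4) ..
  show ?thesis
    unfolding B
  proof (intro conjI ballI)
    show "\<exists>P. prime_ideal_of E.B P \<and> beta_ring D x y a = loc E.B P" if "a \<in> k" for a
      using E.prime_center[OF that] E.essential[OF that] by blast
  qed (rule E.almost_krull_B E.not_noetherian E.irredundant; assumption?)+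
qed

end
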